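(* The matrix-valued weights of the point masses $\lambda_n$ (the eigenvalues) of $\mathbf L_0$ are given by $$\boldsymbol\mu\{\lambda_n\}=-i\lim_{\varepsilon\searrow0}\varepsilon\,\frac{1}{u_2^{[0]}(b,\lambda_n+i\varepsilon)}\begin{pmatrix}-u_1^{[0]}(b,\lambda_n+i\varepsilon)&1\\1&-u_2^{[1]}(b,\lambda_n+i\varepsilon)\end{pmatrix}.$$ In particular, the multiplicity of each eigenvalue of $\mathbf L_0$ is one.
   Context: Setting. Let $-\infty\le a<b\le\infty$, let $p,w>0$ a.e. and $q$ real-valued a.e. on $(a,b)$ with $1/p,q,w\in L^1_{\rm loc}((a,b),dx)$, and put $\ell[f]=-\frac1w\big((pf')'+qf\big)$, acting in $L^2[(a,b),w]$ with $\langle f,g\rangle=\int_a^b f\overline g\,w\,dx$. Let $\mathcal D_{\max}=\{f: f,pf'\in AC_{\rm loc}(a,b),\ f,\ell[f]\in L^2[(a,b),w]\}$ and $[f,g](x)=p(x)\big(f(x)\overline{g'(x)}-f'(x)\overline{g(x)}\big)$; for $f,g\in\mathcal D_{\max}$ the limits at the endpoints exist. Let $\mathcal D_{\min}=\{f\in\mathcal D_{\max}:[f,g](b)-[f,g](a)=0\ \forall g\in\mathcal D_{\max}\}$, and let $\mathbf L_{\max},\mathbf L_{\min}$ be $\ell$ with domains $\mathcal D_{\max},\mathcal D_{\min}$. Standing assumptions: both endpoints are limit-circle, and $\mathbf L_{\min}$ is semi-bounded from below with lower bound $K\in\mathbb R$ (so the endpoints are non-oscillating). Quasi-derivatives. Fix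 $\lambda_0\in\mathbb R$. A real solution $u$ of $(\ell-\lambda_0)y=0$ is principal (non-principal) at an endpoint if $1/(pu^2)$ is not integrable (is integrable) there. Let $u_a,v_a$ (resp. $u_b,v_b$) be real principal and non-principal solutions of $(\ell-\lambda_0)y=0$ at $a$ (resp. $b$) with $[u_a,v_a](a)=1$, $[u_b,v_b](b)=1$. For $f\in\mathcal D_{\max}$: $f^{[0]}(a)=[f,v_a](a)$, $f^{[1]}(a)=-[f,u_a](a)$, $f^{[0]}(b)=[f,v_b](b)$, $f^{[1]}(b)=-[f,u_b](b)$. For $\lambda\in\mathbb C$ let $u_1(\cdot,\lambda),u_2(\cdot,\lambda)$ be the solutions of $(\ell-\lambda)y=0$ with $u_1^{[0]}(a,\lambda)=1,\ u_1^{[1]}(a,\lambda)=0,\ u_2^{[0]}(a,\lambda)=0,\ u_2^{[1]}(a,\lambda)=1$; they satisfy $u_1^{[0]}(b,\lambda)u_2^{[1]}(b,\lambda)-u_1^{[1]}(b,\lambda)u_2^{[0]}(b,\lambda)=1$. Operator and spectral measure. $\mathbf L_0$ is the self-adjoint restriction of $\mathbf L_{\max}$ to $\{f\in\mathcal D_{\max}: f^{[0]}(a)=f^{[0]}(b)=0\}$; its spectrum is discrete, consisting of eigenvalues $\lambda_n$, $n\in\mathbb N_0$. With $\Gamma_0f=(f^{[0]}(a),f^{[0]}(b))^T$, $\Gamma_1f=(f^{[1]}(a),-f^{[1]}(b))^T$, its Weyl function $M_0(\lambda)$, $\lambda\in\rho(\mathbf L_0)$, is the $2\times2$ matrix with $\Gamma_1f=M_0(\lambda)\Gamma_0f$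 for all $f\in\ker(\mathbf L_{\max}-\lambda)$. It is a matrix-valued Herglotz function, and $\boldsymbol\mu$ is the matrix-valued measure in its representation $M_0(z)=C+Dz+\int_{\mathbb R}\big((s-z)^{-1}-s(1+s^2)^{-1}\big)d\boldsymbol\mu(s)$, $z\in\mathbb C_+$. *)

theory Defs
  imports "HOL-Analysis.Analysis" "HOL-Library.Function_Algebras"
begin

definition abs_cont_on :: "real \<Rightarrow> real \<Rightarrow> (real \<Rightarrow> complex) \<Rightarrow> bool" where
  "abs_cont_on c d f \<longleftrightarrow>
     (\<forall>e>0. \<exists>\<delta>>0. \<forall>\<D> :: (real \<times> real) set.
        finite \<D> \<longrightarrow> (\<forall>(x, y)\<in>\<D>. c \<le> x \<and> x \<le> y \<and> y \<le> d) \<longrightarrow>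
        pairwise (\<lambda>i j. {fst i<..<snd i} \<inter> {fst j<..<snd j} = {}) \<D> \<longrightarrow>
        (\<Sum>(x, y)\<in>\<D>. y - x) < \<delta> \<longrightarrow> (\<Sum>(x, y)\<in>\<D>. norm (f y - f x)) < e)"

definition AC_loc :: "ereal \<Rightarrow> ereal \<Rightarrow> (real \<Rightarrow> complex) \<Rightarrow> bool" where
  "AC_loc a b f \<longleftrightarrow> (\<forall>c d. a < ereal c \<longrightarrow> c \<le> d \<longrightarrow> ereal d < b \<longrightarrow> abs_cont_on c d f)"

definition L1_loc :: "ereal \<Rightarrow> ereal \<Rightarrow> (real \<Rightarrow> real) \<Rightarrow> bool" where
  "L1_loc a b f \<longleftrightarrow>
     (\<forall>c d. a < ereal c \<longrightarrow> c \<le> d \<longrightarrow> ereal d < b \<longrightarrow> f absolutely_integrable_on {c..d})"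

record sl_data =
  lend :: ereal
  rend :: ereal
  cp :: "real \<Rightarrow> real"
  cq :: "real \<Rightarrow> real"
  cw :: "real \<Rightarrow> real"

definition sl_int :: "sl_data \<Rightarrow> real set" where
  "sl_int S = einterval (lend S) (rend S)"

definition sl_coeffs :: "sl_data \<Rightarrow> bool" where
  "sl_coeffs S \<longleftrightarrow> lend S < rend S \<and>
     (AE x in lebesgue_on (sl_int S). 0 < cp S x) \<and>
     (AE x in lebesgue_on (sl_int S). 0 < cw S x) \<and>
     L1_loc (lend S) (rend S) (\<lambda>x. 1 / cp S x) \<and>
     L1_loc (lend S) (rend S) (cq S) \<and>
     L1_loc (lend S) (rend S) (cw S)"

definition L2w :: "sl_data \<Rightarrow> (real \<Rightarrow> complex) set" where
  "L2w S = {f. f \<in> borel_measurable (lebesgue_on (sl_int S)) \<and>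
     integrable (lebesgue_on (sl_int S)) (\<lambda>x. (norm (f x))\<^sup>2 * cw S x)}"

definition ipw :: "sl_data \<Rightarrow> (real \<Rightarrow> complex) \<Rightarrow> (real \<Rightarrow> complex) \<Rightarrow> complex" where
  "ipw S f g = (LINT x|lebesgue_on (sl_int S). f x * cnj (g x) * of_real (cw S x))"

definition normw :: "sl_data \<Rightarrow> (real \<Rightarrow> complex) \<Rightarrow> real" where
  "normw S f = sqrt (Re (ipw S f f))"

text \<open>The product \<open>p f'\<close> is only defined almost everywhere. The condition that it is locally
  absolutely continuous means that it has a (then unique) locally absolutely continuous
  representative on the interval, which is the function used in the brackets. Off the interval
  the representative is normalised to 0.\<close>

definition is_pderiv :: "sl_data \<Rightarrow> (real \<Rightarrow> complex) \<Rightarrow> (real \<Rightarrow> complex) \<Rightarrow> bool" where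
  "is_pderiv S f h \<longleftrightarrow> AC_loc (lend S) (rend S) h \<and> (\<forall>x. x \<notin> sl_int S \<longrightarrow> h x = 0) \<and>
     (AE x in lebesgue_on (sl_int S). h x = of_real (cp S x) * vector_derivative f (at x))"

definition pderiv_rep :: "sl_data \<Rightarrow> (real \<Rightarrow> complex) \<Rightarrow> real \<Rightarrow> complex" where
  "pderiv_rep S f = (THE h. is_pderiv S f h)"

definition sl_regular :: "sl_data \<Rightarrow> (real \<Rightarrow> complex) \<Rightarrow> bool" where
  "sl_regular S f \<longleftrightarrow> AC_loc (lend S) (rend S) f \<and> (\<exists>h. is_pderiv S f h)"

definition ell :: "sl_data \<Rightarrow> (real \<Rightarrow> complex) \<Rightarrow> real \<Rightarrow> complex" where
  "ell S f x = - (1 / of_real (cw S x)) *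
     (vector_derivative (pderiv_rep S f) (at x) + of_real (cq S x) * f x)"

definition sl_solution :: "sl_data \<Rightarrow> complex \<Rightarrow> (real \<Rightarrow> complex) \<Rightarrow> bool" where
  "sl_solution S z f \<longleftrightarrow> sl_regular S f \<and>
     (AE x in lebesgue_on (sl_int S). ell S f x - z * f x = 0)"

text \<open>Elements of the domain are continuous functions on the open interval. They are represented
  by total functions vanishing off the interval, so that equality of functions is equality on the
  interval and the dimension of an eigenspace is meaningful. (Two such functions agreeing almost
  everywhere are equal, so there is no need for equivalence classes.)\<close>

definition Dmax :: "sl_data \<Rightarrow> (real \<Rightarrow> complex) set" where
  "Dmax S = {f. sl_regular S f \<and> (\<forall>x. x \<notin> sl_int S \<longrightarrow> f x = 0) \<and> f \<in> L2w S \<and> ell S f \<in> L2w S}"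

definition sl_bracket ::
  "sl_data \<Rightarrow> (real \<Rightarrow> complex) \<Rightarrow> (real \<Rightarrow> complex) \<Rightarrow> real \<Rightarrow> complex" where
  "sl_bracket S f g x = f x * cnj (pderiv_rep S g x) - pderiv_rep S f x * cnj (g x)"

text \<open>Limits at a possibly infinite endpoint are taken in the extended reals, as for
  interval integrals.\<close>

definition bracket_a :: "sl_data \<Rightarrow> (real \<Rightarrow> complex) \<Rightarrow> (real \<Rightarrow> complex) \<Rightarrow> complex" where
  "bracket_a S f g = Lim (at_right (lend S)) (sl_bracket S f g \<circ> real_of_ereal)"

definition bracket_b :: "sl_data \<Rightarrow> (real \<Rightarrow> complex) \<Rightarrow> (real \<Rightarrow> complex) \<Rightarrow> complex" where
  "bracket_b S f g = Lim (at_left (rend S)) (sl_bracket S f g \<circ> real_of_ereal)"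

definition Dmin :: "sl_data \<Rightarrow> (real \<Rightarrow> complex) set" where
  "Dmin S = {f \<in> Dmax S. \<forall>g\<in>Dmax S. bracket_b S f g - bracket_a S f g = 0}"

definition bounded_below :: "sl_data \<Rightarrow> (real \<Rightarrow> complex) set \<Rightarrow> real \<Rightarrow> bool" where
  "bounded_below S D K \<longleftrightarrow> (\<forall>f\<in>D. K * Re (ipw S f f) \<le> Re (ipw S (ell S f) f))"

text \<open>By the Weyl alternative, square integrability of all solutions for one \<open>z\<close> is equivalent to
  square integrability of all solutions for every \<open>z\<close>; the latter is taken as the definition.\<close>

definition limit_circle_a :: "sl_data \<Rightarrow> bool" where
  "limit_circle_a S \<longleftrightarrow> (\<forall>z f. sl_solution S z f \<longrightarrow>
     (\<exists>c\<in>sl_int S. set_integrable lebesgue (einterval (lend S) c) (\<lambda>x. (norm (f x))\<^sup>2 * cw S x)))"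

definition limit_circle_b :: "sl_data \<Rightarrow> bool" where
  "limit_circle_b S \<longleftrightarrow> (\<forall>z f. sl_solution S z f \<longrightarrow>
     (\<exists>c\<in>sl_int S. set_integrable lebesgue (einterval c (rend S)) (\<lambda>x. (norm (f x))\<^sup>2 * cw S x)))"

text \<open>Integrability of \<open>1 / (p u\<^sup>2)\<close> at an endpoint is understood on a one-sided
  neighbourhood free of zeros of \<open>u\<close>, including its inner endpoint: an interior zero
  would always destroy integrability.\<close>

definition principal_a :: "sl_data \<Rightarrow> complex \<Rightarrow> (real \<Rightarrow> real) \<Rightarrow> bool" where
  "principal_a S z u \<longleftrightarrow> sl_solution S z (\<lambda>x. of_real (u x)) \<and>
     (\<exists>c\<in>sl_int S. (\<forall>x\<in>sl_int S. x \<le> c \<longrightarrow> u x \<noteq> 0) \<and>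
        \<not> set_integrable lebesgue (einterval (lend S) c) (\<lambda>x. 1 / (cp S x * (u x)\<^sup>2)))"

definition nonprincipal_a :: "sl_data \<Rightarrow> complex \<Rightarrow> (real \<Rightarrow> real) \<Rightarrow> bool" where
  "nonprincipal_a S z u \<longleftrightarrow> sl_solution S z (\<lambda>x. of_real (u x)) \<and>
     (\<exists>c\<in>sl_int S. (\<forall>x\<in>sl_int S. x \<le> c \<longrightarrow> u x \<noteq> 0) \<and>
        set_integrable lebesgue (einterval (lend S) c) (\<lambda>x. 1 / (cp S x * (u x)\<^sup>2)))"

definition principal_b :: "sl_data \<Rightarrow> complex \<Rightarrow> (real \<Rightarrow> real) \<Rightarrow> bool" where
  "principal_b S z u \<longleftrightarrow> sl_solution S z (\<lambda>x. of_real (u x)) \<and>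
     (\<exists>c\<in>sl_int S. (\<forall>x\<in>sl_int S. c \<le> x \<longrightarrow> u x \<noteq> 0) \<and>
        \<not> set_integrable lebesgue (einterval c (rend S)) (\<lambda>x. 1 / (cp S x * (u x)\<^sup>2)))"

definition nonprincipal_b :: "sl_data \<Rightarrow> complex \<Rightarrow> (real \<Rightarrow> real) \<Rightarrow> bool" where
  "nonprincipal_b S z u \<longleftrightarrow> sl_solution S z (\<lambda>x. of_real (u x)) \<and>
     (\<exists>c\<in>sl_int S. (\<forall>x\<in>sl_int S. c \<le> x \<longrightarrow> u x \<noteq> 0) \<and>
        set_integrable lebesgue (einterval c (rend S)) (\<lambda>x. 1 / (cp S x * (u x)\<^sup>2)))"

record sl_frame =
  ua :: "real \<Rightarrow> real"
  va :: "real \<Rightarrow> real"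
  ub :: "real \<Rightarrow> real"
  vb :: "real \<Rightarrow> real"

definition is_frame :: "sl_data \<Rightarrow> real \<Rightarrow> sl_frame \<Rightarrow> bool" where
  "is_frame S lam0 F \<longleftrightarrow>
     principal_a S (of_real lam0) (ua F) \<and> nonprincipal_a S (of_real lam0) (va F) \<and>
     principal_b S (of_real lam0) (ub F) \<and> nonprincipal_b S (of_real lam0) (vb F) \<and>
     bracket_a S (\<lambda>x. of_real (ua F x)) (\<lambda>x. of_real (va F x)) = 1 \<and>
     bracket_b S (\<lambda>x. of_real (ub F x)) (\<lambda>x. of_real (vb F x)) = 1"

definition qd0_a :: "sl_data \<Rightarrow> sl_frame \<Rightarrow> (real \<Rightarrow> complex) \<Rightarrow> complex" where
  "qd0_a S F f = bracket_a S f (\<lambda>x. of_real (va F x))"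

definition qd1_a :: "sl_data \<Rightarrow> sl_frame \<Rightarrow> (real \<Rightarrow> complex) \<Rightarrow> complex" where
  "qd1_a S F f = - bracket_a S f (\<lambda>x. of_real (ua F x))"

definition qd0_b :: "sl_data \<Rightarrow> sl_frame \<Rightarrow> (real \<Rightarrow> complex) \<Rightarrow> complex" where
  "qd0_b S F f = bracket_b S f (\<lambda>x. of_real (vb F x))"

definition qd1_b :: "sl_data \<Rightarrow> sl_frame \<Rightarrow> (real \<Rightarrow> complex) \<Rightarrow> complex" where
  "qd1_b S F f = - bracket_b S f (\<lambda>x. of_real (ub F x))"

definition fundamental_system ::
  "sl_data \<Rightarrow> sl_frame \<Rightarrow> (complex \<Rightarrow> real \<Rightarrow> complex) \<Rightarrow> (complex \<Rightarrow> real \<Rightarrow> complex) \<Rightarrow> bool" where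
  "fundamental_system S F u1 u2 \<longleftrightarrow> (\<forall>z.
     sl_solution S z (u1 z) \<and> qd0_a S F (u1 z) = 1 \<and> qd1_a S F (u1 z) = 0 \<and>
     sl_solution S z (u2 z) \<and> qd0_a S F (u2 z) = 0 \<and> qd1_a S F (u2 z) = 1)"

text \<open>A restriction of \<open>L_max\<close> is given by its domain \<open>D \<subseteq> D_max\<close>.\<close>

definition sl_kernel :: "sl_data \<Rightarrow> (real \<Rightarrow> complex) set \<Rightarrow> complex \<Rightarrow> (real \<Rightarrow> complex) set" where
  "sl_kernel S D z = {f \<in> D. AE x in lebesgue_on (sl_int S). ell S f x - z * f x = 0}"

definition sl_eigenvalue :: "sl_data \<Rightarrow> (real \<Rightarrow> complex) set \<Rightarrow> complex \<Rightarrow> bool" where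
  "sl_eigenvalue S D z \<longleftrightarrow> (\<exists>f\<in>sl_kernel S D z. f \<noteq> 0)"

interpretation cfun: vector_space "\<lambda>(c :: complex) (f :: real \<Rightarrow> complex) x. c * f x"
  by unfold_locales (auto simp: fun_eq_iff algebra_simps)

definition sl_multiplicity :: "sl_data \<Rightarrow> (real \<Rightarrow> complex) set \<Rightarrow> complex \<Rightarrow> nat" where
  "sl_multiplicity S D z = cfun.dim (sl_kernel S D z)"

definition sl_resolvent_set :: "sl_data \<Rightarrow> (real \<Rightarrow> complex) set \<Rightarrow> complex set" where
  "sl_resolvent_set S D = {z.
     (\<forall>g\<in>L2w S. \<exists>!f. f \<in> D \<and> (AE x in lebesgue_on (sl_int S). ell S f x - z * f x = g x)) \<and>
     (\<exists>C. \<forall>f\<in>D. normw S f \<le> C * normw S (\<lambda>x. ell S f x - z * f x))}"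

definition dom_L0 :: "sl_data \<Rightarrow> sl_frame \<Rightarrow> (real \<Rightarrow> complex) set" where
  "dom_L0 S F = {f \<in> Dmax S. qd0_a S F f = 0 \<and> qd0_b S F f = 0}"

definition Gamma0 :: "sl_data \<Rightarrow> sl_frame \<Rightarrow> (real \<Rightarrow> complex) \<Rightarrow> complex^2" where
  "Gamma0 S F f = vector [qd0_a S F f, qd0_b S F f]"

definition Gamma1 :: "sl_data \<Rightarrow> sl_frame \<Rightarrow> (real \<Rightarrow> complex) \<Rightarrow> complex^2" where
  "Gamma1 S F f = vector [qd1_a S F f, - qd1_b S F f]"

definition is_Weyl_function :: "sl_data \<Rightarrow> sl_frame \<Rightarrow> (complex \<Rightarrow> complex^2^2) \<Rightarrow> bool" where
  "is_Weyl_function S F M \<longleftrightarrow>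
     (\<forall>z\<in>sl_resolvent_set S (dom_L0 S F). \<forall>f\<in>sl_kernel S (Dmax S) z.
        Gamma1 S F f = M z *v Gamma0 S F f)"

definition mat_scale :: "complex \<Rightarrow> complex^'n^'m \<Rightarrow> complex^'n^'m" (infixr "*\<^sub>m" 75) where
  "c *\<^sub>m A = map_matrix (\<lambda>x. c * x) A"

definition quad :: "complex^'n^'n \<Rightarrow> complex^'n \<Rightarrow> complex" where
  "quad A \<xi> = (\<Sum>i\<in>UNIV. cnj (\<xi> $ i) * (A *v \<xi>) $ i)"

definition hermitian :: "complex^'n^'n \<Rightarrow> bool" where
  "hermitian A \<longleftrightarrow> (\<forall>i j. A $ i $ j = cnj (A $ j $ i))"

definition psd :: "complex^'n^'n \<Rightarrow> bool" where
  "psd A \<longleftrightarrow> hermitian A \<and> (\<forall>\<xi>. 0 \<le> Re (quad A \<xi>))"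

text \<open>A matrix-valued measure need not be finite, so it is a set function whose values are
  meaningful on bounded Borel sets only.\<close>

definition matrix_measure :: "(real set \<Rightarrow> complex^'n^'n) \<Rightarrow> bool" where
  "matrix_measure \<mu> \<longleftrightarrow>
     (\<forall>A\<in>sets borel. bounded A \<longrightarrow> psd (\<mu> A)) \<and>
     (\<forall>A :: nat \<Rightarrow> real set. range A \<subseteq> sets borel \<longrightarrow> disjoint_family A \<longrightarrow> bounded (\<Union>i. A i) \<longrightarrow>
        (\<lambda>i. \<mu> (A i)) sums \<mu> (\<Union>i. A i))"

text \<open>The positive Borel measure \<open>A \<mapsto> \<xi>\<^sup>* \<mu>(A) \<xi>\<close>, extended from bounded to arbitrary Borel
  sets by monotone limits.\<close>

definition quad_measure :: "(real set \<Rightarrow> complex^'n^'n) \<Rightarrow> complex^'n \<Rightarrow> real measure" where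
  "quad_measure \<mu> \<xi> = measure_of UNIV (sets borel)
     (\<lambda>A. SUP n::nat. ennreal (Re (quad (\<mu> (A \<inter> {- real n..real n})) \<xi>)))"

text \<open>Integration against the entries \<open>\<mu>\<^sub>i\<^sub>j\<close>, which are complex measures on bounded sets only,
  is reduced to positive measures by the polarisation identity
  \<open>4 A\<^sub>i\<^sub>j = \<Sum>\<omega>\<in>{1,\<i>,-1,-\<i>}. \<omega> (e\<^sub>j + \<omega> e\<^sub>i)\<^sup>* A (e\<^sub>j + \<omega> e\<^sub>i)\<close>.\<close>

definition mat_integral ::
  "(real set \<Rightarrow> complex^'n^'n) \<Rightarrow> (real \<Rightarrow> complex) \<Rightarrow> complex^'n^'n" where
  "mat_integral \<mu> h = (\<chi> i j. (\<Sum>k<4.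
     \<i> ^ k * (LINT s|quad_measure \<mu> (axis j 1 + axis i (\<i> ^ k)). h s)) / 4)"

definition Herglotz_rep ::
  "(complex \<Rightarrow> complex^'n^'n) \<Rightarrow> complex^'n^'n \<Rightarrow> complex^'n^'n \<Rightarrow> (real set \<Rightarrow> complex^'n^'n) \<Rightarrow> bool"
where
  "Herglotz_rep M C D \<mu> \<longleftrightarrow> hermitian C \<and> psd D \<and> matrix_measure \<mu> \<and>
     (\<forall>\<xi>. integrable (quad_measure \<mu> \<xi>) (\<lambda>s. 1 / (1 + s\<^sup>2))) \<and>
     (\<forall>z. Im z > 0 \<longrightarrow> M z = C + z *\<^sub>m D +
        mat_integral \<mu> (\<lambda>s. 1 / (of_real s - z) - of_real s / (1 + (of_real s)\<^sup>2)))"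

end

theory Submission
  imports Defs
begin

text \<open>
  An absolutely continuous function is the difference of two increasing absolutely continuous
  functions, whose Stieltjes measures have Lebesgue densities; by Lebesgue differentiation such a
  function is differentiable almost everywhere and is the integral of its derivative. Hence the
  modified Wronskian \<open>f (p g') - (p f') g\<close> is the integral of \<open>w (\<ell>[f] g - f \<ell>[g])\<close> and
  has limits at both ends, and the Pluecker identity expresses these limits through the
  quasi-derivatives.

  For non-real \<open>z\<close> Green's formula gives \<open>\<bar>Im z\<bar> \<parallel>f\<parallel> \<le> \<parallel>(L\<^sub>0 - z) f\<parallel>\<close>, so \<open>u\<^sub>2\<^sup>[\<^sup>0\<^sup>](b, z) \<noteq> 0\<close>, and variation of
  constants solves \<open>(L\<^sub>0 - z) f = g\<close>. Thus \<open>z\<close> is in the resolvent set, and evaluating the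
  defining relation of the Weyl function on \<open>u\<^sub>1, u\<^sub>2\<close> yields
  the matrix in the statement. Dominated convergence in the Herglotz
  representation gives \<open>- i \<epsilon> M\<^sub>0(\<lambda> + i \<epsilon>) \<longrightarrow> \<mu> {\<lambda>}\<close>. Eigenfunctions are multiples of \<open>u\<^sub>2\<close>, because every
  solution is \<open>f\<^sup>[\<^sup>0\<^sup>](a) u\<^sub>1 + f\<^sup>[\<^sup>1\<^sup>](a) u\<^sub>2\<close>.
\<close>

text \<open>The bracket is sesquilinear, but the computations use the bilinear
  \<open>wronskian\<close>: for two solutions with the same z it is constant, and the Pluecker
  identity for it is pure algebra. The frame functions are real, so the quasi-derivatives are limits
  of Wronskians without any conjugation. Since \<open>u1\<close> and \<open>u2\<close> are given for
  every z, and the limit-circle condition makes all solutions square integrable, the resolvent can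
  be written down by explicit integrals. The limit approaches the eigenvalue through non-real points
  only, where the estimate from Green's formula excludes a zero of the denominator. The factor -i
  eps comes from the Herglotz kernel: at s = lam one has s - z = -i eps, so -i eps / (s - z) = 1,
  whereas for any other s the product tends to 0. The entries of \<mu> are complex and need not be
  finite on the whole line; therefore the limit is taken for the positive measures of its quadratic
  forms, with the dominating function 1 / (1 + s^2) that the representation provides, and the
  entries are recovered by polarisation.\<close>

section \<open>Variation\<close>

text \<open>Degenerate pairs are excluded, so that families inside distinct members of a
  non-overlapping family are disjoint and sums over their union split.\<close>

definition nonoverlapping :: "(real \<times> real) set \<Rightarrow> bool" where
  "nonoverlapping D \<longleftrightarrow> finite D \<and> (\<forall>p\<in>D. fst p < snd p) \<and>
     pairwise (\<lambda>i j. {fst i<..<snd i} \<inter> {fst j<..<snd j} = {}) D"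

definition abs_cont :: "(real \<Rightarrow> real) \<Rightarrow> bool" where
  "abs_cont f \<longleftrightarrow> (\<forall>e>0. \<exists>d>0. \<forall>D. nonoverlapping D \<longrightarrow>
     (\<Sum>p\<in>D. snd p - fst p) < d \<longrightarrow> (\<Sum>p\<in>D. \<bar>f (snd p) - f (fst p)\<bar>) < e)"

definition families :: "real \<Rightarrow> real \<Rightarrow> (real \<times> real) set set" where
  "families x y = {D. nonoverlapping D \<and> (\<forall>p\<in>D. x \<le> fst p \<and> snd p \<le> y)}"

text \<open>Values in \<open>ennreal\<close> let the supremum exist before it is known to be finite,
  which is where absolute continuity enters. For x = y only the empty family is left and the value
  is 0.\<close>

definition variation :: "(real \<Rightarrow> real) \<Rightarrow> real \<Rightarrow> real \<Rightarrow> ennreal" where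
  "variation f x y = (SUP D\<in>families x y. ennreal (\<Sum>p\<in>D. \<bar>f (snd p) - f (fst p)\<bar>))"

section \<open>Combinatorics of non-overlapping families of intervals\<close>

lemma disjoint_open_intervals_iff:
  fixes u v x y :: real
  assumes "u < v" "x < y"
  shows "{u<..<v} \<inter> {x<..<y} = {} \<longleftrightarrow> v \<le> x \<or> y \<le> u"
proof
  show "v \<le> x \<or> y \<le> u" if "{u<..<v} \<inter> {x<..<y} = {}"
  proof (rule ccontr)
    assume "\<not> ?thesis"
    then have "max u x < min v y" using assms by auto
    then obtain t where "max u x < t" "t < min v y" using dense by blast
    with that show False by auto
  qed
qed auto

lemma nonoverlapping_ordered:
  assumes "nonoverlapping D" "p \<in> D" "q \<in> D" "p \<noteq> q"
  shows "snd p \<le> fst q \<or> snd q \<le> fst p"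
  using assms disjoint_open_intervals_iff[of "fst p" "snd p" "fst q" "snd q"]
  unfolding nonoverlapping_def pairwise_def by blast

lemma nonoverlappingI:
  assumes "finite D" "\<And>p. p \<in> D \<Longrightarrow> fst p < snd p"
    and "\<And>p q. p \<in> D \<Longrightarrow> q \<in> D \<Longrightarrow> p \<noteq> q \<Longrightarrow> snd p \<le> fst q \<or> snd q \<le> fst p"
  shows "nonoverlapping D"
  unfolding nonoverlapping_def pairwise_def
  using assms by (metis disjoint_open_intervals_iff)

text \<open>The total length is the Lebesgue measure of a disjoint union of open intervals inside
  [x, y].\<close>

lemma sum_lengths_le:
  assumes "D \<in> families x y" "x \<le> y"
  shows "(\<Sum>p\<in>D. snd p - fst p) \<le> y - x"
proof -
  have D: "finite D" "\<And>p. p \<in> D \<Longrightarrow> fst p < snd p" "\<And>p. p \<in> D \<Longrightarrow> x \<le> fst p \<and> snd p \<le> y"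
    using assms by (auto simp: families_def nonoverlapping_def)
  have "(\<Sum>p\<in>D. snd p - fst p) = (\<Sum>p\<in>D. measure lborel {fst p<..<snd p})"
    using D by (intro sum.cong) (auto simp: less_imp_le)
  also have "\<dots> = measure lborel (\<Union>p\<in>D. {fst p<..<snd p})"
  proof (rule measure_UNION'[symmetric])
    show "{fst p<..<snd p} \<in> fmeasurable lborel" if "p \<in> D" for p
      using D(2)[OF that] by (simp add: fmeasurable_def)
    show "pairwise (\<lambda>i j. disjnt {fst i<..<snd i} {fst j<..<snd j}) D"
      using assms by (auto simp: families_def nonoverlapping_def disjnt_def)
  qed (use D in auto)
  also have "\<dots> \<le> measure lborel {x..y}"
  proof (rule measure_mono_fmeasurable)
    show "(\<Union>p\<in>D. {fst p<..<snd p}) \<subseteq> {x..y}"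
      using D by fastforce
    show "{x..y} \<in> fmeasurable lborel" using assms by (simp add: fmeasurable_def)
  qed (use D in auto)
  finally show ?thesis using assms by simp
qed

lemma empty_family [simp]: "{} \<in> families x y"
  by (auto simp: families_def nonoverlapping_def)

lemma families_nonempty [simp]: "families x y \<noteq> {}"
  using empty_family by blast

text \<open>Families chosen separately inside the members of D can be pooled, so that absolute
  continuity applies to all of them at once.\<close>

lemma nonoverlapping_UN:
  assumes D: "nonoverlapping D" and E: "\<And>p. p \<in> D \<Longrightarrow> E p \<in> families (fst p) (snd p)"
  shows "nonoverlapping (\<Union>p\<in>D. E p)"
    and "sum h (\<Union>p\<in>D. E p) = (\<Sum>p\<in>D. sum h (E p))"
proof -
  have Ep: "finite (E p)" "\<And>q. q \<in> E p \<Longrightarrow> fst q < snd q \<and> fst p \<le> fst q \<and> snd q \<le> snd p" if "p \<in> D" for p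
    using E[OF that] by (auto simp: families_def nonoverlapping_def)
  have sep: "snd q \<le> fst q' \<or> snd q' \<le> fst q"
    if "p \<in> D" "p' \<in> D" "q \<in> E p" "q' \<in> E p'" "p \<noteq> p'" for p p' q q'
    using nonoverlapping_ordered[OF D that(1,2,5)] Ep(2)[OF that(1,3)] Ep(2)[OF that(2,4)] by linarith
  show "nonoverlapping (\<Union>p\<in>D. E p)"
  proof (rule nonoverlappingI)
    show "finite (\<Union>p\<in>D. E p)" using D Ep(1) by (auto simp: nonoverlapping_def)
    show "fst q < snd q" if "q \<in> (\<Union>p\<in>D. E p)" for q using that Ep(2) by blast
    show "snd q \<le> fst q' \<or> snd q' \<le> fst q"
      if qq: "q \<in> (\<Union>p\<in>D. E p)" "q' \<in> (\<Union>p\<in>D. E p)" "q \<noteq> q'" for q q'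
    proof -
      obtain p p' where p: "p \<in> D" "p' \<in> D" "q \<in> E p" "q' \<in> E p'" using qq by blast
      show ?thesis
      proof (cases "p = p'")
        case True
        then show ?thesis using nonoverlapping_ordered[of "E p" q q'] E[OF p(1)] p qq
          by (auto simp: families_def)
      qed (use sep p in blast)
    qed
  qed
  show "sum h (\<Union>p\<in>D. E p) = (\<Sum>p\<in>D. sum h (E p))"
  proof (rule sum.UNION_disjoint)
    show "\<forall>i\<in>D. \<forall>j\<in>D. i \<noteq> j \<longrightarrow> E i \<inter> E j = {}"
    proof (intro ballI impI)
      fix i j assume ij: "i \<in> D" "j \<in> D" "i \<noteq> j"
      { fix q assume q: "q \<in> E i" "q \<in> E j"
        then have False using sep[OF ij(1,2) q ij(3)] Ep(2)[OF ij(1) q(1)] by simp }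
      then show "E i \<inter> E j = {}" by blast
    qed
  qed (use D Ep in \<open>auto simp: nonoverlapping_def\<close>)
qed

text \<open>A monotone map keeps intervals in order but may collapse some of them to points. These
  are dropped, and sums of any h vanishing on degenerate pairs do not notice. It is applied to
  cutting at a point (\<open>min\<close>, \<open>max\<close>) and to clamping to a compact
  interval.\<close>

lemma mono_image_family:
  fixes \<phi> :: "real \<Rightarrow> real"
  assumes D: "nonoverlapping D" and \<phi>: "mono \<phi>"
  obtains E where "nonoverlapping E" "\<And>q. q \<in> E \<Longrightarrow> \<exists>p\<in>D. q = (\<phi> (fst p), \<phi> (snd p))"
    and "\<And>h :: real \<times> real \<Rightarrow> real. (\<And>t. h (t, t) = 0) \<Longrightarrow> sum h E = (\<Sum>p\<in>D. h (\<phi> (fst p), \<phi> (snd p)))"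
proof -
  define P where "P p = (\<phi> (fst p), \<phi> (snd p))" for p
  define D' where "D' = {p\<in>D. \<phi> (fst p) < \<phi> (snd p)}"
  have fin: "finite D" and D'D: "D' \<subseteq> D" using D by (auto simp: nonoverlapping_def D'_def)
  have le: "\<phi> (fst p) \<le> \<phi> (snd p)" if "p \<in> D" for p
    using D that by (intro monoD[OF \<phi>] less_imp_le) (auto simp: nonoverlapping_def)
  have sep: "\<phi> (snd p) \<le> \<phi> (fst q) \<or> \<phi> (snd q) \<le> \<phi> (fst p)" if "p \<in> D" "q \<in> D" "p \<noteq> q" for p q
    using nonoverlapping_ordered[OF D that] \<phi> by (auto simp: mono_def)
  have inj: "inj_on P D'"
  proof (rule inj_onI)
    fix p q assume "p \<in> D'" "q \<in> D'" "P p = P q"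
    then show "p = q" using sep[of p q] by (auto simp: P_def D'_def)
  qed
  show ?thesis
  proof (rule that)
    show "nonoverlapping (P ` D')"
    proof (rule nonoverlappingI)
      show "finite (P ` D')" using fin D'D finite_subset by blast
      show "fst q < snd q" if "q \<in> P ` D'" for q using that by (auto simp: P_def D'_def)
      show "snd q \<le> fst q' \<or> snd q' \<le> fst q" if "q \<in> P ` D'" "q' \<in> P ` D'" "q \<noteq> q'" for q q'
        using that sep by (fastforce simp: P_def D'_def)
    qed
    show "\<exists>p\<in>D. q = (\<phi> (fst p), \<phi> (snd p))" if "q \<in> P ` D'" for q
      using that by (auto simp: P_def D'_def)
    fix h :: "real \<times> real \<Rightarrow> real" assume h: "\<And>t. h (t, t) = 0"
    have "sum h (P ` D') = (\<Sum>p\<in>D'. h (P p))" by (simp add: sum.reindex[OF inj])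
    also have "\<dots> = (\<Sum>p\<in>D. h (P p))"
    proof (rule sum.mono_neutral_left[OF fin D'D])
      show "\<forall>i\<in>D - D'. h (P i) = 0"
        using le h by (fastforce simp: D'_def P_def)
    qed
    finally show "sum h (P ` D') = (\<Sum>p\<in>D. h (\<phi> (fst p), \<phi> (snd p)))" by (simp add: P_def)
  qed
qed

section \<open>Additivity of the total variation\<close>

lemma variation_ge: "D \<in> families x y \<Longrightarrow> ennreal (\<Sum>p\<in>D. \<bar>f (snd p) - f (fst p)\<bar>) \<le> variation f x y"
  unfolding variation_def by (rule SUP_upper)

lemma variation_ge_diff:
  assumes "x \<le> y"
  shows "ennreal \<bar>f y - f x\<bar> \<le> variation f x y"
proof (cases "x < y")
  case True
  then have "{(x, y)} \<in> families x y" by (auto simp: families_def nonoverlapping_def)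
  from variation_ge[OF this] show ?thesis by simp
qed (use assms in auto)

text \<open>Each interval is cut by t -> min t y and t -> max t y. Only an interval straddling y
  really splits, and there the triangle inequality is used.\<close>

lemma families_split:
  fixes f :: "real \<Rightarrow> real"
  assumes "D \<in> families x z" "x \<le> y" "y \<le> z"
  obtains D1 D2 where "D1 \<in> families x y" "D2 \<in> families y z"
    "(\<Sum>p\<in>D. \<bar>f (snd p) - f (fst p)\<bar>) \<le>
      (\<Sum>p\<in>D1. \<bar>f (snd p) - f (fst p)\<bar>) + (\<Sum>p\<in>D2. \<bar>f (snd p) - f (fst p)\<bar>)"
proof -
  have D: "nonoverlapping D" and Dxz: "\<And>p. p \<in> D \<Longrightarrow> x \<le> fst p \<and> snd p \<le> z \<and> fst p < snd p"
    using assms by (auto simp: families_def nonoverlapping_def)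
  have m1: "mono (\<lambda>t::real. min t y)" and m2: "mono (\<lambda>t::real. max t y)" by (auto simp: mono_def)
  let ?h = "\<lambda>p. \<bar>f (snd p) - f (fst p)\<bar>"
  obtain D1 where D1: "nonoverlapping D1" "\<And>q. q \<in> D1 \<Longrightarrow> \<exists>p\<in>D. q = (min (fst p) y, min (snd p) y)"
    "sum ?h D1 = (\<Sum>p\<in>D. ?h (min (fst p) y, min (snd p) y))"
  proof (rule mono_image_family[OF D m1])
    fix E assume E: "nonoverlapping E" "\<And>q. q \<in> E \<Longrightarrow> \<exists>p\<in>D. q = (min (fst p) y, min (snd p) y)"
      and h: "\<And>h :: real \<times> real \<Rightarrow> real. (\<And>t. h (t, t) = 0) \<Longrightarrow> sum h E = (\<Sum>p\<in>D. h (min (fst p) y, min (snd p) y))"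
    show thesis by (rule that[OF E]) (simp_all add: h[of ?h])
  qed
  obtain D2 where D2: "nonoverlapping D2" "\<And>q. q \<in> D2 \<Longrightarrow> \<exists>p\<in>D. q = (max (fst p) y, max (snd p) y)"
    "sum ?h D2 = (\<Sum>p\<in>D. ?h (max (fst p) y, max (snd p) y))"
  proof (rule mono_image_family[OF D m2])
    fix E assume E: "nonoverlapping E" "\<And>q. q \<in> E \<Longrightarrow> \<exists>p\<in>D. q = (max (fst p) y, max (snd p) y)"
      and h: "\<And>h :: real \<times> real \<Rightarrow> real. (\<And>t. h (t, t) = 0) \<Longrightarrow> sum h E = (\<Sum>p\<in>D. h (max (fst p) y, max (snd p) y))"
    show thesis by (rule that[OF E]) (simp_all add: h[of ?h])
  qed
  show ?thesis
  proof (rule that)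
    have "x \<le> fst q \<and> snd q \<le> y" if "q \<in> D1" for q
      using D1(2)[OF that] Dxz assms(2) by (auto simp: min_def)
    then show "D1 \<in> families x y" using D1(1) by (auto simp: families_def)
    have "y \<le> fst q \<and> snd q \<le> z" if "q \<in> D2" for q
      using D2(2)[OF that] Dxz assms(3) by (auto simp: max_def)
    then show "D2 \<in> families y z" using D2(1) by (auto simp: families_def)
    have "?h p \<le> ?h (min (fst p) y, min (snd p) y) + ?h (max (fst p) y, max (snd p) y)" if "p \<in> D" for p
      by (cases "fst p \<le> y"; cases "snd p \<le> y") (auto simp: min_def max_def)
    then show "sum ?h D \<le> sum ?h D1 + sum ?h D2"
      unfolding D1(3) D2(3) sum.distrib[symmetric] by (rule sum_mono)
  qed
qed

text \<open>For \<le> a family is cut at y; for \<ge> a family on each side is joined to one on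
  [x, z], and the two suprema are taken one after the other.\<close>

lemma variation_additive:
  assumes "x \<le> y" "y \<le> z"
  shows "variation f x z = variation f x y + variation f y z"
proof (rule antisym)
  let ?h = "\<lambda>p. \<bar>f (snd p) - f (fst p)\<bar>"
  show "variation f x z \<le> variation f x y + variation f y z"
    unfolding variation_def[of f x z]
  proof (rule SUP_least)
    fix D assume "D \<in> families x z"
    from families_split[OF this assms, of f] obtain D1 D2
      where D: "D1 \<in> families x y" "D2 \<in> families y z" "sum ?h D \<le> sum ?h D1 + sum ?h D2" .
    have "ennreal (sum ?h D) \<le> ennreal (sum ?h D1 + sum ?h D2)" using D(3) by (rule ennreal_leI)
    also have "\<dots> = ennreal (sum ?h D1) + ennreal (sum ?h D2)" by (simp add: sum_nonneg)
    also have "\<dots> \<le> variation f x y + variation f y z" using D by (intro add_mono variation_ge)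
    finally show "ennreal (sum ?h D) \<le> variation f x y + variation f y z" .
  qed
  have *: "ennreal (sum ?h D1) + ennreal (sum ?h D2) \<le> variation f x z"
    if "D1 \<in> families x y" "D2 \<in> families y z" for D1 D2
  proof -
    have 1: "\<And>p. p \<in> D1 \<Longrightarrow> x \<le> fst p \<and> snd p \<le> y \<and> fst p < snd p" "nonoverlapping D1" "finite D1"
      and 2: "\<And>p. p \<in> D2 \<Longrightarrow> y \<le> fst p \<and> snd p \<le> z \<and> fst p < snd p" "nonoverlapping D2" "finite D2"
      using that by (auto simp: families_def nonoverlapping_def)
    have "D1 \<union> D2 \<in> families x z"
      unfolding families_def mem_Collect_eq
    proof (intro conjI nonoverlappingI ballI)
      show "snd p \<le> fst q \<or> snd q \<le> fst p" if "p \<in> D1 \<union> D2" "q \<in> D1 \<union> D2" "p \<noteq> q" for p q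
        using that 1(1)[of p] 1(1)[of q] 2(1)[of p] 2(1)[of q]
          nonoverlapping_ordered[OF 1(2), of p q] nonoverlapping_ordered[OF 2(2), of p q]
        by (smt (verit) Un_iff)
    qed (use 1 2 assms in fastforce)+
    moreover have "D1 \<inter> D2 = {}" using 1(1) 2(1) by fastforce
    then have "sum ?h (D1 \<union> D2) = sum ?h D1 + sum ?h D2" using 1 2 by (intro sum.union_disjoint)
    ultimately show ?thesis using variation_ge[of "D1 \<union> D2" x z f] by (simp add: sum_nonneg)
  qed
  have "variation f x y + variation f y z =
     (SUP D1\<in>families x y. SUP D2\<in>families y z. ennreal (sum ?h D1) + ennreal (sum ?h D2))"
    unfolding variation_def
    by (subst ennreal_SUP_add_left[symmetric], simp, subst ennreal_SUP_add_right) simp_all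
  also have "\<dots> \<le> variation f x z" by (intro SUP_least *)
  finally show "variation f x y + variation f y z \<le> variation f x z" .
qed

text \<open>A bound valid for every simultaneous choice of elements passes to the sum of the
  suprema. The offset c is what makes the induction work: it collects the summands already replaced
  by their suprema.\<close>

lemma sum_SUP_le:
  fixes h :: "'b \<Rightarrow> ennreal"
  assumes "finite D" "\<And>p. p \<in> D \<Longrightarrow> A p \<noteq> {}"
    and "\<And>E. (\<And>p. p \<in> D \<Longrightarrow> E p \<in> A p) \<Longrightarrow> c + (\<Sum>p\<in>D. h (E p)) \<le> e"
  shows "c + (\<Sum>p\<in>D. SUP x\<in>A p. h x) \<le> e"
  using assms
proof (induction D arbitrary: c rule: finite_induct)
  case empty
  then show ?case by simp
next
  case (insert p D)
  have "(c + (SUP x\<in>A p. h x)) + (\<Sum>p\<in>D. SUP x\<in>A p. h x) \<le> e"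
  proof (rule insert.IH)
    fix E assume E: "\<And>q. q \<in> D \<Longrightarrow> E q \<in> A q"
    have "c + (SUP x\<in>A p. h x) + (\<Sum>q\<in>D. h (E q)) = (SUP x\<in>A p. h x + (c + (\<Sum>q\<in>D. h (E q))))"
      by (subst ennreal_SUP_add_left) (use insert.prems(1)[of p] in \<open>simp_all add: add_ac\<close>)
    also have "\<dots> \<le> e"
    proof (rule SUP_least)
      fix x assume x: "x \<in> A p"
      have "c + (\<Sum>q\<in>insert p D. h ((E(p := x)) q)) \<le> e"
        by (rule insert.prems(2)) (use x E insert.hyps in auto)
      moreover have "(\<Sum>q\<in>D. h ((E(p := x)) q)) = (\<Sum>q\<in>D. h (E q))"
        using insert.hyps by (intro sum.cong) auto
      ultimately show "h x + (c + (\<Sum>q\<in>D. h (E q))) \<le> e"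
        using insert.hyps by (simp add: add_ac)
    qed
    finally show "c + (SUP x\<in>A p. h x) + (\<Sum>q\<in>D. h (E q)) \<le> e" .
  qed (use insert.prems in auto)
  then show ?case using insert.hyps by (simp add: add_ac)
qed

text \<open>The d for f also serves for its variation: refining the members of D does not increase
  the total length, so the pooled refinement is still admissible. Taking the supremum turns < into
  \<le>.\<close>

lemma abs_cont_variation:
  assumes f: "abs_cont f" and e: "e > 0"
  obtains d where "d > 0" "\<And>D. nonoverlapping D \<Longrightarrow> (\<Sum>p\<in>D. snd p - fst p) < d \<Longrightarrow>
     (\<Sum>p\<in>D. variation f (fst p) (snd p)) \<le> ennreal e"
proof -
  obtain d where d: "d > 0" "\<And>D. nonoverlapping D \<Longrightarrow> (\<Sum>p\<in>D. snd p - fst p) < d \<Longrightarrow>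
     (\<Sum>p\<in>D. \<bar>f (snd p) - f (fst p)\<bar>) < e"
    using f e unfolding abs_cont_def by blast
  show ?thesis
  proof (rule that[OF d(1)])
    fix D assume D: "nonoverlapping D" "(\<Sum>p\<in>D. snd p - fst p) < d"
    have "0 + (\<Sum>p\<in>D. variation f (fst p) (snd p)) \<le> ennreal e"
      unfolding variation_def
    proof (rule sum_SUP_le)
      fix E assume E: "\<And>p. p \<in> D \<Longrightarrow> E p \<in> families (fst p) (snd p)"
      have "(\<Sum>p\<in>D. \<Sum>q\<in>E p. snd q - fst q) \<le> (\<Sum>p\<in>D. snd p - fst p)"
        using E D by (intro sum_mono sum_lengths_le) (auto simp: nonoverlapping_def less_imp_le)
      then have "(\<Sum>q\<in>(\<Union>p\<in>D. E p). \<bar>f (snd q) - f (fst q)\<bar>) < e"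
        using D by (intro d(2) nonoverlapping_UN(1) E) (auto simp: nonoverlapping_UN(2)[OF D(1) E])
      then have "(\<Sum>p\<in>D. \<Sum>q\<in>E p. \<bar>f (snd q) - f (fst q)\<bar>) < e"
        by (subst (asm) nonoverlapping_UN(2)[OF D(1) E])
      then show "0 + (\<Sum>p\<in>D. ennreal (\<Sum>q\<in>E p. \<bar>f (snd q) - f (fst q)\<bar>)) \<le> ennreal e"
        by (simp add: sum_nonneg ennreal_leI)
    qed (use D in \<open>auto simp: nonoverlapping_def\<close>)
    then show "(\<Sum>p\<in>D. variation f (fst p) (snd p)) \<le> ennreal e" by simp
  qed
qed

lemma abs_cont_variation_finite:
  assumes f: "abs_cont f"
  shows "variation f x y < top"
proof -
  obtain d where d: "d > 0" "\<And>D. nonoverlapping D \<Longrightarrow> (\<Sum>p\<in>D. snd p - fst p) < d \<Longrightarrow>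
     (\<Sum>p\<in>D. variation f (fst p) (snd p)) \<le> ennreal 1"
    by (rule abs_cont_variation[OF f, of 1]) auto
  have small: "variation f u v < top" if "v < u + d" for u v
  proof (cases "u < v")
    case True
    then have "variation f u v \<le> ennreal 1"
      using d(2)[of "{(u, v)}"] that by (auto simp: nonoverlapping_def)
    also have "\<dots> < top" by simp
    finally show ?thesis .
  next
    case False
    have "D = {}" if "D \<in> families u v" for D
      using that False by (fastforce simp: families_def nonoverlapping_def)
    then have "families u v = {{}}" using empty_family by blast
    then show ?thesis by (simp add: variation_def)
  qed
  \<comment> \<open>Steps of length d/2 stay strictly below d, so each of them adds a finite
    variation.\<close>
  have "variation f x v < top" if "v \<le> x + real n * (d/2)" for n v
    using that
  proof (induction n arbitrary: v)
    case 0
    then show ?case using small[of v x] d by simp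
  next
    case (Suc n)
    show ?case
    proof (cases "v \<le> x + d/2")
      case True
      then show ?thesis using small[of v x] d(1) by simp
    next
      case False
      have "variation f x v = variation f x (v - d/2) + variation f (v - d/2) v"
        using False d(1) by (intro variation_additive) auto
      moreover have "variation f x (v - d/2) < top"
        using Suc.prems by (intro Suc.IH) (simp add: field_simps)
      moreover have "variation f (v - d/2) v < top" using d(1) by (intro small) auto
      ultimately show ?thesis by simp
    qed
  qed
  moreover obtain n where "(y - x) / (d/2) \<le> real n" using real_arch_simple by blast
  then have "y \<le> x + real n * (d/2)" using d(1) by (simp add: field_simps)
  ultimately show ?thesis by blast
qed

text \<open>Jordan decomposition f = (f + g) - g, where g is the variation accumulated from c.
  Because f is constant to the left of c, no increment of f escapes g although g is constant there
  as well.\<close>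

lemma abs_cont_monotone_difference:
  assumes f: "abs_cont f" and c: "\<And>x. x \<le> c \<Longrightarrow> f x = f c"
  obtains g where "abs_cont g" "mono g" "mono (\<lambda>x. f x + g x)"
proof -
  define g where "g x = enn2real (variation f c (max c x))" for x
  have fin: "variation f x y < top" for x y by (rule abs_cont_variation_finite[OF f])
  have diff: "g y - g x = enn2real (variation f (max c x) (max c y))" if "x \<le> y" for x y
  proof -
    have "variation f c (max c y) = variation f c (max c x) + variation f (max c x) (max c y)"
      using that by (intro variation_additive) auto
    then show ?thesis unfolding g_def using fin by (simp add: enn2real_plus)
  qed
  have diff_ge: "\<bar>f y - f x\<bar> \<le> g y - g x" if "x \<le> y" for x y
  proof -
    have "ennreal \<bar>f (max c y) - f (max c x)\<bar> \<le> variation f (max c x) (max c y)"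
      using that by (intro variation_ge_diff) auto
    then have "\<bar>f (max c y) - f (max c x)\<bar> \<le> g y - g x"
      unfolding diff[OF that] using enn2real_mono[OF _ fin] by fastforce
    moreover have "f (max c t) = f t" for t using c[of t] by (simp add: max_def)
    ultimately show ?thesis by simp
  qed
  show ?thesis
  proof (rule that)
    show "mono g"
    proof (rule monoI)
      show "g x \<le> g y" if "x \<le> y" for x y using diff_ge[OF that] by linarith
    qed
    show "mono (\<lambda>x. f x + g x)"
    proof (rule monoI)
      show "f x + g x \<le> f y + g y" if "x \<le> y" for x y using diff_ge[OF that] by linarith
    qed
    show "abs_cont g"
      unfolding abs_cont_def
    proof (intro allI impI)
      fix e :: real assume e: "e > 0"
      \<comment> \<open>The supremum only yields a weak inequality; e/2 makes the final one
        strict.\<close>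
      obtain d where d: "d > 0" "\<And>D. nonoverlapping D \<Longrightarrow> (\<Sum>p\<in>D. snd p - fst p) < d \<Longrightarrow>
         (\<Sum>p\<in>D. variation f (fst p) (snd p)) \<le> ennreal (e/2)"
        by (rule abs_cont_variation[OF f, of "e/2"]) (use e in auto)
      show "\<exists>d>0. \<forall>D. nonoverlapping D \<longrightarrow> (\<Sum>p\<in>D. snd p - fst p) < d \<longrightarrow>
              (\<Sum>p\<in>D. \<bar>g (snd p) - g (fst p)\<bar>) < e"
      proof (intro exI conjI allI impI)
        fix D assume D: "nonoverlapping D" "(\<Sum>p\<in>D. snd p - fst p) < d"
        have "variation f (max c (fst p)) (max c (snd p)) \<le> variation f (fst p) (snd p)" if p: "p \<in> D" for p
        proof -
          \<comment> \<open>An interval to the left of c is clamped to a point and admits only the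
            empty family; otherwise clamping merely moves the left end to the right.\<close>
          have "families (max c (fst p)) (max c (snd p)) \<subseteq> families (fst p) (snd p)"
          proof (cases "snd p \<le> c")
            case True
            have "D = {}" if "D \<in> families (max c (fst p)) (max c (snd p))" for D
              using that True D(1) p by (fastforce simp: families_def nonoverlapping_def)
            then show ?thesis using empty_family by blast
          qed (auto simp: families_def)
          then show ?thesis unfolding variation_def by (intro SUP_subset_mono) auto
        qed
        then have "\<bar>g (snd p) - g (fst p)\<bar> \<le> enn2real (variation f (fst p) (snd p))" if "p \<in> D" for p
          using that D(1) diff[of "fst p" "snd p"] enn2real_mono[OF _ fin] enn2real_nonneg
          by (fastforce simp: nonoverlapping_def abs_of_nonneg)
        then have "(\<Sum>p\<in>D. \<bar>g (snd p) - g (fst p)\<bar>) \<le> (\<Sum>p\<in>D. enn2real (variation f (fst p) (snd p)))"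
          by (rule sum_mono)
        also have "\<dots> = enn2real (\<Sum>p\<in>D. variation f (fst p) (snd p))"
          using fin by (simp add: enn2real_sum)
        also have "\<dots> \<le> e/2"
          using d(2)[OF D] e by (intro enn2real_leI) auto
        finally show "(\<Sum>p\<in>D. \<bar>g (snd p) - g (fst p)\<bar>) < e" using e by simp
      qed (rule d(1))
    qed
  qed
qed

section \<open>Lebesgue differentiation\<close>

lemma abs_cont_continuous:
  assumes "abs_cont f"
  shows "continuous_on UNIV f"
  unfolding continuous_on_iff
proof (intro ballI allI impI)
  fix x e :: real assume "e > 0"
  then obtain d where d: "d > 0" "\<And>D. nonoverlapping D \<Longrightarrow> (\<Sum>p\<in>D. snd p - fst p) < d \<Longrightarrow>
     (\<Sum>p\<in>D. \<bar>f (snd p) - f (fst p)\<bar>) < e"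
    using assms unfolding abs_cont_def by blast
  have "\<bar>f v - f u\<bar> < e" if "u < v" "v - u < d" for u v
    using d(2)[of "{(u, v)}"] that by (auto simp: nonoverlapping_def)
  then have "dist (f y) (f x) < e" if "dist y x < d" for y
    using that \<open>e > 0\<close> by (cases x y rule: linorder_cases) (force simp: dist_real_def abs_minus_commute)+
  then show "\<exists>d>0. \<forall>y\<in>UNIV. dist y x < d \<longrightarrow> dist (f y) (f x) < e" using d(1) by blast
qed

text \<open>A null set is covered by countably many closed intervals with disjoint interiors and
  total length below d. Absolute continuity bounds the sum of the F-increments over each finite
  subfamily by e, and this sum dominates its Stieltjes measure.\<close>

lemma abs_cont_interval_measure_null_bounded:
  assumes F: "abs_cont F" "mono F" and N: "N \<in> null_sets lborel" "N \<subseteq> {-r..r}"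
  shows "emeasure (interval_measure F) N = 0"
proof (rule antisym)
  have cont: "continuous_on UNIV F" by (rule abs_cont_continuous[OF F(1)])
  have mono: "\<And>x y. x \<le> y \<Longrightarrow> F x \<le> F y" using F(2) by (rule monoD)
  show "emeasure (interval_measure F) N \<le> 0"
  proof (rule ennreal_le_epsilon)
    fix e :: real assume e: "0 < e"
    then obtain d where d: "d > 0" "\<And>D. nonoverlapping D \<Longrightarrow> (\<Sum>p\<in>D. snd p - fst p) < d \<Longrightarrow>
       (\<Sum>p\<in>D. \<bar>F (snd p) - F (fst p)\<bar>) < e"
      using F(1) unfolding abs_cont_def by blast
    \<comment> \<open>A box with non-empty interior is required for the covering intervals to be
      non-degenerate.\<close>
    define r' where "r' = max 1 r"
    have N': "N \<subseteq> cbox (-r') r'" and ne: "box (-r') r' \<noteq> {}"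
      using N(2) by (force simp: r'_def)+
    have Nl: "N \<in> lmeasurable" "measure lebesgue N = 0"
      using N(1) by (auto simp: fmeasurable_def null_sets_def measure_def)
    obtain \<D> where D: "countable \<D>" "\<And>K. K \<in> \<D> \<Longrightarrow> K \<subseteq> cbox (-r') r' \<and> K \<noteq> {} \<and> (\<exists>c d. K = cbox c d)"
        "pairwise (\<lambda>A B. interior A \<inter> interior B = {}) \<D>"
        "\<And>K. \<lbrakk>K \<in> \<D>; box (-r') r' \<noteq> {}\<rbrakk> \<Longrightarrow> interior K \<noteq> {}"
        "N \<subseteq> \<Union>\<D>" "\<Union>\<D> \<in> lmeasurable" "measure lebesgue (\<Union>\<D>) \<le> measure lebesgue N + d/2"
      using measurable_outer_intervals_bounded[OF Nl(1) N', of "d/2"] d(1) by (metis half_gt_zero)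
    have K: "K = {Inf K..Sup K}" "Inf K < Sup K" if KD: "K \<in> \<D>" for K
    proof -
      obtain u v where uv: "K = {u..v}" using D(2)[OF KD] by auto
      moreover have "{u<..<v} \<noteq> {}" using D(4)[OF KD ne] uv by (simp add: interior_atLeastAtMost_real)
      then have "u < v" by simp
      ultimately show "K = {Inf K..Sup K}" "Inf K < Sup K" by auto
    qed
    have fin: "emeasure (interval_measure F) (\<Union>\<F>) \<le> ennreal e" if FD: "finite \<F>" "\<F> \<subseteq> \<D>" for \<F>
    proof -
      define P where "P K = (Inf K :: real, Sup K :: real)" for K
      have inj: "inj_on P \<F>"
        by (rule inj_onI) (metis K(1) P_def FD(2) prod.inject subsetD)
      have int: "interior K = {Inf K<..<Sup K}" if "K \<in> \<F>" for K
        by (metis K(1) FD(2) that interior_atLeastAtMost_real subsetD)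
      have nonov: "nonoverlapping (P ` \<F>)"
        unfolding nonoverlapping_def
      proof (intro conjI)
        show "pairwise (\<lambda>i j. {fst i<..<snd i} \<inter> {fst j<..<snd j} = {}) (P ` \<F>)"
        proof (rule pairwiseI)
          fix p q assume pq: "p \<in> P ` \<F>" "q \<in> P ` \<F>" "p \<noteq> q"
          then obtain K L where KL: "K \<in> \<F>" "L \<in> \<F>" "p = P K" "q = P L" by blast
          with pq have "K \<noteq> L" by auto
          then have "interior K \<inter> interior L = {}" using KL FD(2) D(3) by (meson pairwiseD subsetD)
          then show "{fst p<..<snd p} \<inter> {fst q<..<snd q} = {}"
            by (simp only: int[OF KL(1)] int[OF KL(2)] KL(3,4) P_def fst_conv snd_conv)
        qed
      qed (use FD K in \<open>auto simp: P_def\<close>)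
      have "(\<Sum>p\<in>P ` \<F>. snd p - fst p) = (\<Sum>K\<in>\<F>. Sup K - Inf K)"
        by (subst sum.reindex[OF inj]) (simp add: P_def)
      \<comment> \<open>The closed intervals may share endpoints, so their lengths are added through
        the disjoint interiors.\<close>
      also have "\<dots> = (\<Sum>K\<in>\<F>. measure lebesgue (interior K))"
        using K(2) FD(2) by (intro sum.cong) (auto simp: int less_imp_le)
      also have "\<dots> = measure lebesgue (\<Union>K\<in>\<F>. interior K)"
      proof (rule measure_UNION'[symmetric, OF FD(1)])
        show "interior K \<in> lmeasurable" if "K \<in> \<F>" for K
          using int[OF that] by simp
        show "pairwise (\<lambda>i j. disjnt (interior i) (interior j)) \<F>"
          using D(3) FD(2) pairwise_subset by (auto simp: disjnt_def)
      qed
      also have "\<dots> \<le> measure lebesgue (\<Union>\<D>)"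
      proof (rule measure_mono_fmeasurable[OF _ _ D(6)])
        show "(\<Union>K\<in>\<F>. interior K) \<subseteq> \<Union>\<D>" using FD(2) interior_subset by blast
      qed (use FD(1) in auto)
      also have "\<dots> < d" using D(7) Nl(2) d(1) by simp
      finally have "(\<Sum>p\<in>P ` \<F>. \<bar>F (snd p) - F (fst p)\<bar>) < e" by (rule d(2)[OF nonov])
      then have le: "(\<Sum>K\<in>\<F>. \<bar>F (Sup K) - F (Inf K)\<bar>) < e"
        by (subst (asm) sum.reindex[OF inj]) (simp add: P_def)
      have "emeasure (interval_measure F) (\<Union>\<F>) = emeasure (interval_measure F) (\<Union>K\<in>\<F>. K)" by simp
      also have "\<dots> \<le> (\<Sum>K\<in>\<F>. emeasure (interval_measure F) K)"
        by (rule emeasure_subadditive_finite) (use FD D(2) in fastforce)+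
      also have "\<dots> = (\<Sum>K\<in>\<F>. ennreal \<bar>F (Sup K) - F (Inf K)\<bar>)"
      proof (rule sum.cong[OF refl])
        fix K assume "K \<in> \<F>"
        then have KD: "K \<in> \<D>" using FD by blast
        have "emeasure (interval_measure F) {Inf K..Sup K} = F (Sup K) - F (Inf K)"
          using K(2)[OF KD] by (intro emeasure_interval_measure_Icc mono cont) auto
        then show "emeasure (interval_measure F) K = ennreal \<bar>F (Sup K) - F (Inf K)\<bar>"
          using K(1)[OF KD] mono[of "Inf K" "Sup K"] K(2)[OF KD] by simp
      qed
      also have "\<dots> = ennreal (\<Sum>K\<in>\<F>. \<bar>F (Sup K) - F (Inf K)\<bar>)" by simp
      also have "\<dots> \<le> ennreal e" using le by (intro ennreal_leI) simp
      finally show ?thesis .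
    qed
    have "emeasure (interval_measure F) (\<Union>\<D>) \<le> ennreal e"
    proof (cases "\<D> = {}")
      case False
      \<comment> \<open>The bound for finite subfamilies is carried to \<D> by continuity of the
        measure from below along an enumeration.\<close>
      define A where "A n = (\<Union>i\<in>{..n}. from_nat_into \<D> i)" for n
      have Dn: "from_nat_into \<D> i \<in> \<D>" for i using from_nat_into[OF False] .
      have UA: "\<Union>\<D> = (\<Union>n. A n)"
      proof -
        have "\<Union>\<D> = (\<Union>i. from_nat_into \<D> i)" using range_from_nat_into[OF False D(1)] by simp
        also have "\<dots> = (\<Union>n. A n)" unfolding A_def by blast
        finally show ?thesis .
      qed
      have "(SUP n. emeasure (interval_measure F) (A n)) = emeasure (interval_measure F) (\<Union>n. A n)"
      proof (rule SUP_emeasure_incseq)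
        show "incseq A" by (fastforce simp: incseq_def A_def)
        have "from_nat_into \<D> i \<in> sets borel" for i using D(2)[OF Dn[of i]] by auto
        then show "range A \<subseteq> sets (interval_measure F)" by (auto simp: A_def)
      qed
      moreover have "emeasure (interval_measure F) (A n) \<le> ennreal e" for n
        using fin[of "from_nat_into \<D> ` {..n}"] Dn by (auto simp: A_def)
      ultimately show ?thesis by (metis UA SUP_least)
    qed simp
    moreover have "emeasure (interval_measure F) N \<le> emeasure (interval_measure F) (\<Union>\<D>)"
    proof (rule emeasure_mono[OF D(5)])
      have "K \<in> sets borel" if "K \<in> \<D>" for K using D(2)[OF that] by auto
      then show "\<Union>\<D> \<in> sets (interval_measure F)" using D(1) by (auto intro: sets.countable_Union)
    qed
    ultimately show "emeasure (interval_measure F) N \<le> 0 + ennreal e" by simp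
  qed
qed simp

lemma abs_cont_interval_measure:
  assumes F: "abs_cont F" "mono F"
  shows "absolutely_continuous lborel (interval_measure F)"
  unfolding absolutely_continuous_def
proof
  fix N :: "real set" assume N: "N \<in> null_sets lborel"
  have "(\<Union>n. N \<inter> {-real n..real n}) \<in> null_sets (interval_measure F)"
  proof (rule null_sets_UN)
    fix n
    have "N \<inter> {-real n..real n} \<in> null_sets lborel" using N by (intro null_set_Int2) auto
    then have "emeasure (interval_measure F) (N \<inter> {-real n..real n}) = 0"
      by (intro abs_cont_interval_measure_null_bounded[OF F]) auto
    then show "N \<inter> {-real n..real n} \<in> null_sets (interval_measure F)"
      using N by (auto simp: null_sets_def)
  qed
  moreover have "(\<Union>n. N \<inter> {-real n..real n}) = N"
  proof -
    have "\<exists>n. - real n \<le> x \<and> x \<le> real n" for x :: real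
      using real_arch_simple[of "\<bar>x\<bar>"] by (auto simp: abs_le_iff) (metis minus_le_iff)
    then show ?thesis by auto
  qed
  ultimately show "N \<in> null_sets (interval_measure F)" by simp
qed

text \<open>g is the Radon-Nikodym density of the Stieltjes measure of F. Continuity of F gives the
  closed interval [x, y] the measure F y - F x.\<close>

lemma abs_cont_mono_has_integral:
  assumes F: "abs_cont F" "mono F"
  obtains g :: "real \<Rightarrow> real" where "\<And>x y. x \<le> y \<Longrightarrow> g absolutely_integrable_on {x..y}"
    "\<And>x y. x \<le> y \<Longrightarrow> (g has_integral (F y - F x)) {x..y}"
proof -
  have cont: "continuous_on UNIV F" by (rule abs_cont_continuous[OF F(1)])
  have mono: "\<And>x y. x \<le> y \<Longrightarrow> F x \<le> F y" using F(2) by (rule monoD)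
  obtain h where h: "h \<in> borel_measurable lborel" "density lborel h = interval_measure F"
    using sigma_finite_measure.Radon_Nikodym[OF sigma_finite_lborel abs_cont_interval_measure[OF F]] by auto
  have nn: "(\<integral>\<^sup>+t. h t * indicator {x..y} t \<partial>lborel) = ennreal (F y - F x)" if "x \<le> y" for x y
  proof -
    have "(\<integral>\<^sup>+t. h t * indicator {x..y} t \<partial>lborel) = emeasure (density lborel h) {x..y}"
      using h(1) by (simp add: emeasure_density)
    then show ?thesis using that by (simp add: h(2) emeasure_interval_measure_Icc mono cont)
  qed
  define g where "g t = enn2real (h t)" for t
  have gm: "g \<in> borel_measurable borel" using h(1) unfolding g_def by measurable
  have int: "(g has_integral (F y - F x)) {x..y}" if xy: "x \<le> y" for x y
  proof -
    \<comment> \<open>A finite integral forces h to be finite almost everywhere on [x, y], so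
      passing to \<open>enn2real\<close> changes h only on a null set.\<close>
    have "AE t in lborel. h t * indicator {x..y} t \<noteq> \<infinity>"
      using nn[OF xy] h(1) by (intro nn_integral_PInf_AE) auto
    then have "AE t in lborel. ennreal (g t * indicator {x..y} t) = h t * indicator {x..y} t"
    proof eventually_elim
      case (elim t)
      then show ?case by (cases "t \<in> {x..y}") (auto simp: g_def less_top)
    qed
    then have "(\<integral>\<^sup>+t. ennreal (g t * indicator {x..y} t) \<partial>lborel) = ennreal (F y - F x)"
      using nn[OF xy] by (simp cong: nn_integral_cong_AE)
    moreover have "(\<lambda>t. g t * indicator {x..y} t) \<in> borel_measurable borel" using gm by measurable
    moreover have "0 \<le> g t * indicator {x..y} t" for t by (simp add: g_def)
    ultimately have "((\<lambda>t. g t * indicator {x..y} t) has_integral (F y - F x)) UNIV"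
      using mono[OF xy] by (intro nn_integral_has_integral) auto
    moreover have "(\<lambda>t. g t * indicator {x..y} t) = (\<lambda>t. if t \<in> {x..y} then g t else 0)"
      by (auto simp: fun_eq_iff)
    ultimately show ?thesis by (simp only: has_integral_restrict_UNIV)
  qed
  show ?thesis
  proof (rule that[OF _ int])
    show "g absolutely_integrable_on {x..y}" if "x \<le> y" for x y
      using int[OF that] by (intro nonnegative_absolutely_integrable_1) (auto simp: g_def)
  qed
qed

text \<open>\<open>integrable_ccontinuous_explicit\<close> controls averages over intervals to the
  right of a point only. Averages to the left are obtained by applying it to the reflected function,
  whose exceptional set is reflected back.\<close>

lemma lebesgue_differentiation:
  fixes g :: "real \<Rightarrow> 'b::euclidean_space"
  assumes g: "g integrable_on {c..d}"
  obtains N where "negligible N"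
    "\<And>x. x \<in> {c<..<d} - N \<Longrightarrow> ((\<lambda>x. integral {c..x} g) has_vector_derivative g x) (at x)"
proof -
  \<comment> \<open>Extension by zero makes the function integrable over every compact interval, as
    needed for both applications.\<close>
  define h where "h x = (if x \<in> {c..d} then g x else 0)" for x
  have "h integrable_on UNIV" using g unfolding h_def by (simp only: integrable_restrict_UNIV)
  then have hi: "h integrable_on {a..b}" for a b
    using integrable_on_subcbox[of h UNIV a b] by simp
  have hr: "(\<lambda>x. h (- x)) integrable_on {a..b}" for a b
    using hi[of "-b" "-a"] Henstock_Kurzweil_Integration.integrable_reflect_real[where f=h and a="-b" and b="-a"] by simp
  obtain N1 where N1: "negligible N1" and N1': "\<And>x e. \<lbrakk>x \<notin> N1; 0 < e\<rbrakk> \<Longrightarrow>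
      \<exists>d>0. \<forall>s. 0 < s \<and> s < d \<longrightarrow> norm (integral {x..x+s} h /\<^sub>R s - h x) < e"
    by (rule integrable_ccontinuous_explicit[of h]) (use hi in auto)
  obtain N2 where N2: "negligible N2" and N2': "\<And>x e. \<lbrakk>x \<notin> N2; 0 < e\<rbrakk> \<Longrightarrow>
      \<exists>d>0. \<forall>s. 0 < s \<and> s < d \<longrightarrow> norm (integral {x..x+s} (\<lambda>x. h (-x)) /\<^sub>R s - h (-x)) < e"
    by (rule integrable_ccontinuous_explicit[of "\<lambda>x. h (- x)"]) (use hr in auto)
  have neg: "negligible (N1 \<union> uminus ` N2)"
    using N1 N2 by (intro negligible_Un negligible_differentiable_image_negligible derivative_intros) (auto intro!: differentiable_on_minus differentiable_on_id)
  show ?thesis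
  proof (rule that[OF neg])
    fix x assume x: "x \<in> {c<..<d} - (N1 \<union> uminus ` N2)"
    then have x1: "x \<notin> N1" and x2: "- x \<notin> N2" by (auto simp: image_iff) 
    have gi: "g integrable_on {c..y}" if "y \<le> d" for y
      using integrable_on_subinterval[OF g] that by auto
    have inc: "integral {c..v} g - integral {c..u} g = integral {u..v} h" if "c \<le> u" "u \<le> v" "v \<le> d" for u v
    proof -
      have "integral {c..u} g + integral {u..v} g = integral {c..v} g"
        using that by (intro Henstock_Kurzweil_Integration.integral_combine gi) auto
      moreover have "integral {u..v} g = integral {u..v} h"
        using that by (intro integral_cong) (auto simp: h_def)
      ultimately show ?thesis by (simp add: algebra_simps)
    qed
    have hx: "h x = g x" using x by (auto simp: h_def)
    show "((\<lambda>x. integral {c..x} g) has_vector_derivative g x) (at x)"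
      unfolding has_vector_derivative_def has_derivative_at_alt
    proof (intro conjI allI impI)
      show "bounded_linear (\<lambda>y. y *\<^sub>R g x)" by (rule bounded_linear_scaleR_left)
      fix e :: real assume e: "e > 0"
      obtain d1 where d1: "d1 > 0" "\<And>s. 0 < s \<Longrightarrow> s < d1 \<Longrightarrow> norm (integral {x..x+s} h /\<^sub>R s - h x) < e"
        using N1'[OF x1 e] by blast
      obtain d2 where d2: "d2 > 0" "\<And>s. 0 < s \<Longrightarrow> s < d2 \<Longrightarrow>
          norm (integral {-x..-x+s} (\<lambda>x. h (-x)) /\<^sub>R s - h x) < e"
        using N2'[OF x2 e] by force
      have scale: "norm (I - s *\<^sub>R g x) \<le> e * s" if "norm (I /\<^sub>R s - h x) < e" "s > 0" for I s
      proof -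
        have "I - s *\<^sub>R g x = s *\<^sub>R (I /\<^sub>R s - h x)" using that by (simp add: algebra_simps hx)
        then have "norm (I - s *\<^sub>R g x) = s * norm (I /\<^sub>R s - h x)" using that by simp
        also have "\<dots> \<le> s * e" using that by (intro mult_left_mono) auto
        finally show ?thesis by (simp add: mult.commute)
      qed
      show "\<exists>d>0. \<forall>y. norm (y - x) < d \<longrightarrow>
          norm (integral {c..y} g - integral {c..x} g - (y - x) *\<^sub>R g x) \<le> e * norm (y - x)"
      proof (intro exI[of _ "min (min d1 d2) (min (d - x) (x - c))"] conjI allI impI)
        show "0 < min (min d1 d2) (min (d - x) (x - c))" using d1 d2 x by auto
        fix y assume y: "norm (y - x) < min (min d1 d2) (min (d - x) (x - c))"
        show "norm (integral {c..y} g - integral {c..x} g - (y - x) *\<^sub>R g x) \<le> e * norm (y - x)"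
        proof (cases x y rule: linorder_cases)
          case less
          then have "integral {c..y} g - integral {c..x} g = integral {x..y} h"
            using y x by (intro inc) auto
          moreover have "norm (integral {x..x + (y - x)} h - (y - x) *\<^sub>R g x) \<le> e * (y - x)"
            using less y by (intro scale d1) auto
          ultimately show ?thesis using less by simp
        next
          case greater
          then have "integral {c..x} g - integral {c..y} g = integral {y..x} h"
            using y x by (intro inc) auto
          moreover have "integral {-x..-y} (\<lambda>x. h (-x)) = integral {y..x} h"
            using Henstock_Kurzweil_Integration.integral_reflect_real[where f=h and a=y and b=x] by simp
          moreover have "norm (integral {-x..-x + (x - y)} (\<lambda>x. h (-x)) - (x - y) *\<^sub>R g x) \<le> e * (x - y)"
            using greater y by (intro scale d2) auto
          ultimately have "norm ((integral {c..x} g - integral {c..y} g) - (x - y) *\<^sub>R g x) \<le> e * (x - y)"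
            by simp
          moreover have "norm (integral {c..y} g - integral {c..x} g - (y - x) *\<^sub>R g x) =
             norm ((integral {c..x} g - integral {c..y} g) - (x - y) *\<^sub>R g x)"
            by (subst norm_minus_cancel[symmetric]) (simp add: algebra_simps)
          ultimately show ?thesis using greater by simp
        qed simp
      qed
    qed
  qed
qed

section \<open>Absolute continuity on compact intervals\<close>

lemma abs_cont_add: "abs_cont f \<Longrightarrow> abs_cont g \<Longrightarrow> abs_cont (\<lambda>x. f x + g x)"
  unfolding abs_cont_def
proof (intro allI impI)
  fix e :: real
  assume f: "\<forall>e>0. \<exists>d>0. \<forall>D. nonoverlapping D \<longrightarrow> (\<Sum>p\<in>D. snd p - fst p) < d \<longrightarrow> (\<Sum>p\<in>D. \<bar>f (snd p) - f (fst p)\<bar>) < e"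
    and g: "\<forall>e>0. \<exists>d>0. \<forall>D. nonoverlapping D \<longrightarrow> (\<Sum>p\<in>D. snd p - fst p) < d \<longrightarrow> (\<Sum>p\<in>D. \<bar>g (snd p) - g (fst p)\<bar>) < e"
    and "0 < e"
  then have "0 < e/2" by simp
  obtain d1 where d1: "d1 > 0" "\<And>D. nonoverlapping D \<Longrightarrow> (\<Sum>p\<in>D. snd p - fst p) < d1 \<Longrightarrow> (\<Sum>p\<in>D. \<bar>f (snd p) - f (fst p)\<bar>) < e/2"
    using f \<open>0 < e/2\<close> by blast
  obtain d2 where d2: "d2 > 0" "\<And>D. nonoverlapping D \<Longrightarrow> (\<Sum>p\<in>D. snd p - fst p) < d2 \<Longrightarrow> (\<Sum>p\<in>D. \<bar>g (snd p) - g (fst p)\<bar>) < e/2"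
    using g \<open>0 < e/2\<close> by blast
  show "\<exists>d>0. \<forall>D. nonoverlapping D \<longrightarrow> (\<Sum>p\<in>D. snd p - fst p) < d \<longrightarrow>
      (\<Sum>p\<in>D. \<bar>(f (snd p) + g (snd p)) - (f (fst p) + g (fst p))\<bar>) < e"
  proof (intro exI[of _ "min d1 d2"] conjI allI impI)
    fix D assume D: "nonoverlapping D" "(\<Sum>p\<in>D. snd p - fst p) < min d1 d2"
    have "(\<Sum>p\<in>D. \<bar>(f (snd p) + g (snd p)) - (f (fst p) + g (fst p))\<bar>) \<le>
      (\<Sum>p\<in>D. \<bar>f (snd p) - f (fst p)\<bar> + \<bar>g (snd p) - g (fst p)\<bar>)"
      by (intro sum_mono) linarith
    also have "\<dots> < e" using d1(2)[OF D(1)] d2(2)[OF D(1)] D(2) by (simp add: sum.distrib)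
    finally show "(\<Sum>p\<in>D. \<bar>(f (snd p) + g (snd p)) - (f (fst p) + g (fst p))\<bar>) < e" .
  qed (use d1 d2 in auto)
qed

text \<open>Clamping the argument to [c, d] extends f to the line and makes it constant to the left
  of c, the form required by \<open>abs_cont_monotone_difference\<close>. Clamping does not lengthen
  intervals. The contraction \<psi> will be \<open>Re\<close> or \<open>Im\<close>.\<close>

lemma abs_cont_on_component:
  assumes f: "abs_cont_on c d f" and "c \<le> d"
    and \<psi>: "\<And>z w. \<bar>\<psi> z - \<psi> w\<bar> \<le> norm (z - w)"
  shows "abs_cont (\<lambda>x. \<psi> (f (max c (min d x))))"
  unfolding abs_cont_def
proof (intro allI impI)
  fix e :: real assume "0 < e"
  define \<phi> where "\<phi> x = max c (min d x)" for x
  have m: "mono \<phi>" by (auto simp: mono_def \<phi>_def)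
  have \<phi>: "c \<le> \<phi> x" "\<phi> x \<le> d" for x using \<open>c \<le> d\<close> by (auto simp: \<phi>_def)
  obtain \<delta> where \<delta>: "\<delta> > 0" "\<And>D. finite D \<Longrightarrow> (\<forall>(x, y)\<in>D. c \<le> x \<and> x \<le> y \<and> y \<le> d) \<Longrightarrow>
        pairwise (\<lambda>i j. {fst i<..<snd i} \<inter> {fst j<..<snd j} = {}) D \<Longrightarrow>
        (\<Sum>(x, y)\<in>D. y - x) < \<delta> \<Longrightarrow> (\<Sum>(x, y)\<in>D. norm (f y - f x)) < e"
    using f \<open>0 < e\<close> unfolding abs_cont_on_def by blast
  show "\<exists>\<delta>>0. \<forall>D. nonoverlapping D \<longrightarrow> (\<Sum>p\<in>D. snd p - fst p) < \<delta> \<longrightarrow>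
      (\<Sum>p\<in>D. \<bar>\<psi> (f (max c (min d (snd p)))) - \<psi> (f (max c (min d (fst p))))\<bar>) < e"
  proof (intro exI[of _ \<delta>] conjI allI impI)
    fix D assume D: "nonoverlapping D" "(\<Sum>p\<in>D. snd p - fst p) < \<delta>"
    obtain E where E: "nonoverlapping E" "\<And>q. q \<in> E \<Longrightarrow> \<exists>p\<in>D. q = (\<phi> (fst p), \<phi> (snd p))"
      and h: "\<And>h :: real \<times> real \<Rightarrow> real. (\<And>t. h (t, t) = 0) \<Longrightarrow> sum h E = (\<Sum>p\<in>D. h (\<phi> (fst p), \<phi> (snd p)))"
      by (rule mono_image_family[OF D(1) m]) blast
    have Dlt: "fst p < snd p" if "p \<in> D" for p using D(1) that by (auto simp: nonoverlapping_def)
    have "(\<Sum>(x, y)\<in>E. y - x) = (\<Sum>p\<in>D. \<phi> (snd p) - \<phi> (fst p))"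
      by (subst h) auto
    also have "\<dots> \<le> (\<Sum>p\<in>D. snd p - fst p)"
    proof (rule sum_mono)
      fix p assume "p \<in> D"
      then show "\<phi> (snd p) - \<phi> (fst p) \<le> snd p - fst p"
        using Dlt[of p] unfolding \<phi>_def by linarith
    qed
    finally have len: "(\<Sum>(x, y)\<in>E. y - x) < \<delta>" using D(2) by linarith
    have "(\<Sum>p\<in>D. \<bar>\<psi> (f (\<phi> (snd p))) - \<psi> (f (\<phi> (fst p)))\<bar>) \<le> (\<Sum>p\<in>D. norm (f (\<phi> (snd p)) - f (\<phi> (fst p))))"
      by (intro sum_mono \<psi>)
    also have "\<dots> = (\<Sum>(x, y)\<in>E. norm (f y - f x))" by (subst h) auto
    also have "\<dots> < e"
    proof (rule \<delta>(2)[OF _ _ _ len])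
      show "\<forall>(x, y)\<in>E. c \<le> x \<and> x \<le> y \<and> y \<le> d"
        using E \<phi> by (fastforce simp: nonoverlapping_def)
    qed (use E in \<open>auto simp: nonoverlapping_def\<close>)
    finally show "(\<Sum>p\<in>D. \<bar>\<psi> (f (max c (min d (snd p)))) - \<psi> (f (max c (min d (fst p))))\<bar>) < e"
      by (simp add: \<phi>_def)
  qed (rule \<delta>(1))
qed

lemma abs_cont_has_integral:
  assumes F: "abs_cont F" and c: "\<And>x. x \<le> c \<Longrightarrow> F x = F c"
  obtains g :: "real \<Rightarrow> real" where "\<And>x y. x \<le> y \<Longrightarrow> g absolutely_integrable_on {x..y}"
    "\<And>x y. x \<le> y \<Longrightarrow> (g has_integral (F y - F x)) {x..y}"
proof -
  obtain G where G: "abs_cont G" "mono G" "mono (\<lambda>x. F x + G x)"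
    using abs_cont_monotone_difference[OF F c] by metis
  obtain g1 where g1: "\<And>x y. x \<le> y \<Longrightarrow> g1 absolutely_integrable_on {x..y}"
    "\<And>x y. x \<le> y \<Longrightarrow> (g1 has_integral ((F y + G y) - (F x + G x))) {x..y}"
    by (rule abs_cont_mono_has_integral[OF abs_cont_add[OF F G(1)] G(3)]) blast
  obtain g2 where g2: "\<And>x y. x \<le> y \<Longrightarrow> g2 absolutely_integrable_on {x..y}"
    "\<And>x y. x \<le> y \<Longrightarrow> (g2 has_integral (G y - G x)) {x..y}"
    by (rule abs_cont_mono_has_integral[OF G(1,2)]) blast
  show ?thesis
  proof (rule that)
    fix x y :: real assume "x \<le> y"
    then show "(\<lambda>t. g1 t - g2 t) absolutely_integrable_on {x..y}" using g1 g2 by (intro set_integral_diff)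
    show "((\<lambda>t. g1 t - g2 t) has_integral (F y - F x)) {x..y}"
      using has_integral_diff[OF g1(2) g2(2)] \<open>x \<le> y\<close> by simp
  qed
qed

section \<open>Almost everywhere derivatives of complex absolutely continuous functions\<close>

lemma absolutely_integrable_of_real:
  fixes g :: "real \<Rightarrow> real"
  shows
  "g absolutely_integrable_on S \<Longrightarrow> (\<lambda>x. complex_of_real (g x)) absolutely_integrable_on S"
  using absolutely_integrable_linear[OF _ bounded_linear_of_real] by (fastforce simp: o_def)

lemma abs_cont_on_has_integral:
  assumes f: "abs_cont_on c d f" and "c \<le> d"
  obtains g where "g absolutely_integrable_on {c..d}"
    "\<And>x y. c \<le> x \<Longrightarrow> x \<le> y \<Longrightarrow> y \<le> d \<Longrightarrow> (g has_integral (f y - f x)) {x..y}"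
proof -
  have Re: "\<bar>Re z - Re w\<bar> \<le> norm (z - w)" and Im: "\<bar>Im z - Im w\<bar> \<le> norm (z - w)" for z w
    using abs_Re_le_cmod[of "z - w"] abs_Im_le_cmod[of "z - w"] by auto
  obtain g1 where g1: "\<And>x y. x \<le> y \<Longrightarrow> g1 absolutely_integrable_on {x..y}"
    "\<And>x y. x \<le> y \<Longrightarrow> (g1 has_integral (Re (f (max c (min d y))) - Re (f (max c (min d x))))) {x..y}"
    by (rule abs_cont_has_integral[OF abs_cont_on_component[OF assms Re], of c])
       (auto simp: max_def min_def)
  obtain g2 where g2: "\<And>x y. x \<le> y \<Longrightarrow> g2 absolutely_integrable_on {x..y}"
    "\<And>x y. x \<le> y \<Longrightarrow> (g2 has_integral (Im (f (max c (min d y))) - Im (f (max c (min d x))))) {x..y}"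
    by (rule abs_cont_has_integral[OF abs_cont_on_component[OF assms Im], of c])
       (auto simp: max_def min_def)
  show ?thesis
  proof (rule that)
    show "(\<lambda>t. of_real (g1 t) + \<i> * of_real (g2 t)) absolutely_integrable_on {c..d}"
      using g1(1) g2(1) \<open>c \<le> d\<close>
      by (intro set_integral_add set_integrable_mult_right absolutely_integrable_of_real) auto
    fix x y assume xy: "c \<le> x" "x \<le> y" "y \<le> d"
    then have *: "max c (min d x) = x" "max c (min d y) = y" by auto
    have "((\<lambda>t. of_real (g1 t) + \<i> * of_real (g2 t)) has_integral
      (of_real (Re (f y) - Re (f x)) + \<i> * of_real (Im (f y) - Im (f x)))) {x..y}"
      using g1(2)[OF xy(2)] g2(2)[OF xy(2)] unfolding *
      by (intro has_integral_add has_integral_mult_right has_integral_of_real)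
    also have "of_real (Re (f y) - Re (f x)) + \<i> * of_real (Im (f y) - Im (f x)) = f y - f x"
      by (simp add: complex_eq_iff)
    finally show "((\<lambda>t. of_real (g1 t) + \<i> * of_real (g2 t)) has_integral (f y - f x)) {x..y}" .
  qed
qed

lemma has_integral_imp_vector_derivative:
  fixes f :: "real \<Rightarrow> 'b::euclidean_space"
  assumes "\<And>x. x \<in> {c..d} \<Longrightarrow> (g has_integral (f x - f c)) {c..x}"
  obtains N where "negligible N" "\<And>x. x \<in> {c<..<d} - N \<Longrightarrow> (f has_vector_derivative g x) (at x)"
proof (cases "c \<le> d")
  case True
  then have "g integrable_on {c..d}" using assms by force
  then obtain N where N: "negligible N"
    "\<And>x. x \<in> {c<..<d} - N \<Longrightarrow> ((\<lambda>x. integral {c..x} g) has_vector_derivative g x) (at x)"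
    by (rule lebesgue_differentiation) blast
  show ?thesis
  proof (rule that[OF N(1)])
    fix x assume x: "x \<in> {c<..<d} - N"
    have "((\<lambda>x. f c + integral {c..x} g) has_vector_derivative 0 + g x) (at x)"
      by (intro derivative_intros N x)
    then have *: "((\<lambda>x. f c + integral {c..x} g) has_vector_derivative g x) (at x)" by simp
    show "(f has_vector_derivative g x) (at x)"
    proof (rule has_vector_derivative_transform_within_open[OF *, where S="{c<..<d}"])
      show "f c + integral {c..y} g = f y" if "y \<in> {c<..<d}" for y
        using integral_unique[OF assms[of y]] that by simp
    qed (use x in auto)
  qed
qed (rule that[of "{}"], auto)

text \<open>By Lebesgue differentiation the density agrees almost everywhere with the total function
  \<open>vector_derivative f (at x)\<close>, which can therefore replace it under the
  integral.\<close>

lemma abs_cont_on_derivative: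
  assumes f: "abs_cont_on c d f" and "c \<le> d"
  shows "\<exists>N. negligible N \<and> (\<forall>x\<in>{c<..<d} - N. (f has_vector_derivative vector_derivative f (at x)) (at x))"
    and "(\<lambda>x. vector_derivative f (at x)) absolutely_integrable_on {c..d}"
    and "((\<lambda>x. vector_derivative f (at x)) has_integral (f d - f c)) {c..d}"
proof -
  obtain g where g: "g absolutely_integrable_on {c..d}"
    "\<And>x y. c \<le> x \<Longrightarrow> x \<le> y \<Longrightarrow> y \<le> d \<Longrightarrow> (g has_integral (f y - f x)) {x..y}"
    by (rule abs_cont_on_has_integral[OF assms]) blast
  obtain N where N: "negligible N" "\<And>x. x \<in> {c<..<d} - N \<Longrightarrow> (f has_vector_derivative g x) (at x)"
    by (rule has_integral_imp_vector_derivative[of c d g f]) (use g(2) in auto)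
  then have eq: "vector_derivative f (at x) = g x" if "x \<in> {c<..<d} - N" for x
    using that by (simp add: vector_derivative_at)
  show "\<exists>N. negligible N \<and> (\<forall>x\<in>{c<..<d} - N. (f has_vector_derivative vector_derivative f (at x)) (at x))"
    using N eq by metis
  have neg: "negligible (N \<union> {c, d})" using N(1) by (intro negligible_Un) auto
  show "(\<lambda>x. vector_derivative f (at x)) absolutely_integrable_on {c..d}"
    by (rule absolutely_integrable_spike[OF g(1) neg]) (use eq in auto)
  show "((\<lambda>x. vector_derivative f (at x)) has_integral (f d - f c)) {c..d}"
    by (rule has_integral_spike[OF neg _ g(2)]) (use eq \<open>c \<le> d\<close> in auto)
qed

text \<open>The left side is the integral of a sum of restrictions of H of which at most one is
  non-zero at any point. Restricting to open intervals matters, since closed ones may share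
  endpoints.\<close>

lemma sum_integral_disjoint_le:
  fixes H :: "real \<Rightarrow> real"
  assumes H: "H integrable_on {c..d}" "\<And>x. x \<in> {c..d} \<Longrightarrow> 0 \<le> H x"
    and D: "finite D" "\<And>p. p \<in> D \<Longrightarrow> c \<le> fst p \<and> snd p \<le> d"
      "pairwise (\<lambda>i j. {fst i<..<snd i} \<inter> {fst j<..<snd j} = {}) D"
  shows "(\<Sum>p\<in>D. integral {fst p..snd p} H) \<le> integral {c..d} H"
proof -
  let ?h = "\<lambda>p t. if t \<in> {fst p<..<snd p} then H t else 0"
  have eq: "integral {fst p..snd p} H = integral {c..d} (?h p)" if "p \<in> D" for p
  proof -
    have "integral {fst p..snd p} H = integral {fst p<..<snd p} H"
      by (simp add: integral_open_interval_real)
    also have "\<dots> = integral {c..d} (?h p)"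
      using D(2)[OF that]
      by (subst Henstock_Kurzweil_Integration.integral_restrict_Int)
         (simp add: inf.absorb1 greaterThanLessThan_subseteq_atLeastAtMost_iff)
    finally show ?thesis .
  qed
  have int: "?h p integrable_on {c..d}" if "p \<in> D" for p
  proof -
    have "H integrable_on {fst p..snd p}"
      using integrable_on_subinterval[OF H(1)] D(2)[OF that] by auto
    then have "H integrable_on {fst p<..<snd p}" by (simp add: integrable_on_open_interval_real)
    then show ?thesis
      using D(2)[OF that] by (subst integrable_restrict_Int) (simp add: inf.absorb1 greaterThanLessThan_subseteq_atLeastAtMost_iff)
  qed
  have "(\<Sum>p\<in>D. integral {fst p..snd p} H) = (\<Sum>p\<in>D. integral {c..d} (?h p))"
    by (rule sum.cong[OF refl eq])
  also have "\<dots> = integral {c..d} (\<lambda>t. \<Sum>p\<in>D. ?h p t)"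
    by (rule integral_sum[symmetric, OF D(1) int])
  also have "\<dots> \<le> integral {c..d} H"
  proof (rule integral_le[OF _ H(1)])
    show "(\<lambda>t. \<Sum>p\<in>D. ?h p t) integrable_on {c..d}" by (rule integrable_sum[OF D(1) int])
    fix t assume t: "t \<in> {c..d}"
    show "(\<Sum>p\<in>D. ?h p t) \<le> H t"
    proof (cases "\<exists>p\<in>D. t \<in> {fst p<..<snd p}")
      case True
      then obtain p where p: "p \<in> D" "t \<in> {fst p<..<snd p}" by blast
      have "?h q t = 0" if "q \<in> D - {p}" for q
      proof -
        have "{fst p<..<snd p} \<inter> {fst q<..<snd q} = {}"
          using pairwiseD[OF D(3) p(1), of q] that by blast
        then show ?thesis using p(2) by auto
      qed
      then have "(\<Sum>q\<in>D. ?h q t) = ?h p t" using D(1) p(1) by (simp add: sum.remove)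
      also have "\<dots> = H t" using p(2) by simp
      finally show ?thesis by simp
    next
      case False
      then have "?h p t = 0" if "p \<in> D" for p using that by auto
      then show ?thesis using H(2)[OF t] by simp
    qed
  qed
  finally show ?thesis .
qed

text \<open>Split the norm of g at height n. The excess \<open>H n\<close> has a small integral for
  large n by dominated convergence, and the remainder contributes at most n times the total
  length.\<close>

lemma absolutely_integrable_imp_abs_cont_on:
  assumes g: "g absolutely_integrable_on {c..d}"
    and f: "\<And>x y. c \<le> x \<Longrightarrow> x \<le> y \<Longrightarrow> y \<le> d \<Longrightarrow> (g has_integral (f y - f x)) {x..y}"
  shows "abs_cont_on c d f"
  unfolding abs_cont_on_def
proof (intro allI impI)
  fix e :: real assume e: "0 < e"
  define H where "H n t = max (norm (g t) - real n) 0" for n t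
  have G: "(\<lambda>t. norm (g t)) absolutely_integrable_on {c..d}" using absolutely_integrable_norm[OF g] by (simp add: o_def)
  have H: "H n integrable_on {c..d}" for n
  proof -
    have "(\<lambda>t. norm (g t) - real n) absolutely_integrable_on {c..d}"
      by (intro set_integral_diff G absolutely_integrable_continuous_real continuous_intros)
    then have "(\<lambda>t. max (norm (g t) - real n) 0) absolutely_integrable_on {c..d}"
      by (intro absolutely_integrable_max_1) auto
    then show ?thesis unfolding H_def[abs_def] by (simp add: absolutely_integrable_on_def)
  qed
  have "(\<lambda>n. integral {c..d} (H n)) \<longlonglongrightarrow> integral {c..d} (\<lambda>t. 0)"
  proof (rule dominated_convergence(2))
    show "(\<lambda>t. norm (g t)) integrable_on {c..d}" using G by (simp add: absolutely_integrable_on_def)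
    show "norm (H n t) \<le> norm (g t)" for n t by (auto simp: H_def)
    show "(\<lambda>n. H n t) \<longlonglongrightarrow> 0" for t
    proof (rule tendsto_eventually)
      show "\<forall>\<^sub>F n in sequentially. H n t = 0"
        using eventually_ge_at_top[of "nat \<lceil>norm (g t)\<rceil>"]
        by eventually_elim (auto simp: H_def max_def nat_ceiling_le_eq)
    qed
  qed (rule H)
  then have "\<forall>\<^sub>F n in sequentially. integral {c..d} (H n) < e/2"
    using e by (intro order_tendstoD(2)[where y=0]) auto
  then obtain n where n: "integral {c..d} (H n) < e/2" by (auto simp: eventually_sequentially)
  \<comment> \<open>Chosen so that n * \<delta> \<le> e/2; the + 1 covers n = 0.\<close>
  define \<delta> where "\<delta> = e / (2 * (real n + 1))"
  have "\<delta> > 0" using e by (simp add: \<delta>_def)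
  show "\<exists>\<delta>>0. \<forall>D. finite D \<longrightarrow> (\<forall>(x, y)\<in>D. c \<le> x \<and> x \<le> y \<and> y \<le> d) \<longrightarrow>
        pairwise (\<lambda>i j. {fst i<..<snd i} \<inter> {fst j<..<snd j} = {}) D \<longrightarrow>
        (\<Sum>(x, y)\<in>D. y - x) < \<delta> \<longrightarrow> (\<Sum>(x, y)\<in>D. norm (f y - f x)) < e"
  proof (intro exI[of _ \<delta>] conjI allI impI)
    fix D :: "(real \<times> real) set"
    assume D: "finite D" "\<forall>(x, y)\<in>D. c \<le> x \<and> x \<le> y \<and> y \<le> d"
        "pairwise (\<lambda>i j. {fst i<..<snd i} \<inter> {fst j<..<snd j} = {}) D" "(\<Sum>(x, y)\<in>D. y - x) < \<delta>"
    have D': "c \<le> fst p \<and> fst p \<le> snd p \<and> snd p \<le> d" if "p \<in> D" for p using D(2) that by auto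
    have "(\<Sum>(x, y)\<in>D. norm (f y - f x)) = (\<Sum>p\<in>D. norm (f (snd p) - f (fst p)))"
      by (simp add: case_prod_beta)
    also have "\<dots> \<le> (\<Sum>p\<in>D. integral {fst p..snd p} (H n) + real n * (snd p - fst p))"
    proof (rule sum_mono)
      fix p assume "p \<in> D"
      note p = D'[OF this]
      have sub: "{fst p..snd p} \<subseteq> {c..d}" using p by auto
      have Hi: "H n integrable_on {fst p..snd p}" using integrable_on_subinterval[OF H sub] .
      have "norm (f (snd p) - f (fst p)) = norm (integral {fst p..snd p} g)"
        using f[of "fst p" "snd p"] p by (simp add: integral_unique)
      also have "\<dots> \<le> integral {fst p..snd p} (\<lambda>t. H n t + real n)"
      proof (rule integral_norm_bound_integral)
        show "g integrable_on {fst p..snd p}" using f[of "fst p" "snd p"] p by blast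
        show "(\<lambda>t. H n t + real n) integrable_on {fst p..snd p}" using Hi by (intro integrable_add) auto
        show "norm (g t) \<le> H n t + real n" for t by (auto simp: H_def)
      qed
      also have "\<dots> = integral {fst p..snd p} (H n) + real n * (snd p - fst p)"
        using Hi p by (subst integral_add) auto
      finally show "norm (f (snd p) - f (fst p)) \<le> integral {fst p..snd p} (H n) + real n * (snd p - fst p)" .
    qed
    also have "\<dots> = (\<Sum>p\<in>D. integral {fst p..snd p} (H n)) + real n * (\<Sum>(x, y)\<in>D. y - x)"
      by (simp add: sum.distrib sum_distrib_left case_prod_beta)
    also have "\<dots> \<le> integral {c..d} (H n) + real n * \<delta>"
      using D D' by (intro add_mono sum_integral_disjoint_le H mult_left_mono) (auto simp: H_def)
    also have "real n * \<delta> \<le> e/2"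
      using e by (simp add: \<delta>_def field_simps)
    finally show "(\<Sum>(x, y)\<in>D. norm (f y - f x)) < e" using n by linarith
  qed fact
qed

section \<open>Closure properties of absolute continuity\<close>

lemma abs_cont_on_cong:
  assumes "\<And>x. x \<in> {c..d} \<Longrightarrow> f x = g x" "abs_cont_on c d f"
  shows "abs_cont_on c d g"
  unfolding abs_cont_on_def
proof (intro allI impI)
  fix e :: real assume "0 < e"
  then obtain \<delta> where \<delta>: "\<delta> > 0" "\<And>D. finite D \<Longrightarrow> (\<forall>(x, y)\<in>D. c \<le> x \<and> x \<le> y \<and> y \<le> d) \<Longrightarrow>
        pairwise (\<lambda>i j. {fst i<..<snd i} \<inter> {fst j<..<snd j} = {}) D \<Longrightarrow>
        (\<Sum>(x, y)\<in>D. y - x) < \<delta> \<Longrightarrow> (\<Sum>(x, y)\<in>D. norm (f y - f x)) < e"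
    using assms(2) unfolding abs_cont_on_def by blast
  show "\<exists>\<delta>>0. \<forall>D. finite D \<longrightarrow> (\<forall>(x, y)\<in>D. c \<le> x \<and> x \<le> y \<and> y \<le> d) \<longrightarrow>
        pairwise (\<lambda>i j. {fst i<..<snd i} \<inter> {fst j<..<snd j} = {}) D \<longrightarrow>
        (\<Sum>(x, y)\<in>D. y - x) < \<delta> \<longrightarrow> (\<Sum>(x, y)\<in>D. norm (g y - g x)) < e"
  proof (intro exI[of _ \<delta>] conjI allI impI)
    fix D :: "(real \<times> real) set"
    assume D: "finite D" "\<forall>(x, y)\<in>D. c \<le> x \<and> x \<le> y \<and> y \<le> d"
        "pairwise (\<lambda>i j. {fst i<..<snd i} \<inter> {fst j<..<snd j} = {}) D" "(\<Sum>(x, y)\<in>D. y - x) < \<delta>"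
    have "(\<Sum>(x, y)\<in>D. norm (g y - g x)) = (\<Sum>(x, y)\<in>D. norm (f y - f x))"
      using D(2) assms(1) by (intro sum.cong) auto
    then show "(\<Sum>(x, y)\<in>D. norm (g y - g x)) < e" using \<delta>(2)[OF D] by simp
  qed (rule \<delta>(1))
qed

text \<open>Common source of the closure properties: the increments of a sum, a conjugate or, on a
  compact interval, a product are bounded by those of its constituents.\<close>

lemma abs_cont_on_increments:
  assumes f: "abs_cont_on c d f" and g: "abs_cont_on c d g" and M: "M > 0"
    and h: "\<And>x y. c \<le> x \<Longrightarrow> x \<le> y \<Longrightarrow> y \<le> d \<Longrightarrow> norm (h y - h x) \<le> M * (norm (f y - f x) + norm (g y - g x))"
  shows "abs_cont_on c d h"
  unfolding abs_cont_on_def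
proof (intro allI impI)
  fix e :: real assume "0 < e"
  then have e: "e / (2 * M) > 0" using M by simp
  obtain d1 where d1: "d1 > 0" "\<And>D. finite D \<Longrightarrow> (\<forall>(x, y)\<in>D. c \<le> x \<and> x \<le> y \<and> y \<le> d) \<Longrightarrow>
        pairwise (\<lambda>i j. {fst i<..<snd i} \<inter> {fst j<..<snd j} = {}) D \<Longrightarrow>
        (\<Sum>(x, y)\<in>D. y - x) < d1 \<Longrightarrow> (\<Sum>(x, y)\<in>D. norm (f y - f x)) < e / (2 * M)"
    using f e unfolding abs_cont_on_def by blast
  obtain d2 where d2: "d2 > 0" "\<And>D. finite D \<Longrightarrow> (\<forall>(x, y)\<in>D. c \<le> x \<and> x \<le> y \<and> y \<le> d) \<Longrightarrow>
        pairwise (\<lambda>i j. {fst i<..<snd i} \<inter> {fst j<..<snd j} = {}) D \<Longrightarrow>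
        (\<Sum>(x, y)\<in>D. y - x) < d2 \<Longrightarrow> (\<Sum>(x, y)\<in>D. norm (g y - g x)) < e / (2 * M)"
    using g e unfolding abs_cont_on_def by blast
  show "\<exists>\<delta>>0. \<forall>D. finite D \<longrightarrow> (\<forall>(x, y)\<in>D. c \<le> x \<and> x \<le> y \<and> y \<le> d) \<longrightarrow>
        pairwise (\<lambda>i j. {fst i<..<snd i} \<inter> {fst j<..<snd j} = {}) D \<longrightarrow>
        (\<Sum>(x, y)\<in>D. y - x) < \<delta> \<longrightarrow> (\<Sum>(x, y)\<in>D. norm (h y - h x)) < e"
  proof (intro exI[of _ "min d1 d2"] conjI allI impI)
    fix D :: "(real \<times> real) set"
    assume D: "finite D" "\<forall>(x, y)\<in>D. c \<le> x \<and> x \<le> y \<and> y \<le> d"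
        "pairwise (\<lambda>i j. {fst i<..<snd i} \<inter> {fst j<..<snd j} = {}) D" "(\<Sum>(x, y)\<in>D. y - x) < min d1 d2"
    have "(\<Sum>(x, y)\<in>D. norm (h y - h x)) \<le> (\<Sum>(x, y)\<in>D. M * (norm (f y - f x) + norm (g y - g x)))"
      using D(2) h by (intro sum_mono) auto
    also have "\<dots> = M * ((\<Sum>(x, y)\<in>D. norm (f y - f x)) + (\<Sum>(x, y)\<in>D. norm (g y - g x)))"
      by (simp add: case_prod_beta sum_distrib_left sum.distrib distrib_left)
    also have "\<dots> < M * (e / (2 * M) + e / (2 * M))"
      using D M by (intro mult_strict_left_mono add_strict_mono d1 d2) auto
    also have "\<dots> = e" using M by (simp add: field_simps)
    finally show "(\<Sum>(x, y)\<in>D. norm (h y - h x)) < e" .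
  qed (use d1 d2 in auto)
qed

lemma abs_cont_on_add: "abs_cont_on c d f \<Longrightarrow> abs_cont_on c d g \<Longrightarrow> abs_cont_on c d (\<lambda>x. f x + g x)"
  by (erule (1) abs_cont_on_increments[where M=1]) (auto simp: add_diff_add norm_triangle_ineq)

lemma abs_cont_on_cnj: "abs_cont_on c d f \<Longrightarrow> abs_cont_on c d (\<lambda>x. cnj (f x))"
  by (rule abs_cont_on_increments[where M=1]) (auto simp: complex_cnj_diff[symmetric] simp del: complex_cnj_diff)

lemma abs_cont_on_continuous:
  assumes "abs_cont_on c d f"
  shows "continuous_on {c..d} f"
  unfolding continuous_on_iff
proof (intro ballI allI impI)
  fix x e :: real assume x: "x \<in> {c..d}" "e > 0"
  then obtain \<delta> where \<delta>: "\<delta> > 0" "\<And>D. finite D \<Longrightarrow> (\<forall>(x, y)\<in>D. c \<le> x \<and> x \<le> y \<and> y \<le> d) \<Longrightarrow>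
        pairwise (\<lambda>i j. {fst i<..<snd i} \<inter> {fst j<..<snd j} = {}) D \<Longrightarrow>
        (\<Sum>(x, y)\<in>D. y - x) < \<delta> \<Longrightarrow> (\<Sum>(x, y)\<in>D. norm (f y - f x)) < e"
    using assms unfolding abs_cont_on_def by blast
  have "norm (f v - f u) < e" if "c \<le> u" "u \<le> v" "v \<le> d" "v - u < \<delta>" for u v
    using \<delta>(2)[of "{(u, v)}"] that by auto
  then have "dist (f y) (f x) < e" if "y \<in> {c..d}" "dist y x < \<delta>" for y
    using that x by (cases "x \<le> y") (force simp: dist_real_def dist_norm norm_minus_commute)+
  then show "\<exists>\<delta>>0. \<forall>y\<in>{c..d}. dist y x < \<delta> \<longrightarrow> dist (f y) (f x) < e" using \<delta>(1) by blast
qed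

lemma abs_cont_on_mult:
  assumes "abs_cont_on c d f" "abs_cont_on c d g"
  shows "abs_cont_on c d (\<lambda>x. f x * g x)"
proof -
  have "bounded (f ` {c..d})" "bounded (g ` {c..d})"
    using assms by (auto intro!: compact_imp_bounded compact_continuous_image abs_cont_on_continuous)
  then obtain B1 B2 where B: "\<And>x. x \<in> {c..d} \<Longrightarrow> norm (f x) \<le> B1" "\<And>x. x \<in> {c..d} \<Longrightarrow> norm (g x) \<le> B2"
    unfolding bounded_iff by blast
  define M where "M = \<bar>B1\<bar> + \<bar>B2\<bar> + 1"
  show ?thesis
  proof (rule abs_cont_on_increments[OF assms, where M=M])
    fix x y assume xy: "c \<le> x" "x \<le> y" "y \<le> d"
    have b: "norm (f y) \<le> M" "norm (g x) \<le> M" using B(1)[of y] B(2)[of x] xy by (auto simp: M_def)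
    have "f y * g y - f x * g x = f y * (g y - g x) + (f y - f x) * g x" by (simp add: algebra_simps)
    then have "norm (f y * g y - f x * g x) \<le> norm (f y) * norm (g y - g x) + norm (f y - f x) * norm (g x)"
      by (metis norm_mult norm_triangle_ineq)
    also have "\<dots> \<le> M * norm (g y - g x) + norm (f y - f x) * M"
      using b by (intro add_mono mult_right_mono mult_left_mono) auto
    finally show "norm (f y * g y - f x * g x) \<le> M * (norm (f y - f x) + norm (g y - g x))"
      by (simp add: algebra_simps)
  qed (simp add: M_def)
qed

lemma abs_cont_on_const: "abs_cont_on c d (\<lambda>x. k)"
  unfolding abs_cont_on_def by (auto simp: case_prod_beta intro: exI[of _ 1])

section \<open>The differential expression\<close>

lemma open_sl_int [simp]: "open (sl_int S)"
  by (simp add: sl_int_def)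

lemma sl_int_sets [simp]: "sl_int S \<in> sets lebesgue"
  by (simp add: sl_int_def)

lemma mem_sl_int: "x \<in> sl_int S \<longleftrightarrow> lend S < ereal x \<and> ereal x < rend S"
  by (simp add: sl_int_def einterval_iff)

lemma Icc_subset_sl_int: "c \<in> sl_int S \<Longrightarrow> d \<in> sl_int S \<Longrightarrow> {c..d} \<subseteq> sl_int S"
  unfolding subset_iff mem_sl_int atLeastAtMost_iff
  by (metis ereal_less_eq(3) le_less_trans less_le_trans)

lemma AE_lebesgue_on_iff:
  assumes "A \<in> sets lebesgue"
  shows "(AE x in lebesgue_on A. P x) \<longleftrightarrow> (\<exists>N. negligible N \<and> (\<forall>x\<in>A - N. P x))"
proof -
  have "(AE x in lebesgue_on A. P x) \<longleftrightarrow> (AE x in lebesgue. x \<in> A \<longrightarrow> P x)"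
    using assms by (simp add: AE_restrict_space_iff)
  also have "\<dots> \<longleftrightarrow> (\<exists>N. negligible N \<and> (\<forall>x\<in>A - N. P x))"
    by (auto simp: eventually_ae_filter negligible_iff_null_sets)
  finally show ?thesis .
qed

lemma lebesgue_on_borel_measurable_AE:
  fixes f g :: "real \<Rightarrow> 'b::euclidean_space"
  assumes A: "A \<in> sets lebesgue" and f: "f \<in> borel_measurable (lebesgue_on A)"
    and eq: "AE x in lebesgue_on A. f x = g x"
  shows "g \<in> borel_measurable (lebesgue_on A)"
proof -
  have "(\<lambda>x. indicator A x *\<^sub>R f x) \<in> borel_measurable lebesgue"
    using f A by (simp add: borel_measurable_restrict_space_iff)
  moreover have "AE x in lebesgue. x \<in> A \<longrightarrow> f x = g x"
    using eq A by (simp add: AE_restrict_space_iff)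
  then have "AE x in lebesgue. indicator A x *\<^sub>R f x = indicator A x *\<^sub>R g x"
    by eventually_elim (auto simp: indicator_def)
  ultimately have "(\<lambda>x. indicator A x *\<^sub>R g x) \<in> borel_measurable lebesgue"
    by (rule borel_measurable_AE)
  then show ?thesis using A by (simp add: borel_measurable_restrict_space_iff)
qed

lemma AC_loc_D: "AC_loc (lend S) (rend S) f \<Longrightarrow> c \<in> sl_int S \<Longrightarrow> d \<in> sl_int S \<Longrightarrow> c \<le> d \<Longrightarrow> abs_cont_on c d f"
  by (auto simp: AC_loc_def mem_sl_int)

lemma AC_locI:
  "(\<And>c d. c \<in> sl_int S \<Longrightarrow> d \<in> sl_int S \<Longrightarrow> c \<le> d \<Longrightarrow> abs_cont_on c d f) \<Longrightarrow> AC_loc (lend S) (rend S) f"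
  unfolding AC_loc_def mem_sl_int
  by (meson ereal_less_eq(3) le_less_trans less_le_trans)

lemma AC_loc_cong:
  assumes "AC_loc (lend S) (rend S) f" "\<And>x. x \<in> sl_int S \<Longrightarrow> f x = g x"
  shows "AC_loc (lend S) (rend S) g"
proof (rule AC_locI)
  fix c d assume cd: "c \<in> sl_int S" "d \<in> sl_int S" "c \<le> d"
  show "abs_cont_on c d g"
    by (rule abs_cont_on_cong[OF _ AC_loc_D[OF assms(1) cd]])
       (use assms(2) Icc_subset_sl_int[OF cd(1,2)] in blast)
qed

lemma AC_loc_add: "AC_loc a b f \<Longrightarrow> AC_loc a b g \<Longrightarrow> AC_loc a b (\<lambda>x. f x + g x)"
  by (simp add: AC_loc_def abs_cont_on_add)

lemma AC_loc_mult: "AC_loc a b f \<Longrightarrow> AC_loc a b g \<Longrightarrow> AC_loc a b (\<lambda>x. f x * g x)"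
  by (simp add: AC_loc_def abs_cont_on_mult)

lemma AC_loc_const: "AC_loc a b (\<lambda>x. k)"
  by (simp add: AC_loc_def abs_cont_on_const)

lemma AC_loc_diff:
  assumes "AC_loc a b f" "AC_loc a b g"
  shows "AC_loc a b (\<lambda>x. f x - g x)"
  using AC_loc_add[OF assms(1) AC_loc_mult[OF AC_loc_const[of a b "-1"] assms(2)]] by simp

lemma AC_loc_cnj: "AC_loc a b f \<Longrightarrow> AC_loc a b (\<lambda>x. cnj (f x))"
  by (simp add: AC_loc_def abs_cont_on_cnj)

lemma L1_loc_D: "L1_loc (lend S) (rend S) f \<Longrightarrow> c \<in> sl_int S \<Longrightarrow> d \<in> sl_int S \<Longrightarrow> f absolutely_integrable_on {c..d}"
  by (cases "c \<le> d") (auto simp: L1_loc_def mem_sl_int)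

section \<open>Exhaustion of the interval and almost everywhere arguments\<close>

locale sturm_liouville =
  fixes S :: sl_data
  assumes coeffs: "sl_coeffs S"
begin

lemma ends: "lend S < rend S"
  using coeffs by (simp add: sl_coeffs_def)

lemma sl_int_exhaustion:
  "\<exists>(l :: nat \<Rightarrow> real) u. sl_int S = (\<Union>i. {l i..u i}) \<and> (\<forall>i. l i \<in> sl_int S \<and> u i \<in> sl_int S \<and> l i < u i)"
proof -
  obtain u l :: "nat \<Rightarrow> real" where *: "sl_int S = (\<Union>i. {l i .. u i})" "\<And>i. l i < u i"
    unfolding sl_int_def by (rule einterval_Icc_approximation[OF ends]) blast
  have "{l i..u i} \<subseteq> sl_int S" for i unfolding *(1) by (rule UN_upper) simp
  then have "l i \<in> sl_int S" "u i \<in> sl_int S" for i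
    using *(2)[of i] by (meson atLeastAtMost_iff less_imp_le order_refl subset_iff)+
  then show ?thesis using * by metis
qed

lemma sl_int_ex: "\<exists>c. c \<in> sl_int S"
  unfolding sl_int_def using einterval_nonempty[OF ends] by blast

text \<open>The interval is a countable union of compact ones, so exceptional sets can be found
  locally. The countably many endpoints join the null set.\<close>

lemma AE_sl_intI:
  assumes "\<And>c d. c \<in> sl_int S \<Longrightarrow> d \<in> sl_int S \<Longrightarrow> c < d \<Longrightarrow> \<exists>N. negligible N \<and> (\<forall>x\<in>{c<..<d} - N. P x)"
  shows "AE x in lebesgue_on (sl_int S). P x"
proof -
  obtain l u where *: "sl_int S = (\<Union>i::nat. {l i..u i})"
    and lu: "\<And>i. l i \<in> sl_int S" "\<And>i. u i \<in> sl_int S" "\<And>i. l i < u i"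
    using sl_int_exhaustion by metis
  have "\<forall>i. \<exists>N. negligible N \<and> (\<forall>x\<in>{l i<..<u i} - N. P x)" using assms[OF lu] by blast
  then obtain N where N: "\<And>i. negligible (N i)" "\<And>i x. x \<in> {l i<..<u i} - N i \<Longrightarrow> P x" by metis
  show ?thesis
    unfolding AE_lebesgue_on_iff[OF sl_int_sets]
  proof (intro exI conjI ballI)
    show "negligible (\<Union>i. N i \<union> {l i, u i})"
      using N(1) by (intro negligible_Union_nat negligible_Un) auto
    fix x assume x: "x \<in> sl_int S - (\<Union>i. N i \<union> {l i, u i})"
    then obtain i where "x \<in> {l i..u i}" unfolding * by blast
    then have "x \<in> {l i<..<u i} - N i" using x by fastforce
    then show "P x" by (rule N(2))
  qed
qed

lemma sl_int_borel_measurableI: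
  fixes f :: "real \<Rightarrow> 'b::euclidean_space"
  assumes "\<And>c d. c \<in> sl_int S \<Longrightarrow> d \<in> sl_int S \<Longrightarrow> c < d \<Longrightarrow> f \<in> borel_measurable (lebesgue_on {c..d})"
  shows "f \<in> borel_measurable (lebesgue_on (sl_int S))"
proof -
  obtain l u where *: "sl_int S = (\<Union>i::nat. {l i..u i})"
    and lu: "\<And>i. l i \<in> sl_int S" "\<And>i. u i \<in> sl_int S" "\<And>i. l i < u i"
    using sl_int_exhaustion by metis
  show ?thesis
  proof (rule measurable_piecewise_restrict)
    show "countable (range (\<lambda>i. {l i..u i}))" by simp
    fix \<Omega> assume "\<Omega> \<in> range (\<lambda>i. {l i..u i})"
    then obtain i where \<Omega>: "\<Omega> = {l i..u i}" by blast
    have sub: "sl_int S \<inter> \<Omega> = \<Omega>" unfolding * \<Omega> by blast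
    show "\<Omega> \<inter> space (lebesgue_on (sl_int S)) \<in> sets (lebesgue_on (sl_int S))"
    proof -
      have "\<Omega> \<in> sets lebesgue" unfolding \<Omega> by simp
      then show ?thesis using sub by (metis image_eqI inf_commute sets_restrict_space space_lebesgue_on)
    qed
    show "f \<in> borel_measurable (restrict_space (lebesgue_on (sl_int S)) \<Omega>)"
      using assms[OF lu] \<Omega> sub by (simp add: restrict_restrict_space)
  qed (use * in auto)
qed

lemma L1_loc_measurable: "L1_loc (lend S) (rend S) f \<Longrightarrow> f \<in> borel_measurable (lebesgue_on (sl_int S))"
  by (rule sl_int_borel_measurableI) (simp add: L1_loc_D absolutely_integrable_imp_borel_measurable)

lemma cw_measurable: "cw S \<in> borel_measurable (lebesgue_on (sl_int S))"
  using coeffs by (simp add: sl_coeffs_def L1_loc_measurable)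

lemma cp_pos: "AE x in lebesgue_on (sl_int S). 0 < cp S x" and cw_pos: "AE x in lebesgue_on (sl_int S). 0 < cw S x"
  using coeffs by (auto simp: sl_coeffs_def)

lemma AC_loc_continuous: 
  assumes "AC_loc (lend S) (rend S) f"
  shows "continuous_on (sl_int S) f"
  unfolding continuous_on_eq_continuous_at[OF open_sl_int]
proof
  fix x assume "x \<in> sl_int S"
  then obtain e where e: "e > 0" "cball x e \<subseteq> sl_int S" using open_contains_cball open_sl_int by blast
  have "x - e \<in> cball x e" "x + e \<in> cball x e" using e by (auto simp: dist_real_def)
  then have "continuous_on {x-e..x+e} f"
    using assms e by (intro abs_cont_on_continuous AC_loc_D) auto
  then have "continuous_on {x-e<..<x+e} f" by (rule continuous_on_subset) auto
  then show "isCont f x" using e by (simp add: continuous_on_eq_continuous_at)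
qed

lemma AC_loc_has_vector_derivative:
  assumes "AC_loc (lend S) (rend S) f"
  shows "AE x in lebesgue_on (sl_int S). (f has_vector_derivative vector_derivative f (at x)) (at x)"
  by (rule AE_sl_intI) (rule abs_cont_on_derivative(1), auto intro: AC_loc_D[OF assms])

text \<open>The fundamental theorem for whatever formula describes the derivative almost everywhere,
  such as the one in \<open>wronskian_deriv\<close>.\<close>

lemma AC_loc_has_integral:
  assumes f: "AC_loc (lend S) (rend S) f"
    and g: "AE x in lebesgue_on (sl_int S). (f has_vector_derivative g x) (at x)"
    and cd: "c \<in> sl_int S" "d \<in> sl_int S" "c \<le> d"
  shows "g absolutely_integrable_on {c..d}" "(g has_integral (f d - f c)) {c..d}"
proof -
  obtain N where N: "negligible N" "\<And>x. x \<in> sl_int S - N \<Longrightarrow> (f has_vector_derivative g x) (at x)"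
    using g unfolding AE_lebesgue_on_iff[OF sl_int_sets] by blast
  have eq: "g x = vector_derivative f (at x)" if "x \<in> {c..d} - N" for x
    using N(2)[of x] that Icc_subset_sl_int[OF cd(1,2)] by (auto simp: vector_derivative_at)
  note d = abs_cont_on_derivative[OF AC_loc_D[OF f cd] cd(3)]
  show "g absolutely_integrable_on {c..d}"
    by (rule absolutely_integrable_spike[OF d(2) N(1)]) (rule eq)
  show "(g has_integral (f d - f c)) {c..d}"
    by (rule has_integral_spike[OF N(1) _ d(3)]) (rule eq)
qed

lemma AE_eq_imp_eq:
  fixes f g :: "real \<Rightarrow> complex"
  assumes "continuous_on (sl_int S) f" "continuous_on (sl_int S) g" "AE x in lebesgue_on (sl_int S). f x = g x"
    and x: "x \<in> sl_int S"
  shows "f x = g x"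
proof (rule ccontr)
  assume ne: "f x \<noteq> g x"
  define U where "U = sl_int S \<inter> (\<lambda>x. f x - g x) -` (- {0})"
  have "open U"
    unfolding U_def using assms by (intro continuous_open_preimage continuous_intros) auto
  moreover have "x \<in> U" using ne x by (simp add: U_def)
  ultimately have "\<not> negligible U" using open_not_negligible by blast
  moreover obtain N where "negligible N" "\<And>x. x \<in> sl_int S - N \<Longrightarrow> f x = g x"
    using assms(3) unfolding AE_lebesgue_on_iff[OF sl_int_sets] by blast
  then have "negligible U" by (rule_tac negligible_subset) (auto simp: U_def)
  ultimately show False by blast
qed

text \<open>Justifies the description operator: two representatives are continuous and agree almost
  everywhere, hence everywhere inside the interval, and both vanish outside.\<close>

lemma pderiv_rep_eq:
  assumes "is_pderiv S f h"
  shows "pderiv_rep S f = h"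
  unfolding pderiv_rep_def
proof (rule the_equality[where P="is_pderiv S f", OF assms])
  fix k assume k: "is_pderiv S f k"
  have "AE x in lebesgue_on (sl_int S). k x = h x"
    using assms k unfolding is_pderiv_def by (auto elim: eventually_elim2)
  then have "k x = h x" if "x \<in> sl_int S" for x
    using assms k that by (intro AE_eq_imp_eq AC_loc_continuous) (auto simp: is_pderiv_def)
  then show "k = h" using assms k unfolding is_pderiv_def fun_eq_iff by metis
qed

section \<open>Calculus of regular functions, of p f' and of the differential expression\<close>

lemma is_pderiv_rep: "sl_regular S f \<Longrightarrow> is_pderiv S f (pderiv_rep S f)"
  unfolding sl_regular_def using pderiv_rep_eq by blast

lemma regular_AC:
  assumes "sl_regular S f"
  shows "AC_loc (lend S) (rend S) f" "AC_loc (lend S) (rend S) (pderiv_rep S f)"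
  using assms is_pderiv_rep[OF assms] by (auto simp: sl_regular_def is_pderiv_def)

lemma regular_deriv:
  assumes "sl_regular S f"
  shows "AE x in lebesgue_on (sl_int S). (f has_vector_derivative pderiv_rep S f x / of_real (cp S x)) (at x)"
proof -
  have "AE x in lebesgue_on (sl_int S). pderiv_rep S f x = of_real (cp S x) * vector_derivative f (at x)"
    using is_pderiv_rep[OF assms] by (simp add: is_pderiv_def)
  with AC_loc_has_vector_derivative[OF regular_AC(1)[OF assms]] cp_pos show ?thesis
    by eventually_elim (simp add: field_simps)
qed

lemma regular_deriv2:
  assumes "sl_regular S f"
  shows "AE x in lebesgue_on (sl_int S).
    (pderiv_rep S f has_vector_derivative - of_real (cw S x) * ell S f x - of_real (cq S x) * f x) (at x)"
  using AC_loc_has_vector_derivative[OF regular_AC(2)[OF assms]] cw_pos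
  by eventually_elim (simp add: ell_def field_simps)

text \<open>Frees candidates for p f' from the normalisation off the interval: h may be arbitrary
  there, and k cuts it off.\<close>

lemma sl_regularI:
  assumes "AC_loc (lend S) (rend S) f" "AC_loc (lend S) (rend S) h"
    and f: "AE x in lebesgue_on (sl_int S). (f has_vector_derivative h x / of_real (cp S x)) (at x)"
  shows "sl_regular S f" "\<And>x. x \<in> sl_int S \<Longrightarrow> pderiv_rep S f x = h x"
proof -
  define k where "k x = (if x \<in> sl_int S then h x else 0)" for x
  have k: "is_pderiv S f k"
    unfolding is_pderiv_def
  proof (intro conjI)
    show "AC_loc (lend S) (rend S) k" by (rule AC_loc_cong[OF assms(2)]) (simp add: k_def)
    have "AE x in lebesgue_on (sl_int S). x \<in> sl_int S"
      unfolding AE_lebesgue_on_iff[OF sl_int_sets] by (intro exI[of _ "{}"]) auto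
    with f cp_pos show "AE x in lebesgue_on (sl_int S). k x = of_real (cp S x) * vector_derivative f (at x)"
      by eventually_elim (auto simp: k_def vector_derivative_at)
  qed (simp add: k_def)
  then show "sl_regular S f" using assms(1) by (auto simp: sl_regular_def)
  show "\<And>x. x \<in> sl_int S \<Longrightarrow> pderiv_rep S f x = h x" unfolding pderiv_rep_eq[OF k] by (simp add: k_def)
qed

lemma vector_derivative_cong:
  assumes "x \<in> sl_int S" "\<And>y. y \<in> sl_int S \<Longrightarrow> f y = g y"
  shows "(f has_vector_derivative d) (at x) \<longleftrightarrow> (g has_vector_derivative d) (at x)"
  using has_vector_derivative_transform_within_open[OF _ open_sl_int assms(1), of f d g]
    has_vector_derivative_transform_within_open[OF _ open_sl_int assms(1), of g d f] assms(2) by auto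

text \<open>Converse of \<open>regular_deriv2\<close>: the value of \<open>ell\<close> is read off
  from a derivative of p f'.\<close>

lemma ell_AE:
  assumes f: "sl_regular S f" and eq: "\<And>x. x \<in> sl_int S \<Longrightarrow> pderiv_rep S f x = h x"
    and h: "AE x in lebesgue_on (sl_int S). (h has_vector_derivative - of_real (cw S x) * k x - of_real (cq S x) * f x) (at x)"
  shows "AE x in lebesgue_on (sl_int S). ell S f x = k x"
proof -
  have "AE x in lebesgue_on (sl_int S). x \<in> sl_int S"
    unfolding AE_lebesgue_on_iff[OF sl_int_sets] by (intro exI[of _ "{}"]) auto
  with h cw_pos show ?thesis
  proof eventually_elim
    case (elim x)
    have "(pderiv_rep S f has_vector_derivative - of_real (cw S x) * k x - of_real (cq S x) * f x) (at x)"
      using elim eq by (subst vector_derivative_cong[of x "pderiv_rep S f" h]) auto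
    then show ?case using elim(2) by (simp add: ell_def vector_derivative_at field_simps)
  qed
qed

text \<open>Needed because elements of \<open>Dmax\<close> vanish off the interval, while solutions
  and frame functions are arbitrary there.\<close>

lemma regular_cong:
  assumes "sl_regular S f" and eq: "\<And>x. x \<in> sl_int S \<Longrightarrow> f x = g x"
  shows "sl_regular S g" "\<And>x. x \<in> sl_int S \<Longrightarrow> pderiv_rep S g x = pderiv_rep S f x"
    "AE x in lebesgue_on (sl_int S). ell S g x = ell S f x"
proof -
  have AE: "AE x in lebesgue_on (sl_int S). x \<in> sl_int S"
    unfolding AE_lebesgue_on_iff[OF sl_int_sets] by (intro exI[of _ "{}"]) auto
  have "AE x in lebesgue_on (sl_int S). (g has_vector_derivative pderiv_rep S f x / of_real (cp S x)) (at x)"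
    using regular_deriv[OF assms(1)] AE by eventually_elim (use vector_derivative_cong[of _ f g] eq in auto)
  note * = sl_regularI[OF AC_loc_cong[OF regular_AC(1)[OF assms(1)] eq] regular_AC(2)[OF assms(1)] this]
  show "sl_regular S g" "\<And>x. x \<in> sl_int S \<Longrightarrow> pderiv_rep S g x = pderiv_rep S f x" using * by auto
  show "AE x in lebesgue_on (sl_int S). ell S g x = ell S f x"
  proof (rule ell_AE[OF * ])
    show "AE x in lebesgue_on (sl_int S). (pderiv_rep S f has_vector_derivative
       - of_real (cw S x) * ell S f x - of_real (cq S x) * g x) (at x)"
      using regular_deriv2[OF assms(1)] AE by eventually_elim (simp add: eq)
  qed
qed

lemma regular_cnj:
  assumes f: "sl_regular S f"
  shows "sl_regular S (\<lambda>x. cnj (f x))" "\<And>x. x \<in> sl_int S \<Longrightarrow> pderiv_rep S (\<lambda>x. cnj (f x)) x = cnj (pderiv_rep S f x)"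
    "AE x in lebesgue_on (sl_int S). ell S (\<lambda>x. cnj (f x)) x = cnj (ell S f x)"
proof -
  have d: "((\<lambda>x. cnj (k x)) has_vector_derivative cnj k') (at x)"
    if "(k has_vector_derivative k') (at x)" for k k' and x :: real
    by (rule bounded_linear.has_vector_derivative[OF bounded_linear_cnj that])
  have "AE x in lebesgue_on (sl_int S). ((\<lambda>x. cnj (f x)) has_vector_derivative cnj (pderiv_rep S f x) / of_real (cp S x)) (at x)"
    using regular_deriv[OF f]
  proof eventually_elim
    case (elim x)
    from d[OF elim] show ?case by simp
  qed
  note * = sl_regularI[OF AC_loc_cnj[OF regular_AC(1)[OF f]] AC_loc_cnj[OF regular_AC(2)[OF f]] this]
  show "sl_regular S (\<lambda>x. cnj (f x))" "\<And>x. x \<in> sl_int S \<Longrightarrow> pderiv_rep S (\<lambda>x. cnj (f x)) x = cnj (pderiv_rep S f x)"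
    using * by auto
  show "AE x in lebesgue_on (sl_int S). ell S (\<lambda>x. cnj (f x)) x = cnj (ell S f x)"
  proof (rule ell_AE[OF *])
    show "AE x in lebesgue_on (sl_int S). ((\<lambda>x. cnj (pderiv_rep S f x)) has_vector_derivative
       - of_real (cw S x) * cnj (ell S f x) - of_real (cq S x) * cnj (f x)) (at x)"
      using regular_deriv2[OF f]
    proof eventually_elim
      case (elim x)
      from d[OF elim] show ?case by simp
    qed
  qed
qed

text \<open>Kept bilinear so that it is constant for two solutions with the same complex z;
  \<open>sl_bracket\<close> is recovered by conjugating the second argument.\<close>

definition wronskian :: "(real \<Rightarrow> complex) \<Rightarrow> (real \<Rightarrow> complex) \<Rightarrow> real \<Rightarrow> complex" where
  "wronskian f g x = f x * pderiv_rep S g x - pderiv_rep S f x * g x"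

section \<open>Lagrange's identity and constancy of the Wronskian\<close>

lemma sl_bracket_wronskian:
  assumes "sl_regular S g" "x \<in> sl_int S"
  shows "sl_bracket S f g x = wronskian f (\<lambda>x. cnj (g x)) x"
  using regular_cnj(2)[OF assms] by (simp add: sl_bracket_def wronskian_def)

lemma wronskian_AC:
  assumes "sl_regular S f" "sl_regular S g"
  shows "AC_loc (lend S) (rend S) (wronskian f g)"
  unfolding wronskian_def[abs_def]
  using assms by (intro AC_loc_diff AC_loc_mult regular_AC)

text \<open>In the product rule the two terms (p f')(p g') / p cancel, and so do the terms with
  q.\<close>

lemma wronskian_deriv:
  assumes f: "sl_regular S f" and g: "sl_regular S g"
  shows "AE x in lebesgue_on (sl_int S). (wronskian f g has_vector_derivative
    of_real (cw S x) * (ell S f x * g x - f x * ell S g x)) (at x)"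
  using regular_deriv[OF f] regular_deriv[OF g] regular_deriv2[OF f] regular_deriv2[OF g]
proof eventually_elim
  case (elim x)
  have "(wronskian f g has_vector_derivative
    (f x * (- of_real (cw S x) * ell S g x - of_real (cq S x) * g x) + pderiv_rep S f x / of_real (cp S x) * pderiv_rep S g x)
    - (pderiv_rep S f x * (pderiv_rep S g x / of_real (cp S x)) + (- of_real (cw S x) * ell S f x - of_real (cq S x) * f x) * g x)) (at x)"
    unfolding wronskian_def[abs_def]
    by (intro has_vector_derivative_diff has_vector_derivative_mult elim)
  then show ?case by (simp add: algebra_simps)
qed

lemma wronskian_has_integral:
  assumes "sl_regular S f" "sl_regular S g" "c \<in> sl_int S" "d \<in> sl_int S" "c \<le> d"
  shows "((\<lambda>x. of_real (cw S x) * (ell S f x * g x - f x * ell S g x)) has_integral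
     (wronskian f g d - wronskian f g c)) {c..d}"
  by (rule AC_loc_has_integral(2)[OF wronskian_AC wronskian_deriv]) (use assms in auto)

lemma solution_regular: "sl_solution S z f \<Longrightarrow> sl_regular S f"
  by (simp add: sl_solution_def)

lemma solution_ell: "sl_solution S z f \<Longrightarrow> AE x in lebesgue_on (sl_int S). ell S f x = z * f x"
  by (simp add: sl_solution_def)

text \<open>The two terms of Lagrange's identity cancel because z is the same. The derivative
  vanishes only almost everywhere, and absolute continuity is what turns this into
  constancy.\<close>

lemma wronskian_const:
  assumes f: "sl_solution S z f" and g: "sl_solution S z g" and cd: "c \<in> sl_int S" "d \<in> sl_int S"
  shows "wronskian f g c = wronskian f g d"
proof -
  have "wronskian f g c = wronskian f g d" if cd: "c \<in> sl_int S" "d \<in> sl_int S" "c \<le> d" for c d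
  proof -
    note fg = solution_regular[OF f] solution_regular[OF g]
    have "AE x in lebesgue_on (sl_int S). (wronskian f g has_vector_derivative 0) (at x)"
      using wronskian_deriv[OF fg] solution_ell[OF f] solution_ell[OF g]
      by eventually_elim (simp add: algebra_simps)
    from AC_loc_has_integral(2)[OF wronskian_AC[OF fg] this cd]
    have "wronskian f g d - wronskian f g c = 0" by (rule has_integral_unique[OF _ has_integral_0])
    then show ?thesis by simp
  qed
  then show ?thesis using cd by (metis linear)
qed

section \<open>Boundary values\<close>

lemma regular_linear:
  assumes f: "sl_regular S f" and g: "sl_regular S g"
  shows "sl_regular S (\<lambda>x. c * f x + d * g x)"
    "\<And>x. x \<in> sl_int S \<Longrightarrow> pderiv_rep S (\<lambda>x. c * f x + d * g x) x = c * pderiv_rep S f x + d * pderiv_rep S g x"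
    "AE x in lebesgue_on (sl_int S). ell S (\<lambda>x. c * f x + d * g x) x = c * ell S f x + d * ell S g x"
proof -
  have d: "((\<lambda>x. c * k x + d * l x) has_vector_derivative c * k' + d * l') (at x)"
    if "(k has_vector_derivative k') (at x)" "(l has_vector_derivative l') (at x)" for k l k' l' and x :: real
    using that by (intro has_vector_derivative_add has_vector_derivative_mult_right)
  have "AE x in lebesgue_on (sl_int S). ((\<lambda>x. c * f x + d * g x) has_vector_derivative
     (c * pderiv_rep S f x + d * pderiv_rep S g x) / of_real (cp S x)) (at x)"
    using regular_deriv[OF f] regular_deriv[OF g]
  proof eventually_elim
    case (elim x)
    from d[OF elim] show ?case by (simp add: add_divide_distrib)
  qed
  from sl_regularI[OF _ _ this]
  show *: "sl_regular S (\<lambda>x. c * f x + d * g x)"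
    "\<And>x. x \<in> sl_int S \<Longrightarrow> pderiv_rep S (\<lambda>x. c * f x + d * g x) x = c * pderiv_rep S f x + d * pderiv_rep S g x"
    using f g by (simp_all add: AC_loc_add AC_loc_mult AC_loc_const regular_AC)
  show "AE x in lebesgue_on (sl_int S). ell S (\<lambda>x. c * f x + d * g x) x = c * ell S f x + d * ell S g x"
  proof (rule ell_AE[OF *])
    show "AE x in lebesgue_on (sl_int S). ((\<lambda>x. c * pderiv_rep S f x + d * pderiv_rep S g x) has_vector_derivative
       - of_real (cw S x) * (c * ell S f x + d * ell S g x) - of_real (cq S x) * (c * f x + d * g x)) (at x)"
      using regular_deriv2[OF f] regular_deriv2[OF g]
    proof eventually_elim
      case (elim x)
      from d[OF elim] show ?case by (simp add: algebra_simps)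
    qed
  qed
qed

section \<open>The weighted space and the maximal domain\<close>

lemma L2w_measurable [measurable_dest]: "f \<in> L2w S \<Longrightarrow> f \<in> borel_measurable (lebesgue_on (sl_int S))"
  and L2w_integrable: "f \<in> L2w S \<Longrightarrow> integrable (lebesgue_on (sl_int S)) (\<lambda>x. (norm (f x))\<^sup>2 * cw S x)"
  by (auto simp: L2w_def)

lemma L2wI:
  assumes f [measurable]: "f \<in> borel_measurable (lebesgue_on (sl_int S))"
    and k: "integrable (lebesgue_on (sl_int S)) k"
    and le: "AE x in lebesgue_on (sl_int S). (norm (f x))\<^sup>2 * cw S x \<le> k x"
  shows "f \<in> L2w S"
proof -
  note [measurable] = cw_measurable
  have "integrable (lebesgue_on (sl_int S)) (\<lambda>x. (norm (f x))\<^sup>2 * cw S x)"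
  proof (rule Bochner_Integration.integrable_bound[OF k])
    show "AE x in lebesgue_on (sl_int S). norm ((norm (f x))\<^sup>2 * cw S x) \<le> norm (k x)"
      using le cw_pos by eventually_elim (auto simp: abs_mult)
  qed measurable
  then show ?thesis using f by (simp add: L2w_def)
qed

lemma L2w_AE:
  assumes "f \<in> L2w S" "AE x in lebesgue_on (sl_int S). f x = g x"
  shows "g \<in> L2w S"
proof (rule L2wI[OF _ L2w_integrable[OF assms(1)]])
  show "g \<in> borel_measurable (lebesgue_on (sl_int S))"
    by (rule lebesgue_on_borel_measurable_AE[OF _ L2w_measurable[OF assms(1)] assms(2)]) simp
  show "AE x in lebesgue_on (sl_int S). (norm (g x))\<^sup>2 * cw S x \<le> (norm (f x))\<^sup>2 * cw S x"
    using assms(2) by eventually_elim simp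
qed

lemma L2w_mult_integrable:
  assumes "f \<in> L2w S" "g \<in> L2w S"
  shows "integrable (lebesgue_on (sl_int S)) (\<lambda>x. f x * g x * of_real (cw S x))"
proof (rule Bochner_Integration.integrable_bound)
  note [measurable] = cw_measurable L2w_measurable[OF assms(1)] L2w_measurable[OF assms(2)]
  show "integrable (lebesgue_on (sl_int S)) (\<lambda>x. (norm (f x))\<^sup>2 * cw S x + (norm (g x))\<^sup>2 * cw S x)"
    using assms by (intro Bochner_Integration.integrable_add L2w_integrable)
  show "(\<lambda>x. f x * g x * of_real (cw S x)) \<in> borel_measurable (lebesgue_on (sl_int S))"
    by measurable
  show "AE x in lebesgue_on (sl_int S). norm (f x * g x * of_real (cw S x))
     \<le> norm ((norm (f x))\<^sup>2 * cw S x + (norm (g x))\<^sup>2 * cw S x)"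
    using cw_pos
  proof eventually_elim
    case (elim x)
    have "0 \<le> (norm (f x) - norm (g x))\<^sup>2 + ((norm (f x))\<^sup>2 + (norm (g x))\<^sup>2)" by simp
    then have "norm (f x) * norm (g x) \<le> (norm (f x))\<^sup>2 + (norm (g x))\<^sup>2"
      by (simp add: power2_diff)
    then have "norm (f x) * norm (g x) * cw S x \<le> ((norm (f x))\<^sup>2 + (norm (g x))\<^sup>2) * cw S x"
      using elim by (intro mult_right_mono) auto
    then show ?case using elim by (simp add: norm_mult distrib_right)
  qed
qed

lemma L2w_linear:
  assumes "f \<in> L2w S" "g \<in> L2w S"
  shows "(\<lambda>x. c * f x + d * g x) \<in> L2w S"
proof (rule L2wI)
  note [measurable] = L2w_measurable[OF assms(1)] L2w_measurable[OF assms(2)]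
  show "(\<lambda>x. c * f x + d * g x) \<in> borel_measurable (lebesgue_on (sl_int S))" by measurable
  show "integrable (lebesgue_on (sl_int S)) (\<lambda>x. 2 * (norm c)\<^sup>2 * ((norm (f x))\<^sup>2 * cw S x) + 2 * (norm d)\<^sup>2 * ((norm (g x))\<^sup>2 * cw S x))"
    using assms by (intro Bochner_Integration.integrable_add integrable_mult_right L2w_integrable)
  show "AE x in lebesgue_on (sl_int S). (norm (c * f x + d * g x))\<^sup>2 * cw S x
      \<le> 2 * (norm c)\<^sup>2 * ((norm (f x))\<^sup>2 * cw S x) + 2 * (norm d)\<^sup>2 * ((norm (g x))\<^sup>2 * cw S x)"
    using cw_pos
  proof eventually_elim
    case (elim x)
    have "(norm (c * f x + d * g x))\<^sup>2 \<le> (norm (c * f x) + norm (d * g x))\<^sup>2"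
      by (intro power_mono norm_triangle_ineq) simp
    also have "\<dots> \<le> 2 * (norm (c * f x))\<^sup>2 + 2 * (norm (d * g x))\<^sup>2"
      using zero_le_power2[of "norm (c * f x) - norm (d * g x)"] by (simp add: power2_sum power2_diff)
    also have "\<dots> = 2 * (norm c)\<^sup>2 * (norm (f x))\<^sup>2 + 2 * (norm d)\<^sup>2 * (norm (g x))\<^sup>2"
      by (simp add: norm_mult power_mult_distrib)
    finally have "(norm (c * f x + d * g x))\<^sup>2 * cw S x \<le>
      (2 * (norm c)\<^sup>2 * (norm (f x))\<^sup>2 + 2 * (norm d)\<^sup>2 * (norm (g x))\<^sup>2) * cw S x"
      using elim by (intro mult_right_mono) auto
    then show ?case by (simp add: algebra_simps)
  qed
qed

lemma L2w_cnj: "f \<in> L2w S \<Longrightarrow> (\<lambda>x. cnj (f x)) \<in> L2w S"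
  by (rule L2wI[OF _ L2w_integrable[of f]])
    (auto intro!: borel_measurable_continuous_onI continuous_intros
      measurable_compose[OF L2w_measurable, where g=cnj])

text \<open>\<open>Dmax\<close> without vanishing off the interval, so that solutions and frame
  functions qualify without being cut off.\<close>

definition dmax :: "(real \<Rightarrow> complex) \<Rightarrow> bool" where
  "dmax f \<longleftrightarrow> sl_regular S f \<and> f \<in> L2w S \<and> ell S f \<in> L2w S"

lemma dmax_D: assumes "dmax f" shows "sl_regular S f" "f \<in> L2w S" "ell S f \<in> L2w S"
  using assms by (auto simp: dmax_def)

lemma Dmax_dmax: "f \<in> Dmax S \<longleftrightarrow> dmax f \<and> (\<forall>x. x \<notin> sl_int S \<longrightarrow> f x = 0)"
  by (auto simp: Dmax_def dmax_def)

lemma AE_sl_int: "AE x in lebesgue_on (sl_int S). x \<in> sl_int S"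
  unfolding AE_lebesgue_on_iff[OF sl_int_sets] by (intro exI[of _ "{}"]) auto

lemma dmax_cong:
  assumes f: "dmax f" and eq: "\<And>x. x \<in> sl_int S \<Longrightarrow> f x = g x"
  shows "dmax g"
  unfolding dmax_def
proof (intro conjI)
  show "sl_regular S g" by (rule regular_cong(1)[OF dmax_D(1)[OF f]]) (rule eq)
  have r: "AE x in lebesgue_on (sl_int S). ell S g x = ell S f x"
    by (rule regular_cong(3)[OF dmax_D(1)[OF f]]) (rule eq)
  have "AE x in lebesgue_on (sl_int S). f x = g x" using AE_sl_int by eventually_elim (rule eq)
  then show "g \<in> L2w S" by (rule L2w_AE[OF dmax_D(2)[OF f]])
  have "AE x in lebesgue_on (sl_int S). ell S f x = ell S g x" using r by eventually_elim simp
  then show "ell S g \<in> L2w S" by (rule L2w_AE[OF dmax_D(3)[OF f]])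
qed

lemma dmax_linear:
  assumes "dmax f" "dmax g"
  shows "dmax (\<lambda>x. c * f x + d * g x)"
  unfolding dmax_def
proof (intro conjI)
  note r = regular_linear[OF dmax_D(1)[OF assms(1)] dmax_D(1)[OF assms(2)], where c=c and d=d]
  show "sl_regular S (\<lambda>x. c * f x + d * g x)" by (rule r(1))
  show "(\<lambda>x. c * f x + d * g x) \<in> L2w S" using assms by (intro L2w_linear dmax_D)
  have "AE x in lebesgue_on (sl_int S). c * ell S f x + d * ell S g x = ell S (\<lambda>x. c * f x + d * g x) x"
    using r(3) by eventually_elim simp
  then show "ell S (\<lambda>x. c * f x + d * g x) \<in> L2w S"
    by (rule L2w_AE[OF L2w_linear[OF dmax_D(3)[OF assms(1)] dmax_D(3)[OF assms(2)]]])
qed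

lemma dmax_cnj:
  assumes "dmax f"
  shows "dmax (\<lambda>x. cnj (f x))"
  unfolding dmax_def
proof (intro conjI)
  note r = regular_cnj[OF dmax_D(1)[OF assms]]
  show "sl_regular S (\<lambda>x. cnj (f x))" by (rule r(1))
  show "(\<lambda>x. cnj (f x)) \<in> L2w S" using assms by (intro L2w_cnj dmax_D)
  have "AE x in lebesgue_on (sl_int S). cnj (ell S f x) = ell S (\<lambda>x. cnj (f x)) x"
    using r(3) by eventually_elim simp
  then show "ell S (\<lambda>x. cnj (f x)) \<in> L2w S"
    by (rule L2w_AE[OF L2w_cnj[OF dmax_D(3)[OF assms]]])
qed

section \<open>Endpoint filters and integrals from the left endpoint\<close>

lemma near_lend:
  assumes "t \<in> sl_int S"
  shows "\<forall>\<^sub>F x in at_right (lend S). real_of_ereal x \<in> sl_int S \<and> real_of_ereal x < t"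
proof -
  have lt: "lend S < ereal t" "ereal t < rend S" using assms by (auto simp: mem_sl_int)
  show ?thesis
    unfolding eventually_at_right[OF lt(1)]
  proof (rule exI[of _ "ereal t"], rule conjI[OF lt(1)], intro allI impI)
    fix y assume y: "lend S < y" "y < ereal t"
    then obtain r where "y = ereal r" by (cases y) auto
    moreover have "y < rend S" using y(2) lt(2) by (rule less_trans)
    ultimately show "real_of_ereal y \<in> sl_int S \<and> real_of_ereal y < t" using y by (auto simp: mem_sl_int)
  qed
qed

lemma near_rend:
  assumes "t \<in> sl_int S"
  shows "\<forall>\<^sub>F x in at_left (rend S). real_of_ereal x \<in> sl_int S \<and> t < real_of_ereal x"
proof -
  have lt: "lend S < ereal t" "ereal t < rend S" using assms by (auto simp: mem_sl_int)
  show ?thesis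
    unfolding eventually_at_left[OF lt(2)]
  proof (rule exI[of _ "ereal t"], rule conjI[OF lt(2)], intro allI impI)
    fix y assume y: "ereal t < y" "y < rend S"
    then obtain r where "y = ereal r" by (cases y) auto
    moreover have "lend S < y" using lt(1) y(1) by (rule less_trans)
    ultimately show "real_of_ereal y \<in> sl_int S \<and> t < real_of_ereal y" using y by (auto simp: mem_sl_int)
  qed
qed

lemma near_lend_int: "\<forall>\<^sub>F x in at_right (lend S). real_of_ereal x \<in> sl_int S"
proof -
  obtain t where "t \<in> sl_int S" using sl_int_ex by blast
  from near_lend[OF this] show ?thesis by eventually_elim simp
qed

lemma near_rend_int: "\<forall>\<^sub>F x in at_left (rend S). real_of_ereal x \<in> sl_int S"
proof -
  obtain t where "t \<in> sl_int S" using sl_int_ex by blast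
  from near_rend[OF this] show ?thesis by eventually_elim simp
qed

lemma at_lend_nontrivial [simp]: "at_right (lend S) \<noteq> bot"
  unfolding trivial_limit_def eventually_at_right[OF ends] using dense by blast

lemma at_rend_nontrivial [simp]: "at_left (rend S) \<noteq> bot"
  unfolding trivial_limit_def eventually_at_left[OF ends] using dense by blast

text \<open>A cut-off integral over the whole interval: it makes sense for an infinite left
  endpoint, and dominated convergence gives its limits at both ends.\<close>

definition cumul :: "(real \<Rightarrow> complex) \<Rightarrow> real \<Rightarrow> complex" where
  "cumul \<phi> x = (LINT t|lebesgue_on (sl_int S). indicator {..x} t *\<^sub>R \<phi> t)"

lemma integrable_cut:
  fixes \<phi> :: "real \<Rightarrow> complex"
  assumes \<phi>: "integrable (lebesgue_on (sl_int S)) \<phi>"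
  shows "integrable (lebesgue_on (sl_int S)) (\<lambda>t. indicator {..x} t *\<^sub>R \<phi> t)"
proof -
  have "sl_int S \<inter> {..x} \<in> sets (lebesgue_on (sl_int S))" by (simp add: sets_restrict_space)
  from integrable_mult_indicator[OF this \<phi>] show ?thesis
    by (subst Bochner_Integration.integrable_cong[OF refl, where g="\<lambda>t. indicator (sl_int S \<inter> {..x}) t *\<^sub>R \<phi> t"])
      (auto simp: indicator_def)
qed

lemma cumul_lend:
  assumes \<phi>: "integrable (lebesgue_on (sl_int S)) \<phi>"
  shows "((\<lambda>x. cumul \<phi> (real_of_ereal x)) \<longlongrightarrow> 0) (at_right (lend S))"
proof (rule tendsto_at_right_sequentially[OF ends])
  fix X :: "nat \<Rightarrow> ereal" assume X: "\<And>n. lend S < X n" "X \<longlonglongrightarrow> lend S"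
  \<comment> \<open>Dominated convergence concerns sequences, so statements holding near the
    endpoint are transferred to X.\<close>
  have "filterlim X (at_right (lend S)) sequentially"
    using X not_sym[OF less_imp_neq[OF X(1)]] by (auto simp: filterlim_at)
  then have ev: "\<forall>\<^sub>F n in sequentially. P (X n)" if "eventually P (at_right (lend S))" for P
    using that by (auto simp: filterlim_iff)
  have "(\<lambda>n. cumul \<phi> (real_of_ereal (X n))) \<longlonglongrightarrow> (LINT t|lebesgue_on (sl_int S). 0)"
    unfolding cumul_def
  proof (rule integral_dominated_convergence)
    show "integrable (lebesgue_on (sl_int S)) (\<lambda>t. norm (\<phi> t))" using \<phi> by simp
    show "(\<lambda>t. indicator {..real_of_ereal (X n)} t *\<^sub>R \<phi> t) \<in> borel_measurable (lebesgue_on (sl_int S))" for n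
      by (intro borel_measurable_integrable integrable_cut \<phi>)
    show "AE t in lebesgue_on (sl_int S). (\<lambda>n. indicator {..real_of_ereal (X n)} t *\<^sub>R \<phi> t) \<longlonglongrightarrow> 0"
      using AE_sl_int
    proof eventually_elim
      case (elim t)
      show ?case
        by (rule tendsto_eventually, use ev[OF near_lend[OF elim]] in eventually_elim) (auto simp: indicator_def)
    qed
    show "AE t in lebesgue_on (sl_int S). norm (indicator {..real_of_ereal (X n)} t *\<^sub>R \<phi> t) \<le> norm (\<phi> t)" for n
      by (auto simp: indicator_def)
  qed simp
  then show "(\<lambda>n. cumul \<phi> (real_of_ereal (X n))) \<longlonglongrightarrow> 0" by simp
qed

lemma cumul_rend:
  assumes \<phi>: "integrable (lebesgue_on (sl_int S)) \<phi>"
  shows "((\<lambda>x. cumul \<phi> (real_of_ereal x)) \<longlongrightarrow> (LINT t|lebesgue_on (sl_int S). \<phi> t)) (at_left (rend S))"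
proof (rule tendsto_at_left_sequentially[OF ends])
  fix X :: "nat \<Rightarrow> ereal" assume X: "\<And>n. X n < rend S" "X \<longlonglongrightarrow> rend S"
  have "filterlim X (at_left (rend S)) sequentially"
    using X less_imp_neq[OF X(1)] by (auto simp: filterlim_at)
  then have ev: "\<forall>\<^sub>F n in sequentially. P (X n)" if "eventually P (at_left (rend S))" for P
    using that by (auto simp: filterlim_iff)
  show "(\<lambda>n. cumul \<phi> (real_of_ereal (X n))) \<longlonglongrightarrow> (LINT t|lebesgue_on (sl_int S). \<phi> t)"
    unfolding cumul_def
  proof (rule integral_dominated_convergence)
    show "integrable (lebesgue_on (sl_int S)) (\<lambda>t. norm (\<phi> t))" using \<phi> by simp
    show "\<phi> \<in> borel_measurable (lebesgue_on (sl_int S))" using \<phi> by simp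
    show "(\<lambda>t. indicator {..real_of_ereal (X n)} t *\<^sub>R \<phi> t) \<in> borel_measurable (lebesgue_on (sl_int S))" for n
      by (intro borel_measurable_integrable integrable_cut \<phi>)
    show "AE t in lebesgue_on (sl_int S). (\<lambda>n. indicator {..real_of_ereal (X n)} t *\<^sub>R \<phi> t) \<longlonglongrightarrow> \<phi> t"
      using AE_sl_int
    proof eventually_elim
      case (elim t)
      show ?case
        by (rule tendsto_eventually, use ev[OF near_rend[OF elim]] in eventually_elim) (auto simp: indicator_def)
    qed
    show "AE t in lebesgue_on (sl_int S). norm (indicator {..real_of_ereal (X n)} t *\<^sub>R \<phi> t) \<le> norm (\<phi> t)" for n
      by (auto simp: indicator_def)
  qed
qed

lemma cumul_diff:
  assumes \<phi>: "integrable (lebesgue_on (sl_int S)) \<phi>" and cd: "c \<in> sl_int S" "d \<in> sl_int S" "c \<le> d"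
  shows "\<phi> absolutely_integrable_on {c..d}" "(\<phi> has_integral (cumul \<phi> d - cumul \<phi> c)) {c..d}"
proof -
  have int: "integrable lebesgue (\<lambda>t. indicator (sl_int S) t *\<^sub>R \<phi> t)"
    using \<phi> by (simp add: integrable_restrict_space)
  then have *: "integrable lebesgue (\<lambda>t. indicator (sl_int S \<inter> {..x}) t *\<^sub>R \<phi> t)" for x
    using integrable_mult_indicator[of "{..x}" lebesgue "\<lambda>t. indicator (sl_int S) t *\<^sub>R \<phi> t"]
    by (simp add: indicator_inter_arith mult.commute)
  have **: "cumul \<phi> x = (LINT t|lebesgue. indicator (sl_int S \<inter> {..x}) t *\<^sub>R \<phi> t)" for x
    unfolding cumul_def by (subst integral_restrict_space) (auto simp: indicator_inter_arith)
  have "{c<..d} \<subseteq> sl_int S" using Icc_subset_sl_int[OF cd(1,2)] by fastforce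
  then have eq: "indicator (sl_int S \<inter> {..d}) t *\<^sub>R \<phi> t - indicator (sl_int S \<inter> {..c}) t *\<^sub>R \<phi> t
     = indicator {c<..d} t *\<^sub>R \<phi> t" for t
    using cd(3) by (auto simp: indicator_def)
  \<comment> \<open>Half-open because it arises as the difference of {..d} and {..c}; the single
    point c is restored at the end.\<close>
  have "set_integrable lebesgue {c<..d} \<phi>"
    unfolding set_integrable_def using Bochner_Integration.integrable_diff[OF *[of d] *[of c]] by (simp add: eq)
  moreover have "(LINT t:{c<..d}|lebesgue. \<phi> t) = cumul \<phi> d - cumul \<phi> c"
    unfolding ** set_lebesgue_integral_def by (subst Bochner_Integration.integral_diff[OF * *, symmetric]) (simp add: eq)
  ultimately have hi: "(\<phi> has_integral (cumul \<phi> d - cumul \<phi> c)) {c<..d}"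
    using has_integral_set_lebesgue[of "{c<..d}" \<phi>] by simp
  show "\<phi> absolutely_integrable_on {c..d}"
  proof (rule set_integrable_subset)
    show "set_integrable lebesgue (sl_int S) \<phi>" using int by (simp add: set_integrable_def)
  qed (use Icc_subset_sl_int[OF cd(1,2)] in auto)
  show "(\<phi> has_integral (cumul \<phi> d - cumul \<phi> c)) {c..d}"
    by (rule has_integral_spike_set_eq[THEN iffD1, OF _ _ hi]) (auto intro: negligible_subset[of "{c}"])
qed

lemma cumul_AC:
  assumes \<phi>: "integrable (lebesgue_on (sl_int S)) \<phi>"
  shows "AC_loc (lend S) (rend S) (cumul \<phi>)"
proof (rule AC_locI)
  fix c d assume cd: "c \<in> sl_int S" "d \<in> sl_int S" "c \<le> d"
  show "abs_cont_on c d (cumul \<phi>)"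
  proof (rule absolutely_integrable_imp_abs_cont_on[OF cumul_diff(1)[OF \<phi> cd]])
    fix x y assume "c \<le> x" "x \<le> y" "y \<le> d"
    then show "(\<phi> has_integral (cumul \<phi> y - cumul \<phi> x)) {x..y}"
      using Icc_subset_sl_int[OF cd(1,2)] by (intro cumul_diff \<phi>) auto
  qed
qed

lemma cumul_deriv:
  assumes \<phi>: "integrable (lebesgue_on (sl_int S)) \<phi>"
  shows "AE x in lebesgue_on (sl_int S). (cumul \<phi> has_vector_derivative \<phi> x) (at x)"
proof (rule AE_sl_intI)
  fix c d assume cd: "c \<in> sl_int S" "d \<in> sl_int S" "c < d"
  have "(\<phi> has_integral (cumul \<phi> x - cumul \<phi> c)) {c..x}" if "x \<in> {c..d}" for x
    using that cd Icc_subset_sl_int[OF cd(1,2)] by (intro cumul_diff \<phi>) auto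
  then obtain N where "negligible N" "\<And>x. x \<in> {c<..<d} - N \<Longrightarrow> (cumul \<phi> has_vector_derivative \<phi> x) (at x)"
    using has_integral_imp_vector_derivative[of c d \<phi> "cumul \<phi>"] by metis
  then show "\<exists>N. negligible N \<and> (\<forall>x\<in>{c<..<d} - N. (cumul \<phi> has_vector_derivative \<phi> x) (at x))" by blast
qed

text \<open>The bound does not depend on x: products with \<open>cumul\<close> remain in
  \<open>L2w\<close>, which the resolvent formula requires.\<close>

lemma cumul_bounded:
  assumes \<phi>: "integrable (lebesgue_on (sl_int S)) \<phi>"
  shows "norm (cumul \<phi> x) \<le> (LINT t|lebesgue_on (sl_int S). norm (\<phi> t))"
proof -
  have int: "integrable (lebesgue_on (sl_int S)) (\<lambda>t. indicator {..x} t *\<^sub>R \<phi> t)"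
    by (rule integrable_cut[OF \<phi>])
  have "norm (cumul \<phi> x) \<le> (LINT t|lebesgue_on (sl_int S). norm (indicator {..x} t *\<^sub>R \<phi> t))"
    unfolding cumul_def by (rule integral_norm_bound)
  also have "\<dots> \<le> (LINT t|lebesgue_on (sl_int S). norm (\<phi> t))"
    using \<phi> by (intro integral_mono integrable_norm[OF int] integrable_norm) (auto simp: indicator_def)
  finally show ?thesis .
qed

section \<open>Limits of Wronskians at the endpoints and Green's formula\<close>

lemma wronskian_integrable:
  assumes "dmax f" "dmax g"
  shows "integrable (lebesgue_on (sl_int S)) (\<lambda>x. of_real (cw S x) * (ell S f x * g x - f x * ell S g x))"
proof -
  have "integrable (lebesgue_on (sl_int S)) (\<lambda>x. ell S f x * g x * of_real (cw S x) - f x * ell S g x * of_real (cw S x))"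
    using assms by (intro Bochner_Integration.integrable_diff L2w_mult_integrable dmax_D)
  then show ?thesis by (simp add: algebra_simps)
qed

text \<open>The Wronskian differs from \<open>cumul\<close> of its derivative by a constant A, hence
  inherits limits at both ends. Stating them together, with the same A, already contains Green's
  formula.\<close>

lemma wronskian_limits:
  assumes "dmax f" "dmax g"
  shows "\<exists>A. ((\<lambda>x. wronskian f g (real_of_ereal x)) \<longlongrightarrow> A) (at_right (lend S)) \<and>
    ((\<lambda>x. wronskian f g (real_of_ereal x)) \<longlongrightarrow>
      A + (LINT x|lebesgue_on (sl_int S). of_real (cw S x) * (ell S f x * g x - f x * ell S g x))) (at_left (rend S))"
proof -
  define \<phi> where "\<phi> x = of_real (cw S x) * (ell S f x * g x - f x * ell S g x)" for x
  have \<phi>: "integrable (lebesgue_on (sl_int S)) \<phi>"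
    unfolding \<phi>_def[abs_def] by (rule wronskian_integrable[OF assms])
  obtain t where t: "t \<in> sl_int S" using sl_int_ex by blast
  define A where "A = wronskian f g t - cumul \<phi> t"
  have const: "wronskian f g d - wronskian f g c = cumul \<phi> d - cumul \<phi> c"
    if "c \<in> sl_int S" "d \<in> sl_int S" "c \<le> d" for c d
    using wronskian_has_integral[OF dmax_D(1)[OF assms(1)] dmax_D(1)[OF assms(2)] that] cumul_diff(2)[OF \<phi> that]
    unfolding \<phi>_def[symmetric] by (rule has_integral_unique)
  have eq: "wronskian f g x = A + cumul \<phi> x" if "x \<in> sl_int S" for x
    using const[OF t that] const[OF that t] unfolding A_def by (cases "t \<le> x") (auto simp: algebra_simps)
  have lend: "((\<lambda>x. A + cumul \<phi> (real_of_ereal x)) \<longlongrightarrow> A + 0) (at_right (lend S))"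
    by (intro tendsto_intros cumul_lend \<phi>)
  have rend: "((\<lambda>x. A + cumul \<phi> (real_of_ereal x)) \<longlongrightarrow> A + (LINT t|lebesgue_on (sl_int S). \<phi> t)) (at_left (rend S))"
    by (intro tendsto_intros cumul_rend \<phi>)
  show ?thesis
    unfolding \<phi>_def[symmetric]
  proof (intro exI conjI)
    show "((\<lambda>x. wronskian f g (real_of_ereal x)) \<longlongrightarrow> A + 0) (at_right (lend S))"
      by (rule Lim_transform_eventually[OF lend], use near_lend_int in eventually_elim) (simp add: eq)
    show "((\<lambda>x. wronskian f g (real_of_ereal x)) \<longlongrightarrow> A + 0 + (LINT t|lebesgue_on (sl_int S). \<phi> t)) (at_left (rend S))"
      unfolding add_0_right
      by (rule Lim_transform_eventually[OF rend], use near_rend_int in eventually_elim) (simp add: eq)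
  qed
qed

definition wronskian_lend :: "(real \<Rightarrow> complex) \<Rightarrow> (real \<Rightarrow> complex) \<Rightarrow> complex" where
  "wronskian_lend f g = Lim (at_right (lend S)) (\<lambda>x. wronskian f g (real_of_ereal x))"

definition wronskian_rend :: "(real \<Rightarrow> complex) \<Rightarrow> (real \<Rightarrow> complex) \<Rightarrow> complex" where
  "wronskian_rend f g = Lim (at_left (rend S)) (\<lambda>x. wronskian f g (real_of_ereal x))"

lemma wronskian_lend:
  assumes "dmax f" "dmax g"
  shows "((\<lambda>x. wronskian f g (real_of_ereal x)) \<longlongrightarrow> wronskian_lend f g) (at_right (lend S))"
proof -
  from wronskian_limits[OF assms] obtain A
    where A: "((\<lambda>x. wronskian f g (real_of_ereal x)) \<longlongrightarrow> A) (at_right (lend S))" by (elim exE conjE)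
  from tendsto_Lim[OF at_lend_nontrivial this] A show ?thesis by (simp only: wronskian_lend_def)
qed

lemma wronskian_rend:
  assumes "dmax f" "dmax g"
  shows "((\<lambda>x. wronskian f g (real_of_ereal x)) \<longlongrightarrow> wronskian_rend f g) (at_left (rend S))"
proof -
  from wronskian_limits[OF assms] obtain A
    where A: "((\<lambda>x. wronskian f g (real_of_ereal x)) \<longlongrightarrow> A) (at_left (rend S))" by (elim exE conjE)
  from tendsto_Lim[OF at_rend_nontrivial this] A show ?thesis by (simp only: wronskian_rend_def)
qed

lemma wronskian_lend_eqI:
  "((\<lambda>x. wronskian f g (real_of_ereal x)) \<longlongrightarrow> L) (at_right (lend S)) \<Longrightarrow> wronskian_lend f g = L"
  unfolding wronskian_lend_def by (rule tendsto_Lim) simp_all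

lemma wronskian_rend_eqI:
  "((\<lambda>x. wronskian f g (real_of_ereal x)) \<longlongrightarrow> L) (at_left (rend S)) \<Longrightarrow> wronskian_rend f g = L"
  unfolding wronskian_rend_def by (rule tendsto_Lim) simp_all

lemma green_formula:
  assumes "dmax f" "dmax g"
  shows "wronskian_rend f g - wronskian_lend f g =
    (LINT x|lebesgue_on (sl_int S). of_real (cw S x) * (ell S f x * g x - f x * ell S g x))"
proof -
  from wronskian_limits[OF assms] obtain A where
    A: "((\<lambda>x. wronskian f g (real_of_ereal x)) \<longlongrightarrow> A) (at_right (lend S))"
      "((\<lambda>x. wronskian f g (real_of_ereal x)) \<longlongrightarrow>
        A + (LINT x|lebesgue_on (sl_int S). of_real (cw S x) * (ell S f x * g x - f x * ell S g x))) (at_left (rend S))"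
    by (elim exE conjE)
  show ?thesis unfolding wronskian_lend_eqI[OF A(1)] wronskian_rend_eqI[OF A(2)] by simp
qed

lemma bracket_a_wronskian:
  assumes "dmax f" "dmax g"
  shows "bracket_a S f g = wronskian_lend f (\<lambda>x. cnj (g x))"
  unfolding bracket_a_def
proof (rule tendsto_Lim)
  have "\<forall>\<^sub>F x in at_right (lend S). wronskian f (\<lambda>x. cnj (g x)) (real_of_ereal x) = (sl_bracket S f g \<circ> real_of_ereal) x"
    using near_lend_int by eventually_elim (simp add: sl_bracket_wronskian dmax_D(1)[OF assms(2)])
  with wronskian_lend[OF assms(1) dmax_cnj[OF assms(2)]]
  show "((sl_bracket S f g \<circ> real_of_ereal) \<longlongrightarrow> wronskian_lend f (\<lambda>x. cnj (g x))) (at_right (lend S))"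
    by (rule Lim_transform_eventually)
qed simp

lemma bracket_b_wronskian:
  assumes "dmax f" "dmax g"
  shows "bracket_b S f g = wronskian_rend f (\<lambda>x. cnj (g x))"
  unfolding bracket_b_def
proof (rule tendsto_Lim)
  have "\<forall>\<^sub>F x in at_left (rend S). wronskian f (\<lambda>x. cnj (g x)) (real_of_ereal x) = (sl_bracket S f g \<circ> real_of_ereal) x"
    using near_rend_int by eventually_elim (simp add: sl_bracket_wronskian dmax_D(1)[OF assms(2)])
  with wronskian_rend[OF assms(1) dmax_cnj[OF assms(2)]]
  show "((sl_bracket S f g \<circ> real_of_ereal) \<longlongrightarrow> wronskian_rend f (\<lambda>x. cnj (g x))) (at_left (rend S))"
    by (rule Lim_transform_eventually)
qed simp

lemma wronskian_cong:
  assumes "sl_regular S f" "sl_regular S g" "\<And>x. x \<in> sl_int S \<Longrightarrow> f x = f' x" "\<And>x. x \<in> sl_int S \<Longrightarrow> g x = g' x"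
    "x \<in> sl_int S"
  shows "wronskian f' g' x = wronskian f g x"
  using regular_cong(2)[OF assms(1,3)] regular_cong(2)[OF assms(2,4)] assms by (simp add: wronskian_def)

lemma wronskian_linear:
  assumes "sl_regular S f" "sl_regular S g" "x \<in> sl_int S"
  shows "wronskian (\<lambda>x. c * f x + d * g x) h x = c * wronskian f h x + d * wronskian g h x"
  using regular_linear(2)[OF assms] by (simp add: wronskian_def algebra_simps)

lemma wronskian_lend_linear:
  assumes "dmax f" "dmax g" "dmax h"
  shows "wronskian_lend (\<lambda>x. c * f x + d * g x) h = c * wronskian_lend f h + d * wronskian_lend g h"
proof (rule wronskian_lend_eqI)
  have "\<forall>\<^sub>F x in at_right (lend S). c * wronskian f h (real_of_ereal x) + d * wronskian g h (real_of_ereal x)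
     = wronskian (\<lambda>x. c * f x + d * g x) h (real_of_ereal x)"
    using near_lend_int by eventually_elim (simp add: wronskian_linear dmax_D(1) assms)
  moreover have "((\<lambda>x. c * wronskian f h (real_of_ereal x) + d * wronskian g h (real_of_ereal x))
     \<longlongrightarrow> c * wronskian_lend f h + d * wronskian_lend g h) (at_right (lend S))"
    by (intro tendsto_intros wronskian_lend assms)
  ultimately show "((\<lambda>x. wronskian (\<lambda>x. c * f x + d * g x) h (real_of_ereal x))
     \<longlongrightarrow> c * wronskian_lend f h + d * wronskian_lend g h) (at_right (lend S))"
    by (rule Lim_transform_eventually[rotated])
qed

lemma wronskian_rend_linear:
  assumes "dmax f" "dmax g" "dmax h"
  shows "wronskian_rend (\<lambda>x. c * f x + d * g x) h = c * wronskian_rend f h + d * wronskian_rend g h"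
proof (rule wronskian_rend_eqI)
  have "\<forall>\<^sub>F x in at_left (rend S). c * wronskian f h (real_of_ereal x) + d * wronskian g h (real_of_ereal x)
     = wronskian (\<lambda>x. c * f x + d * g x) h (real_of_ereal x)"
    using near_rend_int by eventually_elim (simp add: wronskian_linear dmax_D(1) assms)
  moreover have "((\<lambda>x. c * wronskian f h (real_of_ereal x) + d * wronskian g h (real_of_ereal x))
     \<longlongrightarrow> c * wronskian_rend f h + d * wronskian_rend g h) (at_left (rend S))"
    by (intro tendsto_intros wronskian_rend assms)
  ultimately show "((\<lambda>x. wronskian (\<lambda>x. c * f x + d * g x) h (real_of_ereal x))
     \<longlongrightarrow> c * wronskian_rend f h + d * wronskian_rend g h) (at_left (rend S))"
    by (rule Lim_transform_eventually[rotated])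
qed

text \<open>The three-term relation between the 2x2 determinants of four vectors (f, p f') in the
  plane.\<close>

lemma pluecker:
  "wronskian f g x * wronskian u v x = wronskian f u x * wronskian g v x - wronskian f v x * wronskian g u x"
  by (simp add: wronskian_def algebra_simps)

lemma pluecker_lend:
  assumes "dmax f" "dmax g" "dmax u" "dmax v"
  shows "wronskian_lend f g * wronskian_lend u v =
    wronskian_lend f u * wronskian_lend g v - wronskian_lend f v * wronskian_lend g u"
proof (rule tendsto_unique[OF at_lend_nontrivial])
  show "((\<lambda>x. wronskian f g (real_of_ereal x) * wronskian u v (real_of_ereal x))
     \<longlongrightarrow> wronskian_lend f g * wronskian_lend u v) (at_right (lend S))"
    by (intro tendsto_intros wronskian_lend assms)
  show "((\<lambda>x. wronskian f g (real_of_ereal x) * wronskian u v (real_of_ereal x))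
     \<longlongrightarrow> wronskian_lend f u * wronskian_lend g v - wronskian_lend f v * wronskian_lend g u) (at_right (lend S))"
    unfolding pluecker[of f g] by (intro tendsto_intros wronskian_lend assms)
qed

lemma pluecker_rend:
  assumes "dmax f" "dmax g" "dmax u" "dmax v"
  shows "wronskian_rend f g * wronskian_rend u v =
    wronskian_rend f u * wronskian_rend g v - wronskian_rend f v * wronskian_rend g u"
proof (rule tendsto_unique[OF at_rend_nontrivial])
  show "((\<lambda>x. wronskian f g (real_of_ereal x) * wronskian u v (real_of_ereal x))
     \<longlongrightarrow> wronskian_rend f g * wronskian_rend u v) (at_left (rend S))"
    by (intro tendsto_intros wronskian_rend assms)
  show "((\<lambda>x. wronskian f g (real_of_ereal x) * wronskian u v (real_of_ereal x))
     \<longlongrightarrow> wronskian_rend f u * wronskian_rend g v - wronskian_rend f v * wronskian_rend g u) (at_left (rend S))"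
    unfolding pluecker[of f g] by (intro tendsto_intros wronskian_rend assms)
qed

end

section \<open>The resolvent and the Weyl function\<close>

locale sl_problem = sturm_liouville +
  fixes F :: sl_frame and lam0 :: real and u1 u2 :: "complex \<Rightarrow> real \<Rightarrow> complex"
  assumes limit_circle: "limit_circle_a S" "limit_circle_b S"
    and frame: "is_frame S lam0 F"
    and fundamental: "fundamental_system S F u1 u2"
begin

text \<open>The limit-circle condition handles neighbourhoods of the ends; on the compact middle
  part the solution is bounded and the weight is integrable.\<close>

lemma solution_L2w:
  assumes f: "sl_solution S z f"
  shows "f \<in> L2w S"
proof -
  let ?\<phi> = "\<lambda>x. (norm (f x))\<^sup>2 * cw S x"
  obtain c where c: "c \<in> sl_int S" "set_integrable lebesgue (einterval (lend S) c) ?\<phi>"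
    using limit_circle(1) f unfolding limit_circle_a_def by blast
  obtain d where d: "d \<in> sl_int S" "set_integrable lebesgue (einterval d (rend S)) ?\<phi>"
    using limit_circle(2) f unfolding limit_circle_b_def by blast
  have cont: "continuous_on (sl_int S) f"
    by (rule AC_loc_continuous[OF regular_AC(1)[OF solution_regular[OF f]]])
  have f_meas: "f \<in> borel_measurable (lebesgue_on (sl_int S))"
    by (rule continuous_imp_measurable_on_sets_lebesgue[OF cont]) simp
  have sub: "{c..d} \<subseteq> sl_int S" by (rule Icc_subset_sl_int[OF c(1) d(1)])
  have contcd: "continuous_on {c..d} f" using cont sub by (rule continuous_on_subset)
  then have "bounded (f ` {c..d})" by (intro compact_imp_bounded compact_continuous_image) auto
  then obtain B where B: "\<And>x. x \<in> {c..d} \<Longrightarrow> norm (f x) \<le> B" unfolding bounded_iff by blast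
  have w: "cw S absolutely_integrable_on {c..d}"
    using coeffs c(1) d(1) unfolding sl_coeffs_def by (blast intro: L1_loc_D)
  have "set_integrable lebesgue {c..d} ?\<phi>"
  proof -
    have wi: "integrable (lebesgue_on {c..d}) (cw S)"
      using w by (simp add: set_integrable_def integrable_restrict_space)
    have fm: "f \<in> borel_measurable (lebesgue_on {c..d})"
      by (rule continuous_imp_measurable_on_sets_lebesgue[OF contcd]) simp
    have "integrable (lebesgue_on {c..d}) ?\<phi>"
    proof (rule Bochner_Integration.integrable_bound)
      show "integrable (lebesgue_on {c..d}) (\<lambda>x. B\<^sup>2 * cw S x)" using wi by simp
      show "?\<phi> \<in> borel_measurable (lebesgue_on {c..d})" using fm borel_measurable_integrable[OF wi] by measurable
      have "norm (?\<phi> x) \<le> norm (B\<^sup>2 * cw S x)" if "x \<in> {c..d}" for x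
      proof -
        have "(norm (f x))\<^sup>2 \<le> B\<^sup>2" using B[OF that] by (intro power_mono) auto
        then show ?thesis by (simp add: abs_mult mult_right_mono)
      qed
      then show "AE x in lebesgue_on {c..d}. norm (?\<phi> x) \<le> norm (B\<^sup>2 * cw S x)"
        by (intro AE_I2) simp
    qed
    then show ?thesis by (simp add: set_integrable_def integrable_restrict_space)
  qed
  then have "set_integrable lebesgue (einterval (lend S) c \<union> {c..d} \<union> einterval d (rend S)) ?\<phi>"
    using c d by (intro set_integrable_Un) auto
  \<comment> \<open>The three sets cover the interval even if d < c, when the middle one is
    empty.\<close>
  then have "set_integrable lebesgue (sl_int S) ?\<phi>"
    by (rule set_integrable_subset) (auto simp: mem_sl_int einterval_iff not_le)
  then show ?thesis
    using f_meas unfolding L2w_def by (simp add: set_integrable_def integrable_restrict_space)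
qed

lemma solution_dmax:
  assumes f: "sl_solution S z f"
  shows "dmax f"
  unfolding dmax_def
proof (intro conjI solution_regular[OF f] solution_L2w[OF f])
  have "AE x in lebesgue_on (sl_int S). z * f x + 0 * f x = ell S f x"
    using solution_ell[OF f] by eventually_elim simp
  then show "ell S f \<in> L2w S" by (rule L2w_AE[OF L2w_linear[OF solution_L2w[OF f] solution_L2w[OF f]]])
qed

section \<open>Quasi-derivatives as limits of Wronskians\<close>

lemma frame_dmax:
  "dmax (\<lambda>x. of_real (ua F x))" "dmax (\<lambda>x. of_real (va F x))"
  "dmax (\<lambda>x. of_real (ub F x))" "dmax (\<lambda>x. of_real (vb F x))"
  using frame solution_dmax
  by (auto simp: is_frame_def principal_a_def nonprincipal_a_def principal_b_def nonprincipal_b_def)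

lemma qd_wronskian:
  assumes "dmax f"
  shows "qd0_a S F f = wronskian_lend f (\<lambda>x. of_real (va F x))"
    "qd1_a S F f = - wronskian_lend f (\<lambda>x. of_real (ua F x))"
    "qd0_b S F f = wronskian_rend f (\<lambda>x. of_real (vb F x))"
    "qd1_b S F f = - wronskian_rend f (\<lambda>x. of_real (ub F x))"
  using assms frame_dmax
  by (simp_all add: qd0_a_def qd1_a_def qd0_b_def qd1_b_def bracket_a_wronskian bracket_b_wronskian)

lemma frame_wronskian:
  "wronskian_lend (\<lambda>x. of_real (ua F x)) (\<lambda>x. of_real (va F x)) = 1"
  "wronskian_rend (\<lambda>x. of_real (ub F x)) (\<lambda>x. of_real (vb F x)) = 1"
  using frame frame_dmax by (auto simp: is_frame_def bracket_a_wronskian bracket_b_wronskian)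

text \<open>Pluecker identity with the frame at the left end, whose own Wronskian is 1 there. If
  both arguments satisfy the boundary condition, the boundary term in Green's formula
  disappears.\<close>

lemma wronskian_lend_qd:
  assumes "dmax f" "dmax g"
  shows "wronskian_lend f g = qd0_a S F f * qd1_a S F g - qd1_a S F f * qd0_a S F g"
  using pluecker_lend[OF assms frame_dmax(1,2)] assms by (simp add: frame_wronskian qd_wronskian)

lemma wronskian_rend_qd:
  assumes "dmax f" "dmax g"
  shows "wronskian_rend f g = qd0_b S F f * qd1_b S F g - qd1_b S F f * qd0_b S F g"
  using pluecker_rend[OF assms frame_dmax(3,4)] assms by (simp add: frame_wronskian qd_wronskian)

lemma qd_linear:
  assumes "dmax f" "dmax g"
  shows "qd0_a S F (\<lambda>x. c * f x + d * g x) = c * qd0_a S F f + d * qd0_a S F g"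
    "qd0_b S F (\<lambda>x. c * f x + d * g x) = c * qd0_b S F f + d * qd0_b S F g"
  using assms frame_dmax by (simp_all add: qd_wronskian dmax_linear wronskian_lend_linear wronskian_rend_linear)

lemma wronskian_cnj:
  assumes "dmax f" "dmax g" "x \<in> sl_int S"
  shows "wronskian (\<lambda>x. cnj (f x)) (\<lambda>x. cnj (g x)) x = cnj (wronskian f g x)"
  using regular_cnj(2)[OF dmax_D(1)[OF assms(1)] assms(3)] regular_cnj(2)[OF dmax_D(1)[OF assms(2)] assms(3)]
  by (simp add: wronskian_def)

lemma wronskian_lend_cnj:
  assumes "dmax f" "dmax g"
  shows "wronskian_lend (\<lambda>x. cnj (f x)) (\<lambda>x. cnj (g x)) = cnj (wronskian_lend f g)"
proof (rule wronskian_lend_eqI, rule Lim_transform_eventually)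
  show "((\<lambda>x. cnj (wronskian f g (real_of_ereal x))) \<longlongrightarrow> cnj (wronskian_lend f g)) (at_right (lend S))"
    by (intro tendsto_intros wronskian_lend assms)
  show "\<forall>\<^sub>F x in at_right (lend S). cnj (wronskian f g (real_of_ereal x)) =
      wronskian (\<lambda>x. cnj (f x)) (\<lambda>x. cnj (g x)) (real_of_ereal x)"
    using near_lend_int by eventually_elim (simp add: wronskian_cnj assms)
qed

lemma wronskian_rend_cnj:
  assumes "dmax f" "dmax g"
  shows "wronskian_rend (\<lambda>x. cnj (f x)) (\<lambda>x. cnj (g x)) = cnj (wronskian_rend f g)"
proof (rule wronskian_rend_eqI, rule Lim_transform_eventually)
  show "((\<lambda>x. cnj (wronskian f g (real_of_ereal x))) \<longlongrightarrow> cnj (wronskian_rend f g)) (at_left (rend S))"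
    by (intro tendsto_intros wronskian_rend assms)
  show "\<forall>\<^sub>F x in at_left (rend S). cnj (wronskian f g (real_of_ereal x)) =
      wronskian (\<lambda>x. cnj (f x)) (\<lambda>x. cnj (g x)) (real_of_ereal x)"
    using near_rend_int by eventually_elim (simp add: wronskian_cnj assms)
qed

text \<open>Conjugation passes through because the frame functions are real. Thus cnj f satisfies
  the boundary conditions whenever f does.\<close>

lemma qd_cnj:
  assumes "dmax f"
  shows "qd0_a S F (\<lambda>x. cnj (f x)) = cnj (qd0_a S F f)" "qd0_b S F (\<lambda>x. cnj (f x)) = cnj (qd0_b S F f)"
  using assms frame_dmax wronskian_lend_cnj[OF assms frame_dmax(2)] wronskian_rend_cnj[OF assms frame_dmax(4)]
  by (simp_all add: qd_wronskian dmax_cnj)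

lemma wronskian_end_cong:
  assumes "dmax f" "dmax g" "\<And>x. x \<in> sl_int S \<Longrightarrow> f x = f' x"
  shows "wronskian_lend f' g = wronskian_lend f g" "wronskian_rend f' g = wronskian_rend f g"
proof -
  have eq: "wronskian f g x = wronskian f' g x" if "x \<in> sl_int S" for x
    by (rule wronskian_cong[symmetric]) (use assms dmax_D that in auto)
  show "wronskian_lend f' g = wronskian_lend f g"
    by (rule wronskian_lend_eqI, rule Lim_transform_eventually[OF wronskian_lend[OF assms(1,2)]],
        use near_lend_int in eventually_elim) (rule eq)
  show "wronskian_rend f' g = wronskian_rend f g"
    by (rule wronskian_rend_eqI, rule Lim_transform_eventually[OF wronskian_rend[OF assms(1,2)]],
        use near_rend_int in eventually_elim) (rule eq)
qed

text \<open>Setting a solution to zero off the interval, to place it in \<open>Dmax\<close>, leaves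
  its boundary values unchanged.\<close>

lemma qd_cong:
  assumes "dmax f" "\<And>x. x \<in> sl_int S \<Longrightarrow> f x = g x"
  shows "qd0_a S F g = qd0_a S F f" "qd1_a S F g = qd1_a S F f"
    "qd0_b S F g = qd0_b S F f" "qd1_b S F g = qd1_b S F f"
proof -
  have g: "dmax g" by (rule dmax_cong[OF assms])
  have "wronskian_lend g h = wronskian_lend f h" "wronskian_rend g h = wronskian_rend f h" if "dmax h" for h
    using wronskian_end_cong[OF assms(1) that] assms(2) by blast+
  then show "qd0_a S F g = qd0_a S F f" "qd1_a S F g = qd1_a S F f"
    "qd0_b S F g = qd0_b S F f" "qd1_b S F g = qd1_b S F f"
    using frame_dmax by (simp_all only: qd_wronskian[OF g] qd_wronskian[OF assms(1)])
qed

section \<open>The fundamental system\<close>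

lemma fund:
  "sl_solution S z (u1 z)" "qd0_a S F (u1 z) = 1" "qd1_a S F (u1 z) = 0"
  "sl_solution S z (u2 z)" "qd0_a S F (u2 z) = 0" "qd1_a S F (u2 z) = 1"
  using fundamental by (auto simp: fundamental_system_def)

lemma fund_dmax: "dmax (u1 z)" "dmax (u2 z)"
  using fund solution_dmax by blast+

lemma solution_wronskian_ends:
  assumes f: "sl_solution S z f" and g: "sl_solution S z g" and x: "x \<in> sl_int S"
  shows "wronskian f g x = wronskian_lend f g" "wronskian f g x = wronskian_rend f g"
proof -
  have "((\<lambda>y. wronskian f g (real_of_ereal y)) \<longlongrightarrow> wronskian f g x) (at_right (lend S))"
    by (rule tendsto_eventually, use near_lend_int in eventually_elim) (rule wronskian_const[OF f g _ x])
  then show "wronskian f g x = wronskian_lend f g" by (simp add: wronskian_lend_eqI)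
  have "((\<lambda>y. wronskian f g (real_of_ereal y)) \<longlongrightarrow> wronskian f g x) (at_left (rend S))"
    by (rule tendsto_eventually, use near_rend_int in eventually_elim) (rule wronskian_const[OF f g _ x])
  then show "wronskian f g x = wronskian_rend f g" by (simp add: wronskian_rend_eqI)
qed

lemma fund_wronskian:
  assumes "x \<in> sl_int S"
  shows "wronskian (u1 z) (u2 z) x = 1"
  using solution_wronskian_ends(1)[OF fund(1,4) assms] fund fund_dmax by (simp add: wronskian_lend_qd)

text \<open>The Wronskian of \<open>u1\<close> and \<open>u2\<close> is constant; it equals 1 at the
  left end and is read off here at the right end.\<close>

lemma fund_rend: "qd0_b S F (u1 z) * qd1_b S F (u2 z) - qd1_b S F (u1 z) * qd0_b S F (u2 z) = 1"
proof -
  obtain x where x: "x \<in> sl_int S" using sl_int_ex by blast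
  show ?thesis
    using solution_wronskian_ends(2)[OF fund(1,4) x] fund_wronskian[OF x] by (simp add: wronskian_rend_qd fund_dmax)
qed

text \<open>Cramer's rule with unit determinant. The numerators are Wronskians of solutions, hence
  constant, and are evaluated at the left end.\<close>

lemma solution_expansion:
  assumes f: "sl_solution S z f" and x: "x \<in> sl_int S"
  shows "f x = qd0_a S F f * u1 z x + qd1_a S F f * u2 z x"
proof -
  note d = solution_dmax[OF f]
  have 1: "wronskian f (u2 z) x = qd0_a S F f" "wronskian (u1 z) f x = qd1_a S F f"
    using solution_wronskian_ends(1)[OF f fund(4) x] solution_wronskian_ends(1)[OF fund(1) f x] fund d fund_dmax
    by (simp_all add: wronskian_lend_qd)
  have "f x * wronskian (u1 z) (u2 z) x = wronskian f (u2 z) x * u1 z x + wronskian (u1 z) f x * u2 z x"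
    by (simp add: wronskian_def algebra_simps)
  then show ?thesis by (simp add: fund_wronskian[OF x] 1)
qed

section \<open>Estimates and the resolvent at non-real points\<close>

definition sq_norm :: "(real \<Rightarrow> complex) \<Rightarrow> real" where
  "sq_norm f = (LINT x|lebesgue_on (sl_int S). (norm (f x))\<^sup>2 * cw S x)"

lemma normw_sq_norm: "normw S f = sqrt (sq_norm f)"
proof -
  have "ipw S f f = (LINT x|lebesgue_on (sl_int S). complex_of_real ((norm (f x))\<^sup>2 * cw S x))"
    unfolding ipw_def by (simp add: complex_norm_square[symmetric] mult.commute)
  also have "\<dots> = of_real (sq_norm f)" unfolding sq_norm_def by (rule integral_complex_of_real)
  finally show ?thesis by (simp add: normw_def)
qed

lemma sq_norm_nonneg: "0 \<le> sq_norm f"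
  unfolding sq_norm_def
  by (rule integral_nonneg_AE, use cw_pos in eventually_elim) simp

text \<open>Boundary conditions make the boundary terms of Green's formula for \<open>f\<close> and \<open>cnj f\<close>
  vanish; its imaginary part then bounds \<open>f\<close> by \<open>(L\<^sub>0 - z) f\<close>.\<close>

lemma dissipation:
  assumes f: "dmax f" and bc: "qd0_a S F f = 0" "qd0_b S F f = 0" and z: "Im z \<noteq> 0"
  shows "(Im z)\<^sup>2 * sq_norm f \<le> sq_norm (\<lambda>x. ell S f x - z * f x)"
proof -
  define g where "g x = ell S f x - z * f x" for x
  define \<Lambda> where "\<Lambda> = lebesgue_on (sl_int S)"
  define \<delta> where "\<delta> = \<bar>Im z\<bar>"
  have \<delta>: "\<delta> > 0" using z by (simp add: \<delta>_def)
  have g: "g \<in> L2w S"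
    using L2w_linear[OF dmax_D(3)[OF f] dmax_D(2)[OF f], of 1 "-z"] by (simp add: g_def[abs_def])
  note fL = dmax_D(2)[OF f]
  note df' = dmax_cnj[OF f]
  have f2: "integrable \<Lambda> (\<lambda>x. (norm (f x))\<^sup>2 * cw S x)" and g2: "integrable \<Lambda> (\<lambda>x. (norm (g x))\<^sup>2 * cw S x)"
    using L2w_integrable[OF fL] L2w_integrable[OF g] by (simp_all add: \<Lambda>_def)
  have fg: "integrable \<Lambda> (\<lambda>x. g x * cnj (f x) * of_real (cw S x))"
    using L2w_mult_integrable[OF g L2w_cnj[OF fL]] by (simp add: \<Lambda>_def)
  have "(LINT x|\<Lambda>. of_real (cw S x) * (ell S f x * cnj (f x) - f x * ell S (\<lambda>x. cnj (f x)) x)) = 0"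
    using green_formula[OF f df'] f df' bc qd_cnj[OF f] by (simp add: wronskian_lend_qd wronskian_rend_qd \<Lambda>_def)
  \<comment> \<open>The coefficients are real, so \<open>ell\<close> commutes with conjugation and
    the integrand is 2i times the weighted imaginary part of ell[f] cnj f. Inserting ell[f] = g + z
    f splits off Im z times the squared modulus of f.\<close>
  also have "(LINT x|\<Lambda>. of_real (cw S x) * (ell S f x * cnj (f x) - f x * ell S (\<lambda>x. cnj (f x)) x)) =
     (LINT x|\<Lambda>. 2 * \<i> * of_real (Im z * ((norm (f x))\<^sup>2 * cw S x) + Im (g x * cnj (f x) * of_real (cw S x))))"
  proof (rule integral_cong_AE)
    show "(\<lambda>x. of_real (cw S x) * (ell S f x * cnj (f x) - f x * ell S (\<lambda>x. cnj (f x)) x)) \<in> borel_measurable \<Lambda>"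
      using wronskian_integrable[OF f df'] by (simp add: \<Lambda>_def)
    show "(\<lambda>x. 2 * \<i> * of_real (Im z * ((norm (f x))\<^sup>2 * cw S x) + Im (g x * cnj (f x) * of_real (cw S x)))) \<in> borel_measurable \<Lambda>"
      using borel_measurable_integrable[OF f2] borel_measurable_integrable[OF fg] by measurable
    show "AE x in \<Lambda>. of_real (cw S x) * (ell S f x * cnj (f x) - f x * ell S (\<lambda>x. cnj (f x)) x) =
       2 * \<i> * of_real (Im z * ((norm (f x))\<^sup>2 * cw S x) + Im (g x * cnj (f x) * of_real (cw S x)))"
      using regular_cnj(3)[OF dmax_D(1)[OF f]] unfolding \<Lambda>_def
    proof eventually_elim
      case (elim x)
      have e: "ell S f x = g x + z * f x" by (simp add: g_def)
      have n: "(norm (f x))\<^sup>2 = (Re (f x))\<^sup>2 + (Im (f x))\<^sup>2" by (rule cmod_power2)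
      show ?case unfolding elim e n
        by (simp add: complex_eq_iff algebra_simps power2_eq_square)
    qed
  qed
  also have "\<dots> = 2 * \<i> * of_real (LINT x|\<Lambda>. Im z * ((norm (f x))\<^sup>2 * cw S x) + Im (g x * cnj (f x) * of_real (cw S x)))"
    by (subst integral_mult_right_zero) (simp only: integral_complex_of_real)
  also have "(LINT x|\<Lambda>. Im z * ((norm (f x))\<^sup>2 * cw S x) + Im (g x * cnj (f x) * of_real (cw S x)))
     = Im z * sq_norm f + (LINT x|\<Lambda>. Im (g x * cnj (f x) * of_real (cw S x)))"
    using f2 fg by (subst Bochner_Integration.integral_add) (simp_all only: integrable_mult_right integrable_Im integral_mult_right_zero sq_norm_def \<Lambda>_def)
  finally have "Im z * sq_norm f = - (LINT x|\<Lambda>. Im (g x * cnj (f x) * of_real (cw S x)))"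
    by (simp only: mult_eq_0_iff of_real_eq_0_iff) (simp add: eq_neg_iff_add_eq_0)
  then have "\<bar>Im z * sq_norm f\<bar> = \<bar>LINT x|\<Lambda>. Im (g x * cnj (f x) * of_real (cw S x))\<bar>"
    by (simp only: abs_minus_cancel)
  then have "\<delta> * sq_norm f = \<bar>LINT x|\<Lambda>. Im (g x * cnj (f x) * of_real (cw S x))\<bar>"
    using sq_norm_nonneg[of f] by (simp only: \<delta>_def abs_mult abs_of_nonneg)
  also have "\<dots> \<le> (LINT x|\<Lambda>. \<bar>Im (g x * cnj (f x) * of_real (cw S x))\<bar>)"
    by (rule integral_abs_bound)
  \<comment> \<open>Young's inequality. With the weight \<delta>/2 half of the left side is
    absorbed, which leaves exactly the constant \<delta>^2.\<close>
  also have "\<dots> \<le> (LINT x|\<Lambda>. \<delta>/2 * ((norm (f x))\<^sup>2 * cw S x) + 1 / (2*\<delta>) * ((norm (g x))\<^sup>2 * cw S x))"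
  proof (rule integral_mono_AE)
    show "integrable \<Lambda> (\<lambda>x. \<bar>Im (g x * cnj (f x) * of_real (cw S x))\<bar>)"
      using fg by (intro integrable_abs integrable_Im)
    show "integrable \<Lambda> (\<lambda>x. \<delta>/2 * ((norm (f x))\<^sup>2 * cw S x) + 1 / (2*\<delta>) * ((norm (g x))\<^sup>2 * cw S x))"
      using f2 g2 by (intro Bochner_Integration.integrable_add integrable_mult_right)
    show "AE x in \<Lambda>. \<bar>Im (g x * cnj (f x) * of_real (cw S x))\<bar> \<le>
       \<delta>/2 * ((norm (f x))\<^sup>2 * cw S x) + 1 / (2*\<delta>) * ((norm (g x))\<^sup>2 * cw S x)"
      using cw_pos unfolding \<Lambda>_def
    proof eventually_elim
      case (elim x)
      have "\<bar>Im (g x * cnj (f x) * of_real (cw S x))\<bar> \<le> norm (g x * cnj (f x) * of_real (cw S x))"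
        by (rule abs_Im_le_cmod)
      also have "\<dots> = norm (g x) * norm (f x) * cw S x" using elim by (simp add: norm_mult)
      also have "norm (g x) * norm (f x) \<le> \<delta>/2 * (norm (f x))\<^sup>2 + 1 / (2*\<delta>) * (norm (g x))\<^sup>2"
      proof -
        have "0 \<le> (\<delta> * norm (f x) - norm (g x))\<^sup>2 / (2*\<delta>)" using \<delta> by simp
        also have "\<dots> = \<delta>/2 * (norm (f x))\<^sup>2 + 1 / (2*\<delta>) * (norm (g x))\<^sup>2 - norm (g x) * norm (f x)"
          using \<delta> by (simp add: field_simps power2_eq_square)
        finally show ?thesis by simp
      qed
      finally show ?case using elim by (simp add: algebra_simps)
    qed
  qed
  also have "\<dots> = \<delta>/2 * sq_norm f + 1 / (2*\<delta>) * sq_norm g"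
    using f2 g2 by (subst Bochner_Integration.integral_add) (simp_all only: integrable_mult_right integral_mult_right_zero sq_norm_def \<Lambda>_def)
  finally have "\<delta> * (\<delta> * sq_norm f) \<le> \<delta> * (\<delta>/2 * sq_norm f + 1 / (2*\<delta>) * sq_norm g)"
    using \<delta> by (intro mult_left_mono) auto
  then have "\<delta>\<^sup>2 * sq_norm f \<le> sq_norm g" using \<delta> by (simp add: field_simps power2_eq_square)
  then show ?thesis by (simp add: \<delta>_def g_def[abs_def])
qed

lemma sq_norm_0:
  assumes f: "dmax f" and "sq_norm f \<le> 0" and x: "x \<in> sl_int S"
  shows "f x = 0"
proof -
  have "sq_norm f = 0" using assms(2) sq_norm_nonneg[of f] by linarith
  moreover have "AE x in lebesgue_on (sl_int S). 0 \<le> (norm (f x))\<^sup>2 * cw S x"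
    using cw_pos by eventually_elim simp
  ultimately have "AE x in lebesgue_on (sl_int S). (norm (f x))\<^sup>2 * cw S x = 0"
    using integral_nonneg_eq_0_iff_AE[OF L2w_integrable[OF dmax_D(2)[OF f]]] by (simp add: sq_norm_def)
  with cw_pos have "AE x in lebesgue_on (sl_int S). f x = 0" by eventually_elim simp
  then show ?thesis
    by (rule AE_eq_imp_eq[OF AC_loc_continuous[OF regular_AC(1)[OF dmax_D(1)[OF f]]] continuous_on_const _ x])
qed

lemma dissipation_0:
  assumes f: "dmax f" and bc: "qd0_a S F f = 0" "qd0_b S F f = 0" and z: "Im z \<noteq> 0"
    and ell: "AE x in lebesgue_on (sl_int S). ell S f x - z * f x = 0" and x: "x \<in> sl_int S"
  shows "f x = 0"
proof (rule sq_norm_0[OF f _ x])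
  have "sq_norm (\<lambda>x. ell S f x - z * f x) = (LINT x|lebesgue_on (sl_int S). 0)"
    unfolding sq_norm_def
  proof (rule integral_cong_AE)
    have "(\<lambda>x. ell S f x - z * f x) \<in> L2w S"
      using L2w_linear[OF dmax_D(3)[OF f] dmax_D(2)[OF f], of 1 "-z"] by simp
    then show "(\<lambda>x. (norm (ell S f x - z * f x))\<^sup>2 * cw S x) \<in> borel_measurable (lebesgue_on (sl_int S))"
      using L2w_integrable by blast
    show "AE x in lebesgue_on (sl_int S). (norm (ell S f x - z * f x))\<^sup>2 * cw S x = 0"
      using ell by eventually_elim simp
  qed simp
  then have "(Im z)\<^sup>2 * sq_norm f \<le> 0" using dissipation[OF f bc z] by simp
  then show "sq_norm f \<le> 0" using z by (simp add: mult_le_0_iff)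
qed

text \<open>Otherwise \<open>u2 z\<close> would satisfy both boundary conditions and vanish by
  \<open>dissipation_0\<close>, contradicting its unit Wronskian with \<open>u1 z\<close>.\<close>

lemma u2_rend_nonzero:
  assumes z: "Im z \<noteq> 0"
  shows "qd0_b S F (u2 z) \<noteq> 0"
proof
  assume 0: "qd0_b S F (u2 z) = 0"
  obtain x where x: "x \<in> sl_int S" using sl_int_ex by blast
  have ell: "AE x in lebesgue_on (sl_int S). ell S (u2 z) x - z * u2 z x = 0"
    using solution_ell[OF fund(4)] by eventually_elim simp
  have u2: "u2 z x = 0" if "x \<in> sl_int S" for x
    by (rule dissipation_0[OF fund_dmax(2) fund(5) 0 z ell that])
  have reg: "sl_regular S (u2 z)" by (rule solution_regular[OF fund(4)])
  have "pderiv_rep S (u2 z) x = pderiv_rep S (\<lambda>x. 0 * u2 z x + 0 * u2 z x) x"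
    by (rule regular_cong(2)[OF regular_linear(1)[OF reg reg] _ x]) (simp add: u2)
  also have "\<dots> = 0" using regular_linear(2)[OF reg reg x, of 0 0] by simp
  finally have "wronskian (u1 z) (u2 z) x = 0" by (simp add: wronskian_def u2[OF x])
  then show False using fund_wronskian[OF x] by simp
qed

lemma L2w_bounded_mult:
  assumes f: "f \<in> L2w S" and A [measurable]: "A \<in> borel_measurable (lebesgue_on (sl_int S))"
    and M: "\<And>x. norm (A x) \<le> M"
  shows "(\<lambda>x. f x * A x) \<in> L2w S"
proof (rule L2wI)
  note [measurable] = L2w_measurable[OF f]
  show "(\<lambda>x. f x * A x) \<in> borel_measurable (lebesgue_on (sl_int S))" by measurable
  show "integrable (lebesgue_on (sl_int S)) (\<lambda>x. M\<^sup>2 * ((norm (f x))\<^sup>2 * cw S x))"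
    using L2w_integrable[OF f] by simp
  show "AE x in lebesgue_on (sl_int S). (norm (f x * A x))\<^sup>2 * cw S x \<le> M\<^sup>2 * ((norm (f x))\<^sup>2 * cw S x)"
    using cw_pos
  proof eventually_elim
    case (elim x)
    have "(norm (A x))\<^sup>2 \<le> M\<^sup>2" using M by (intro power_mono) auto
    then have "(norm (A x))\<^sup>2 * ((norm (f x))\<^sup>2 * cw S x) \<le> M\<^sup>2 * ((norm (f x))\<^sup>2 * cw S x)"
      using elim by (intro mult_right_mono) auto
    then show ?case by (simp add: norm_mult power_mult_distrib mult_ac)
  qed
qed

text \<open>Variation of constants with \<open>u\<^sub>2\<close>, which satisfies the condition at the left end, and the
  combination \<open>\<psi>\<close> of \<open>u\<^sub>1\<close> and \<open>u\<^sub>2\<close> that satisfies the condition at the right end.\<close>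

lemma resolvent_exists:
  assumes z: "Im z \<noteq> 0" and g: "g \<in> L2w S"
  shows "\<exists>f. dmax f \<and> qd0_a S F f = 0 \<and> qd0_b S F f = 0 \<and>
    (AE x in lebesgue_on (sl_int S). ell S f x = z * f x + g x)"
proof -
  let ?\<Lambda> = "lebesgue_on (sl_int S)"
  define r where "r = qd0_b S F (u1 z) / qd0_b S F (u2 z)"
  define \<psi> where "\<psi> x = 1 * u1 z x + (- r) * u2 z x" for x
  have \<psi>: "dmax \<psi>" unfolding \<psi>_def[abs_def] by (intro dmax_linear fund_dmax)
  have \<psi>b: "qd0_b S F \<psi> = 0"
    unfolding \<psi>_def[abs_def] qd_linear(2)[OF fund_dmax] using u2_rend_nonzero[OF z] by (simp add: r_def)
  note \<phi> = fund_dmax(2)[of z]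
  have W: "wronskian \<psi> (u2 z) x = 1" if "x \<in> sl_int S" for x
    unfolding \<psi>_def[abs_def] wronskian_linear[OF dmax_D(1)[OF fund_dmax(1)] dmax_D(1)[OF fund_dmax(2)] that]
    using fund_wronskian[OF that] by (simp add: wronskian_def)
  have ell\<psi>: "AE x in ?\<Lambda>. ell S \<psi> x = z * \<psi> x"
    using regular_linear(3)[OF dmax_D(1)[OF fund_dmax(1)[of z]] dmax_D(1)[OF fund_dmax(2)[of z]], where c=1 and d="-r"]
      solution_ell[OF fund(1), of z] solution_ell[OF fund(4), of z]
    unfolding \<psi>_def[abs_def] by eventually_elim (simp add: algebra_simps)
  have ell\<phi>: "AE x in ?\<Lambda>. ell S (u2 z) x = z * u2 z x" by (rule solution_ell[OF fund(4)])
  define \<alpha> where "\<alpha> x = u2 z x * g x * of_real (cw S x)" for x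
  define \<beta> where "\<beta> x = \<psi> x * g x * of_real (cw S x)" for x
  have \<alpha>: "integrable ?\<Lambda> \<alpha>" unfolding \<alpha>_def[abs_def] by (intro L2w_mult_integrable g dmax_D(2) \<phi>)
  have \<beta>: "integrable ?\<Lambda> \<beta>" unfolding \<beta>_def[abs_def] by (intro L2w_mult_integrable g dmax_D(2) \<psi>)
  define I where "I = (LINT x|?\<Lambda>. \<beta> x)"
  \<comment> \<open>A integrates from the left end up to x, B from x to the right end. So only
    \<open>u2\<close> survives at the left end and only \<psi> at the right end.\<close>
  define A where "A = cumul \<alpha>"
  define B where "B x = I - cumul \<beta> x" for x
  have A_AC: "AC_loc (lend S) (rend S) A" unfolding A_def by (rule cumul_AC[OF \<alpha>])
  have B_AC: "AC_loc (lend S) (rend S) B" unfolding B_def[abs_def] by (intro AC_loc_diff AC_loc_const cumul_AC \<beta>)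
  have A_deriv: "AE x in ?\<Lambda>. (A has_vector_derivative \<alpha> x) (at x)"
    unfolding A_def by (rule cumul_deriv[OF \<alpha>])
  have B_deriv: "AE x in ?\<Lambda>. (B has_vector_derivative - \<beta> x) (at x)"
    using cumul_deriv[OF \<beta>]
  proof eventually_elim
    case (elim x)
    have "(B has_vector_derivative 0 - \<beta> x) (at x)"
      unfolding B_def[abs_def] by (intro derivative_intros elim)
    then show ?case by simp
  qed
  have A_meas: "A \<in> borel_measurable ?\<Lambda>" and B_meas: "B \<in> borel_measurable ?\<Lambda>"
    by (auto intro!: continuous_imp_measurable_on_sets_lebesgue AC_loc_continuous A_AC B_AC)
  define f where "f x = \<psi> x * A x + u2 z x * B x" for x
  \<comment> \<open>The candidate for p f'. It contains no derivatives of A and B, because \<psi> *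
    \<alpha> = u2 * \<beta>.\<close>
  define h where "h x = pderiv_rep S \<psi> x * A x + pderiv_rep S (u2 z) x * B x" for x
  have f_AC: "AC_loc (lend S) (rend S) f" and h_AC: "AC_loc (lend S) (rend S) h"
    unfolding f_def[abs_def] h_def[abs_def]
    by (intro AC_loc_add AC_loc_mult A_AC B_AC regular_AC dmax_D(1) \<psi> \<phi>)+
  have "AE x in ?\<Lambda>. (f has_vector_derivative h x / of_real (cp S x)) (at x)"
    using A_deriv B_deriv regular_deriv[OF dmax_D(1)[OF \<psi>]] regular_deriv[OF dmax_D(1)[OF \<phi>]]
  proof eventually_elim
    case (elim x)
    have "(f has_vector_derivative (\<psi> x * \<alpha> x + pderiv_rep S \<psi> x / of_real (cp S x) * A x)
       + (u2 z x * (- \<beta> x) + pderiv_rep S (u2 z) x / of_real (cp S x) * B x)) (at x)"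
      unfolding f_def[abs_def] by (intro has_vector_derivative_add has_vector_derivative_mult elim)
    then show ?case by (simp add: \<alpha>_def \<beta>_def h_def algebra_simps add_divide_distrib)
  qed
  note f = sl_regularI[OF f_AC h_AC this]
  have ellf: "AE x in ?\<Lambda>. ell S f x = z * f x + g x"
  proof (rule ell_AE[OF f])
    show "AE x in ?\<Lambda>. (h has_vector_derivative - of_real (cw S x) * (z * f x + g x) - of_real (cq S x) * f x) (at x)"
      using A_deriv B_deriv regular_deriv2[OF dmax_D(1)[OF \<psi>]] regular_deriv2[OF dmax_D(1)[OF \<phi>]]
        ell\<psi> ell\<phi> AE_sl_int
    proof eventually_elim
      case (elim x)
      have "(h has_vector_derivative
         (pderiv_rep S \<psi> x * \<alpha> x + (- of_real (cw S x) * ell S \<psi> x - of_real (cq S x) * \<psi> x) * A x)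
       + (pderiv_rep S (u2 z) x * (- \<beta> x) + (- of_real (cw S x) * ell S (u2 z) x - of_real (cq S x) * u2 z x) * B x)) (at x)"
        unfolding h_def[abs_def] by (intro has_vector_derivative_add has_vector_derivative_mult elim)
      \<comment> \<open>The derivatives of A and B now leave -w g times the Wronskian of \<psi> and
        \<open>u2\<close>, which is 1.\<close>
      moreover have "(pderiv_rep S \<psi> x * \<alpha> x + (- of_real (cw S x) * ell S \<psi> x - of_real (cq S x) * \<psi> x) * A x)
       + (pderiv_rep S (u2 z) x * (- \<beta> x) + (- of_real (cw S x) * ell S (u2 z) x - of_real (cq S x) * u2 z x) * B x)
       = - of_real (cw S x) * (z * f x + g x * wronskian \<psi> (u2 z) x) - of_real (cq S x) * f x"
        unfolding elim by (simp add: f_def \<alpha>_def \<beta>_def wronskian_def algebra_simps)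
      ultimately show ?case using W elim by simp
    qed
  qed
  have fL: "f \<in> L2w S"
  proof -
    have "(\<lambda>x. 1 * (\<psi> x * A x) + 1 * (u2 z x * B x)) \<in> L2w S"
    proof (intro L2w_linear L2w_bounded_mult)
      show "norm (A x) \<le> (LINT t|?\<Lambda>. norm (\<alpha> t))" for x unfolding A_def by (rule cumul_bounded[OF \<alpha>])
      show "norm (B x) \<le> norm I + (LINT t|?\<Lambda>. norm (\<beta> t))" for x
        unfolding B_def by (rule order_trans[OF norm_triangle_ineq4 add_left_mono[OF cumul_bounded[OF \<beta>]]])
    qed (use dmax_D \<psi> \<phi> A_meas B_meas in auto)
    then show ?thesis by (simp add: f_def[abs_def])
  qed
  have df: "dmax f"
    unfolding dmax_def
  proof (intro conjI f(1) fL)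
    have "AE x in ?\<Lambda>. z * f x + 1 * g x = ell S f x" using ellf by eventually_elim simp
    then show "ell S f \<in> L2w S" by (rule L2w_AE[OF L2w_linear[OF fL g]])
  qed
  \<comment> \<open>The formulas for f and p f' share the coefficients A and B, so Wronskians
    combine with the same ones and their limits follow from those of A and B.\<close>
  have Wf: "A x * wronskian \<psi> v x + B x * wronskian (u2 z) v x = wronskian f v x" if "x \<in> sl_int S" for v x
    using f(2)[OF that] by (simp add: wronskian_def f_def h_def algebra_simps)
  have "wronskian_lend f v = I * wronskian_lend (u2 z) v" if v: "dmax v" for v
  proof (rule wronskian_lend_eqI, rule Lim_transform_eventually)
    have "((\<lambda>x. A (real_of_ereal x) * wronskian \<psi> v (real_of_ereal x) + B (real_of_ereal x) * wronskian (u2 z) v (real_of_ereal x))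
       \<longlongrightarrow> 0 * wronskian_lend \<psi> v + (I - 0) * wronskian_lend (u2 z) v) (at_right (lend S))"
      unfolding A_def B_def by (intro tendsto_intros cumul_lend \<alpha> \<beta> wronskian_lend \<psi> \<phi> v)
    then show "((\<lambda>x. A (real_of_ereal x) * wronskian \<psi> v (real_of_ereal x) + B (real_of_ereal x) * wronskian (u2 z) v (real_of_ereal x))
       \<longlongrightarrow> I * wronskian_lend (u2 z) v) (at_right (lend S))" by simp
    show "\<forall>\<^sub>F x in at_right (lend S). A (real_of_ereal x) * wronskian \<psi> v (real_of_ereal x) +
       B (real_of_ereal x) * wronskian (u2 z) v (real_of_ereal x) = wronskian f v (real_of_ereal x)"
      using near_lend_int by eventually_elim (rule Wf)
  qed
  from this[OF frame_dmax(2)] have "qd0_a S F f = 0"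
    using fund(5)[of z] df \<phi> by (simp add: qd_wronskian)
  moreover have "wronskian_rend f v = (LINT x|?\<Lambda>. \<alpha> x) * wronskian_rend \<psi> v" if v: "dmax v" for v
  proof (rule wronskian_rend_eqI, rule Lim_transform_eventually)
    have "((\<lambda>x. A (real_of_ereal x) * wronskian \<psi> v (real_of_ereal x) + B (real_of_ereal x) * wronskian (u2 z) v (real_of_ereal x))
       \<longlongrightarrow> (LINT x|?\<Lambda>. \<alpha> x) * wronskian_rend \<psi> v + (I - I) * wronskian_rend (u2 z) v) (at_left (rend S))"
      unfolding A_def B_def unfolding I_def by (intro tendsto_intros cumul_rend \<alpha> \<beta> wronskian_rend \<psi> \<phi> v)
    then show "((\<lambda>x. A (real_of_ereal x) * wronskian \<psi> v (real_of_ereal x) + B (real_of_ereal x) * wronskian (u2 z) v (real_of_ereal x))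
       \<longlongrightarrow> (LINT x|?\<Lambda>. \<alpha> x) * wronskian_rend \<psi> v) (at_left (rend S))" by simp
    show "\<forall>\<^sub>F x in at_left (rend S). A (real_of_ereal x) * wronskian \<psi> v (real_of_ereal x) +
       B (real_of_ereal x) * wronskian (u2 z) v (real_of_ereal x) = wronskian f v (real_of_ereal x)"
      using near_rend_int by eventually_elim (rule Wf)
  qed
  from this[OF frame_dmax(4)] have "qd0_b S F f = 0"
    using \<psi>b df \<psi> by (simp add: qd_wronskian)
  ultimately show ?thesis using df ellf by blast
qed

text \<open>Existence is variation of constants; uniqueness and the bound 1 / \<bar>Im z\<bar> both
  come from \<open>dissipation\<close>.\<close>

lemma resolvent_set_nonreal:
  assumes z: "Im z \<noteq> 0"
  shows "z \<in> sl_resolvent_set S (dom_L0 S F)"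
  unfolding sl_resolvent_set_def mem_Collect_eq
proof (intro conjI ballI)
  fix g assume g: "g \<in> L2w S"
  obtain f where f: "dmax f" "qd0_a S F f = 0" "qd0_b S F f = 0" "AE x in lebesgue_on (sl_int S). ell S f x = z * f x + g x"
    using resolvent_exists[OF z g] by blast
  \<comment> \<open>Membership in \<open>Dmax\<close> and uniqueness as a total function both call
    for the version vanishing off the interval.\<close>
  define f' where "f' x = (if x \<in> sl_int S then f x else 0)" for x
  have ff': "\<And>x. x \<in> sl_int S \<Longrightarrow> f x = f' x" by (simp add: f'_def)
  have "AE x in lebesgue_on (sl_int S). ell S f' x = ell S f x"
    by (rule regular_cong(3)[OF dmax_D(1)[OF f(1)]]) (rule ff')
  with f(4) AE_sl_int have ell: "AE x in lebesgue_on (sl_int S). ell S f' x - z * f' x = g x"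
    by eventually_elim (simp add: ff')
  have "f' x = 0" if "x \<notin> sl_int S" for x using that by (simp add: f'_def)
  then have "f' \<in> dom_L0 S F"
    unfolding dom_L0_def Dmax_dmax
    using f qd_cong[OF f(1), of f'] dmax_cong[OF f(1), of f'] ff' by auto
  moreover have "k = f'" if k: "k \<in> dom_L0 S F" "AE x in lebesgue_on (sl_int S). ell S k x - z * k x = g x" for k
  proof -
    have dk: "dmax k" "qd0_a S F k = 0" "qd0_b S F k = 0" "\<And>x. x \<notin> sl_int S \<Longrightarrow> k x = 0"
      using k(1) by (auto simp: dom_L0_def Dmax_dmax)
    have df': "dmax f'" "qd0_a S F f' = 0" "qd0_b S F f' = 0"
      using \<open>f' \<in> dom_L0 S F\<close> by (auto simp: dom_L0_def Dmax_dmax)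
    have eq0: "1 * k x + (-1) * f' x = 0" if x: "x \<in> sl_int S" for x
    proof (rule dissipation_0[OF dmax_linear[OF dk(1) df'(1)] _ _ z _ x])
      show "AE x in lebesgue_on (sl_int S). ell S (\<lambda>x. 1 * k x + (-1) * f' x) x - z * (1 * k x + (-1) * f' x) = 0"
        using regular_linear(3)[OF dmax_D(1)[OF dk(1)] dmax_D(1)[OF df'(1)], where c=1 and d="-1"] k(2) ell
        by eventually_elim (simp add: algebra_simps)
    qed (simp_all only: qd_linear[OF dk(1) df'(1)] dk df' mult_zero_right add_0)
    then show "k = f'" using dk(4) by (fastforce simp: f'_def fun_eq_iff)
  qed
  ultimately show "\<exists>!f. f \<in> dom_L0 S F \<and> (AE x in lebesgue_on (sl_int S). ell S f x - z * f x = g x)"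
    using ell by blast
next
  show "\<exists>C. \<forall>f\<in>dom_L0 S F. normw S f \<le> C * normw S (\<lambda>x. ell S f x - z * f x)"
  proof (intro exI[of _ "1 / \<bar>Im z\<bar>"] ballI)
    fix f assume "f \<in> dom_L0 S F"
    then have f: "dmax f" "qd0_a S F f = 0" "qd0_b S F f = 0" by (auto simp: dom_L0_def Dmax_dmax)
    have "sqrt ((Im z)\<^sup>2 * sq_norm f) \<le> sqrt (sq_norm (\<lambda>x. ell S f x - z * f x))"
      using dissipation[OF f z] by (rule real_sqrt_le_mono)
    then have "\<bar>Im z\<bar> * normw S f \<le> normw S (\<lambda>x. ell S f x - z * f x)"
      by (simp add: real_sqrt_mult normw_sq_norm)
    then show "normw S f \<le> 1 / \<bar>Im z\<bar> * normw S (\<lambda>x. ell S f x - z * f x)"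
      using z by (simp add: field_simps)
  qed
qed

section \<open>The Weyl function and the eigenfunctions\<close>

lemma kernel_restriction:
  assumes f: "sl_solution S z f"
  shows "(\<lambda>x. if x \<in> sl_int S then f x else 0) \<in> sl_kernel S (Dmax S) z"
proof -
  let ?g = "\<lambda>x. if x \<in> sl_int S then f x else 0"
  have eq: "f x = ?g x" if "x \<in> sl_int S" for x using that by simp
  have "AE x in lebesgue_on (sl_int S). ell S ?g x = ell S f x"
    by (rule regular_cong(3)[OF solution_regular[OF f]]) (rule eq)
  with solution_ell[OF f] AE_sl_int have "AE x in lebesgue_on (sl_int S). ell S ?g x - z * ?g x = 0"
    by eventually_elim simp
  moreover have "dmax ?g" by (rule dmax_cong[OF solution_dmax[OF f] eq])
  ultimately show ?thesis by (simp add: sl_kernel_def Dmax_dmax)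
qed

text \<open>\<open>Gamma0\<close> maps \<open>u2 z\<close> to a multiple of the second unit vector,
  so \<open>u2 z\<close> determines the second column of M z; then \<open>u1 z\<close> determines
  the first.\<close>

lemma Weyl_function_eq:
  assumes M: "is_Weyl_function S F M" and z: "Im z \<noteq> 0"
  shows "M z = (1 / qd0_b S F (u2 z)) *\<^sub>m
    vector [vector [- qd0_b S F (u1 z), 1], vector [1, - qd1_b S F (u2 z)]]"
proof -
  have G: "vector [qd1_a S F f, - qd1_b S F f] = M z *v vector [qd0_a S F f, qd0_b S F f]"
    if f: "sl_solution S z f" for f
  proof -
    define g where "g x = (if x \<in> sl_int S then f x else 0)" for x
    have eq: "f x = g x" if "x \<in> sl_int S" for x using that by (simp add: g_def)
    have "g \<in> sl_kernel S (Dmax S) z" unfolding g_def[abs_def] by (rule kernel_restriction[OF f])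
    then have "Gamma1 S F g = M z *v Gamma0 S F g"
      using M resolvent_set_nonreal[OF z] unfolding is_Weyl_function_def by blast
    then show ?thesis
      using qd_cong[OF solution_dmax[OF f], of g] eq by (simp add: Gamma0_def Gamma1_def)
  qed
  have comp: "qd1_a S F f = M z $ 1 $ 1 * qd0_a S F f + M z $ 1 $ 2 * qd0_b S F f"
    "- qd1_b S F f = M z $ 2 $ 1 * qd0_a S F f + M z $ 2 $ 2 * qd0_b S F f" if f: "sl_solution S z f" for f
    using G[OF f] by (simp_all add: vec_eq_iff forall_2 matrix_vector_mult_def sum_2)
  note b = u2_rend_nonzero[OF z]
  have m: "M z $ 1 $ 1 + M z $ 1 $ 2 * qd0_b S F (u1 z) = 0"
    "- qd1_b S F (u1 z) = M z $ 2 $ 1 + M z $ 2 $ 2 * qd0_b S F (u1 z)"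
    "M z $ 1 $ 2 * qd0_b S F (u2 z) = 1" "M z $ 2 $ 2 * qd0_b S F (u2 z) = - qd1_b S F (u2 z)"
    using comp[OF fund(1)] comp[OF fund(4)] by (simp_all add: fund)
  have m12: "M z $ 1 $ 2 = 1 / qd0_b S F (u2 z)" and m22: "M z $ 2 $ 2 = - qd1_b S F (u2 z) / qd0_b S F (u2 z)"
    using m(3,4) b by (simp_all add: field_simps)
  have m11: "M z $ 1 $ 1 = - qd0_b S F (u1 z) / qd0_b S F (u2 z)"
    using m(1) unfolding m12 by (simp add: eq_neg_iff_add_eq_0)
  have "M z $ 2 $ 1 = - qd1_b S F (u1 z) - M z $ 2 $ 2 * qd0_b S F (u1 z)" using m(2) by simp
  also have "\<dots> = (qd0_b S F (u1 z) * qd1_b S F (u2 z) - qd1_b S F (u1 z) * qd0_b S F (u2 z)) / qd0_b S F (u2 z)"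
    using b unfolding m22 by (simp add: field_simps)
  \<comment> \<open>The numerator is the Wronskian of \<open>u1 z\<close> and \<open>u2 z\<close> at
    the right end, hence 1, and the matrix becomes symmetric.\<close>
  finally have m21: "M z $ 2 $ 1 = 1 / qd0_b S F (u2 z)" unfolding fund_rend .
  show ?thesis
    by (simp add: vec_eq_iff forall_2 mat_scale_def map_matrix_def m11 m12 m21 m22)
qed

lemma kernel_dom_L0:
  assumes "f \<in> sl_kernel S (dom_L0 S F) z"
  shows "f x = (if x \<in> sl_int S then qd1_a S F f * u2 z x else 0)"
proof -
  have f: "dmax f" "qd0_a S F f = 0" "\<And>x. x \<notin> sl_int S \<Longrightarrow> f x = 0"
    "AE x in lebesgue_on (sl_int S). ell S f x - z * f x = 0"
    using assms by (auto simp: sl_kernel_def dom_L0_def Dmax_dmax)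
  then have "sl_solution S z f" by (simp add: sl_solution_def dmax_D)
  from solution_expansion[OF this, of x] f show ?thesis by auto
qed

lemma eigenvalue_simple:
  assumes "sl_eigenvalue S (dom_L0 S F) z"
  shows "sl_multiplicity S (dom_L0 S F) z = 1"
proof -
  obtain f where f: "f \<in> sl_kernel S (dom_L0 S F) z" "f \<noteq> 0"
    using assms by (auto simp: sl_eigenvalue_def)
  have nz: "qd1_a S F f \<noteq> 0"
  proof
    assume 0: "qd1_a S F f = 0"
    have "f x = 0" for x unfolding kernel_dom_L0[OF f(1), of x] by (simp add: 0)
    then have "f = 0" by (simp add: fun_eq_iff)
    with f(2) show False by contradiction
  qed
  show ?thesis
    unfolding sl_multiplicity_def
  proof (rule cfun.dim_unique)
    show "{f} \<subseteq> sl_kernel S (dom_L0 S F) z" using f(1) by simp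
    show "sl_kernel S (dom_L0 S F) z \<subseteq> cfun.span {f}"
    proof
      fix k assume k: "k \<in> sl_kernel S (dom_L0 S F) z"
      \<comment> \<open>Both functions are multiples of \<open>u2 z\<close> with their first
        quasi-derivatives at the left end as factors.\<close>
      have "k = (\<lambda>x. (qd1_a S F k / qd1_a S F f) * f x)"
      proof
        fix x
        show "k x = (qd1_a S F k / qd1_a S F f) * f x"
          unfolding kernel_dom_L0[OF k, of x] kernel_dom_L0[OF f(1), of x] using nz by simp
      qed
      then show "k \<in> cfun.span {f}" using cfun.span_scale[OF cfun.span_base[of f "{f}"]] by (metis insertI1)
    qed
    show "\<not> cfun.dependent {f}" using f(2) by (simp add: cfun.dependent_single)
  qed simp
qed

end

section \<open>Point masses of Herglotz measures\<close>

lemma mat_scale_component [simp]: "(c *\<^sub>m A) $ i $ j = c * A $ i $ j"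
  by (simp add: mat_scale_def map_matrix_def)

lemma quad_double_sum: "quad A \<xi> = (\<Sum>i\<in>UNIV. \<Sum>j\<in>UNIV. cnj (\<xi> $ i) * A $ i $ j * \<xi> $ j)"
  by (simp add: quad_def matrix_vector_mult_def sum_distrib_left mult.assoc)

lemma quad_hermitian_real:
  assumes "hermitian A"
  shows "Im (quad A \<xi>) = 0"
proof -
  have h: "cnj (A $ i $ j) = A $ j $ i" for i j using assms by (metis hermitian_def)
  have "cnj (quad A \<xi>) = (\<Sum>i\<in>UNIV. \<Sum>j\<in>UNIV. cnj (\<xi> $ j) * A $ j $ i * \<xi> $ i)"
    unfolding quad_double_sum by (simp add: h mult_ac)
  also have "\<dots> = quad A \<xi>" unfolding quad_double_sum by (rule sum.swap)
  finally show ?thesis by (simp add: complex_eq_iff)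
qed

text \<open>Transports convergent series of matrices to series of real numbers, which gives
  countable additivity of the scalar set functions.\<close>

lemma bounded_linear_Re_quad: "bounded_linear (\<lambda>A. Re (quad A \<xi>))"
proof (rule linear_conv_bounded_linear[THEN iffD1], rule linearI)
  show "Re (quad (A + B) \<xi>) = Re (quad A \<xi>) + Re (quad B \<xi>)" for A B
    by (simp add: quad_double_sum distrib_left distrib_right sum.distrib)
  show "Re (quad (r *\<^sub>R A) \<xi>) = r *\<^sub>R Re (quad A \<xi>)" for r A
  proof -
    have "quad (r *\<^sub>R A) \<xi> = r *\<^sub>R quad A \<xi>" by (simp add: quad_double_sum scaleR_sum_right)
    then show ?thesis by simp
  qed
qed

lemma axis_sum:
  fixes X :: "'n::finite \<Rightarrow> complex"
  shows "(\<Sum>l\<in>UNIV. cnj (axis j a $ l) * X l) = cnj a * X j" "(\<Sum>l\<in>UNIV. X l * axis j a $ l) = X j * a"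
  by (simp_all add: axis_def if_distrib if_distribR cong: if_cong)

lemma quad_axis:
  fixes A :: "complex^'n::finite^'n"
  shows "quad A (axis j 1 + axis i \<omega>) =
    A $ j $ j + \<omega> * A $ j $ i + cnj \<omega> * A $ i $ j + cnj \<omega> * \<omega> * A $ i $ i"
proof -
  have "quad A (axis j 1 + axis i \<omega>) =
    (\<Sum>k\<in>UNIV. cnj (axis j 1 $ k) * (\<Sum>l\<in>UNIV. A $ k $ l * axis j 1 $ l)) +
    (\<Sum>k\<in>UNIV. cnj (axis j 1 $ k) * (\<Sum>l\<in>UNIV. A $ k $ l * axis i \<omega> $ l)) +
    ((\<Sum>k\<in>UNIV. cnj (axis i \<omega> $ k) * (\<Sum>l\<in>UNIV. A $ k $ l * axis j 1 $ l)) +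
    (\<Sum>k\<in>UNIV. cnj (axis i \<omega> $ k) * (\<Sum>l\<in>UNIV. A $ k $ l * axis i \<omega> $ l)))"
    by (simp add: quad_def matrix_vector_mult_def distrib_left distrib_right sum.distrib)
  then show ?thesis unfolding axis_sum by (simp add: mult_ac)
qed

text \<open>For the fourth roots of unity the sums of \<omega> and of \<omega>^2 vanish, so only the
  term with \<omega> * cnj \<omega> = 1 survives.\<close>

lemma polarisation:
  fixes A :: "complex^'n::finite^'n"
  shows "(\<Sum>k<4. \<i> ^ k * quad A (axis j 1 + axis i (\<i> ^ k))) / 4 = A $ i $ j"
proof -
  have "{..<4::nat} = {0, 1, 2, 3}" by auto
  then show ?thesis by (simp add: quad_axis power3_eq_cube algebra_simps)
qed

text \<open>The values given to \<open>measure_of\<close> are its measure once they are shown to be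
  countably additive. On bounded sets additivity is inherited from \<mu>; truncations increase with
  n, so the supremum may be exchanged with the series.\<close>

lemma emeasure_quad_measure:
  assumes \<mu>: "matrix_measure \<mu>" and A: "A \<in> sets borel"
  shows "emeasure (quad_measure \<mu> \<xi>) A = (SUP n::nat. ennreal (Re (quad (\<mu> (A \<inter> {- real n..real n})) \<xi>)))"
proof (rule emeasure_measure_of[OF quad_measure_def])
  let ?q = "\<lambda>A. Re (quad (\<mu> A) \<xi>)"
  let ?\<nu> = "\<lambda>A. SUP n::nat. ennreal (?q (A \<inter> {- real n..real n}))"
  have sets: "sets (quad_measure \<mu> \<xi>) = sets borel"
    by (simp add: quad_measure_def sets.sigma_sets_eq[of borel, simplified])
  then show "A \<in> sets (quad_measure \<mu> \<xi>)" using A by simp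
  have nonneg: "0 \<le> ?q A" if "A \<in> sets borel" "bounded A" for A
    using \<mu> that by (auto simp: matrix_measure_def psd_def)
  have sums: "(\<lambda>i. ?q (X i)) sums ?q (\<Union>i. X i)"
    if "range X \<subseteq> sets borel" "disjoint_family X" "bounded (\<Union>i. X i)" for X :: "nat \<Rightarrow> real set"
    by (rule bounded_linear.sums[OF bounded_linear_Re_quad]) (use \<mu> that in \<open>auto simp: matrix_measure_def\<close>)
  \<comment> \<open>The empty set is the disjoint union of countably many copies of itself, and a
    constant series converges only if its terms are 0.\<close>
  have empty: "?q {} = 0"
  proof -
    have "(\<lambda>i::nat. ?q {}) sums ?q {}" using sums[of "\<lambda>i. {}"] by (simp add: disjoint_family_on_def)
    from sums_summable[OF this] show ?thesis by (simp add: summable_const_iff)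
  qed
  \<comment> \<open>Finite additivity is extracted from countable additivity with the sequence A, B
    - A, {}, {}, and so on.\<close>
  have mono: "?q A \<le> ?q B" if "A \<in> sets borel" "B \<in> sets borel" "A \<subseteq> B" "bounded B" for A B
  proof -
    have "(\<lambda>i. ?q (binaryset A (B - A) i)) sums ?q (\<Union>i. binaryset A (B - A) i)"
    proof (rule sums)
      show "disjoint_family (binaryset A (B - A))"
        by (auto simp: disjoint_family_on_def binaryset_def)
    qed (use that in \<open>auto simp: UN_binaryset_eq range_binaryset_eq Un_absorb1\<close>)
    moreover have "(\<lambda>i. ?q (binaryset A (B - A) i)) sums (?q A + ?q (B - A))"
      by (rule binaryset_sums[of ?q]) (rule empty)
    moreover have "(\<Union>i. binaryset A (B - A) i) = B" using that by (auto simp: UN_binaryset_eq)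
    ultimately have "?q B = ?q A + ?q (B - A)" by (metis sums_unique2)
    moreover have "0 \<le> ?q (B - A)" using that by (intro nonneg) (auto intro: bounded_subset)
    ultimately show ?thesis by simp
  qed
  show "positive (sets (quad_measure \<mu> \<xi>)) ?\<nu>" by (simp add: positive_def empty)
  show "countably_additive (sets (quad_measure \<mu> \<xi>)) ?\<nu>"
    unfolding sets
  proof (rule countably_additiveI)
    fix X :: "nat \<Rightarrow> real set"
    assume X: "range X \<subseteq> sets borel" "disjoint_family X" "(\<Union>i. X i) \<in> sets borel"
    have bX: "X i \<inter> {- real n..real n} \<in> sets borel" "bounded (Y \<inter> {- real n..real n})" for i n Y
      using X(1) by (auto intro: bounded_subset[OF bounded_closed_interval])
    have "(\<Sum>i. ?\<nu> (X i)) = (SUP n. \<Sum>i. ennreal (?q (X i \<inter> {- real n..real n})))"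
    proof (rule ennreal_suminf_SUP_eq)
      show "incseq (\<lambda>n. ennreal (?q (X i \<inter> {- real n..real n})))" for i
        unfolding incseq_def by (intro allI impI ennreal_leI mono bX) auto
    qed
    also have "\<dots> = ?\<nu> (\<Union>i. X i)"
    proof (rule SUP_cong[OF refl])
      fix n
      have "(\<lambda>i. ?q (X i \<inter> {- real n..real n})) sums ?q (\<Union>i. X i \<inter> {- real n..real n})"
      proof (rule sums)
        show "disjoint_family (\<lambda>i. X i \<inter> {- real n..real n})"
          using X(2) by (auto simp: disjoint_family_on_def)
        have "(\<Union>i. X i \<inter> {- real n..real n}) = (\<Union>i. X i) \<inter> {- real n..real n}" by blast
        then show "bounded (\<Union>i. X i \<inter> {- real n..real n})" by (simp only: bX)
      qed (use bX in auto)
      moreover have "(\<Union>i. X i \<inter> {- real n..real n}) = (\<Union>i. X i) \<inter> {- real n..real n}" by blast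
      ultimately have s: "(\<lambda>i. ?q (X i \<inter> {- real n..real n})) sums ?q ((\<Union>i. X i) \<inter> {- real n..real n})" by simp
      have "(\<lambda>i. ennreal (?q (X i \<inter> {- real n..real n}))) sums ennreal (?q ((\<Union>i. X i) \<inter> {- real n..real n}))"
        by (subst sums_ennreal) (use s nonneg bX X(3) in auto)
      then show "(\<Sum>i. ennreal (?q (X i \<inter> {- real n..real n}))) = ennreal (?q ((\<Union>i. X i) \<inter> {- real n..real n}))"
        by (rule sums_unique[symmetric])
    qed
    finally show "(\<Sum>i. ?\<nu> (X i)) = ?\<nu> (\<Union>i. X i)" .
  qed
qed simp

lemma sets_quad_measure [simp]: "sets (quad_measure \<mu> \<xi>) = sets borel"
  by (simp add: quad_measure_def sets.sigma_sets_eq[of borel, simplified])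

lemma matrix_measure_empty:
  assumes "matrix_measure \<mu>"
  shows "\<mu> {} = 0"
proof -
  have "(\<lambda>i::nat. \<mu> {}) sums \<mu> {}"
    using assms unfolding matrix_measure_def by (auto simp: disjoint_family_on_def dest!: spec[of _ "\<lambda>i. {}"])
  from sums_summable[OF this] show ?thesis by (simp add: summable_const_iff)
qed

text \<open>The truncations of {t} are empty until n reaches \<bar>t\<bar> and equal to {t}
  afterwards, so the supremum is attained.\<close>

lemma measure_quad_measure_singleton:
  assumes \<mu>: "matrix_measure \<mu>"
  shows "of_real (measure (quad_measure \<mu> \<xi>) {t}) = quad (\<mu> {t}) \<xi>"
proof -
  have psd: "psd (\<mu> {t})" using \<mu> by (simp add: matrix_measure_def)
  let ?q = "\<lambda>A. Re (quad (\<mu> A) \<xi>)"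
  have "emeasure (quad_measure \<mu> \<xi>) {t} = (SUP n::nat. ennreal (?q ({t} \<inter> {- real n..real n})))"
    by (rule emeasure_quad_measure[OF \<mu>]) simp
  also have "\<dots> = ennreal (?q {t})"
  proof (rule antisym)
    show "(SUP n::nat. ennreal (?q ({t} \<inter> {- real n..real n}))) \<le> ennreal (?q {t})"
    proof (rule SUP_least)
      fix n :: nat
      show "ennreal (?q ({t} \<inter> {- real n..real n})) \<le> ennreal (?q {t})"
        by (cases "t \<in> {- real n..real n}") (simp_all add: matrix_measure_empty[OF \<mu>] quad_double_sum)
    qed
    obtain n :: nat where "\<bar>t\<bar> \<le> real n" using real_arch_simple by blast
    then have "{t} \<inter> {- real n..real n} = {t}" by auto
    then show "ennreal (?q {t}) \<le> (SUP n::nat. ennreal (?q ({t} \<inter> {- real n..real n})))"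
      by (intro SUP_upper2[of n]) auto
  qed
  finally have "measure (quad_measure \<mu> \<xi>) {t} = ?q {t}"
    using psd by (simp add: measure_def psd_def)
  then show ?thesis
    using quad_hermitian_real[of "\<mu> {t}" \<xi>] psd by (simp add: complex_eq_iff psd_def)
qed

text \<open>Over the common denominator the kernel is ((1 + z^2) / (s - z) + z) / (1 + s^2). The
  factor \<epsilon> compensates \<bar>s - z\<bar> \<ge> \<epsilon>, and m bounds \<bar>z\<bar> for
  all \<epsilon> < 1, so the bound is uniform in \<epsilon>.\<close>

lemma Herglotz_kernel_bound:
  fixes t s \<epsilon> :: real
  assumes \<epsilon>: "0 < \<epsilon>" "\<epsilon> < 1"
  defines "z \<equiv> of_real t + \<i> * of_real \<epsilon>" and "m \<equiv> \<bar>t\<bar> + 1"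
  shows "norm (- \<i> * of_real \<epsilon> * (1 / (of_real s - z) - of_real s / (1 + (of_real s)\<^sup>2)))
    \<le> (1 + m\<^sup>2 + m) * (1 / (1 + s\<^sup>2))"
proof -
  have z: "norm z \<le> m"
  proof -
    have "norm z \<le> norm (of_real t :: complex) + norm (\<i> * of_real \<epsilon>)" unfolding z_def by (rule norm_triangle_ineq)
    then show ?thesis using \<epsilon> by (simp add: m_def norm_mult)
  qed
  have sz: "\<epsilon> \<le> norm (of_real s - z)"
    using abs_Im_le_cmod[of "of_real s - z"] \<epsilon> by (simp add: z_def)
  have ne: "of_real s - z \<noteq> 0" using sz \<epsilon> by auto
  have s2: "1 + s\<^sup>2 > 0" by (simp add: add_pos_nonneg)
  have s2c: "1 + (of_real s :: complex)\<^sup>2 = of_real (1 + s\<^sup>2)" by simp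
  have ne2: "of_real (1 + s\<^sup>2) \<noteq> (0 :: complex)" using s2 by (simp only: of_real_eq_0_iff)
  have eq: "1 / (of_real s - z) - of_real s / (1 + (of_real s)\<^sup>2)
     = ((1 + z\<^sup>2) / (of_real s - z) + z) / of_real (1 + s\<^sup>2)"
  proof -
    have "1 / (of_real s - z) - of_real s / of_real (1 + s\<^sup>2)
      = (of_real (1 + s\<^sup>2) - of_real s * (of_real s - z)) / ((of_real s - z) * of_real (1 + s\<^sup>2))"
      using diff_frac_eq[OF ne ne2, of 1 "of_real s"] by (simp only: mult_1)
    also have "of_real (1 + s\<^sup>2) - of_real s * (of_real s - z) = (1 + z\<^sup>2) + z * (of_real s - z)"
      by (simp add: algebra_simps power2_eq_square)
    also have "\<dots> / ((of_real s - z) * of_real (1 + s\<^sup>2)) = ((1 + z\<^sup>2) / (of_real s - z) + z) / of_real (1 + s\<^sup>2)"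
      using ne by (simp add: add_divide_distrib)
    finally show ?thesis unfolding s2c .
  qed
  have "norm ((1 + z\<^sup>2) / (of_real s - z) + z) \<le> norm (1 + z\<^sup>2) / norm (of_real s - z) + norm z"
    by (metis norm_divide norm_triangle_ineq)
  also have "\<dots> \<le> (1 + m\<^sup>2) / \<epsilon> + m"
  proof (intro add_mono frac_le z sz)
    have "norm (1 + z\<^sup>2) \<le> 1 + (norm z)\<^sup>2" by (metis norm_one norm_power norm_triangle_ineq)
    also have "\<dots> \<le> 1 + m\<^sup>2" using z by (simp add: power_mono)
    finally show "norm (1 + z\<^sup>2) \<le> 1 + m\<^sup>2" .
  qed (use \<epsilon> in auto)
  finally have "\<epsilon> * norm ((1 + z\<^sup>2) / (of_real s - z) + z) \<le> \<epsilon> * ((1 + m\<^sup>2) / \<epsilon> + m)"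
    using \<epsilon> by (intro mult_left_mono) auto
  also have "\<dots> = 1 + m\<^sup>2 + \<epsilon> * m" using \<epsilon> by (simp add: field_simps)
  also have "\<dots> \<le> 1 + m\<^sup>2 + m" using \<epsilon> mult_right_mono[of \<epsilon> 1 m] by (simp add: m_def)
  finally have "\<epsilon> * norm ((1 + z\<^sup>2) / (of_real s - z) + z) / (1 + s\<^sup>2) \<le> (1 + m\<^sup>2 + m) / (1 + s\<^sup>2)"
    using s2 by (intro divide_right_mono) auto
  then show ?thesis unfolding eq norm_mult norm_divide norm_of_real using \<epsilon> s2 by simp
qed

lemma point_mass_limit:
  fixes M :: "real measure"
  assumes M: "sets M = sets borel" "integrable M (\<lambda>s. 1 / (1 + s\<^sup>2))"
  shows "((\<lambda>\<epsilon>::real. - \<i> * of_real \<epsilon> *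
      (LINT s|M. 1 / (of_real s - (of_real t + \<i> * of_real \<epsilon>)) - of_real s / (1 + (of_real s)\<^sup>2)))
    \<longlongrightarrow> complex_of_real (measure M {t})) (at_right 0)"
\<comment> \<open>Sequences in (0, 1): dominated convergence needs a sequence, and the uniform bound
  needs \<epsilon> < 1.\<close>
proof (rule tendsto_at_right_sequentially)
  show "(0::real) < 1" by simp
  fix e :: "nat \<Rightarrow> real" assume e: "\<And>n. 0 < e n" "\<And>n. e n < 1" "e \<longlonglongrightarrow> 0"
  define m where "m = \<bar>t\<bar> + 1"
  let ?k = "\<lambda>n s. - \<i> * of_real (e n) * (1 / (of_real s - (of_real t + \<i> * of_real (e n))) - of_real s / (1 + (of_real s)\<^sup>2))"
  have meas: "f \<in> borel_measurable M" if "f \<in> borel_measurable borel" for f :: "real \<Rightarrow> complex"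
    using that M(1) measurable_cong_sets by blast
  have "(\<lambda>n. LINT s|M. ?k n s) \<longlonglongrightarrow> (LINT s|M. complex_of_real (indicator {t} s))"
  proof (rule integral_dominated_convergence)
    show "(\<lambda>s. complex_of_real (indicator {t} s)) \<in> borel_measurable M" by (rule meas) measurable
    show "?k n \<in> borel_measurable M" for n by (rule meas) measurable
    show "integrable M (\<lambda>s. (1 + m\<^sup>2 + m) * (1 / (1 + s\<^sup>2)))" using M(2) by (rule integrable_mult_right)
    show "AE s in M. norm (?k n s) \<le> (1 + m\<^sup>2 + m) * (1 / (1 + s\<^sup>2))" for n
      unfolding m_def using Herglotz_kernel_bound[OF e(1,2)] by (intro AE_I2)
    have lim: "(\<lambda>n. ?k n s) \<longlonglongrightarrow> complex_of_real (indicator {t} s)" for s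
    proof (cases "s = t")
      case True
      \<comment> \<open>Here s - z = -i \<epsilon>, so the singular part contributes exactly 1 and
        the regularising part is of order \<epsilon>.\<close>
      have "?k n s = 1 + \<i> * of_real (e n) * (of_real s / (1 + (of_real s)\<^sup>2))" for n
        using True e(1)[of n] by (simp add: field_simps)
      moreover have "(\<lambda>n. 1 + \<i> * of_real (e n) * (of_real s / (1 + (of_real s)\<^sup>2)))
          \<longlonglongrightarrow> 1 + \<i> * of_real 0 * (of_real s / (1 + (of_real s)\<^sup>2))"
        by (intro tendsto_intros e)
      ultimately show ?thesis using True by simp
    next
      case False
      have "(\<lambda>n. ?k n s) \<longlonglongrightarrow> - \<i> * of_real 0 * (1 / (of_real s - (of_real t + \<i> * of_real 0)) - of_real s / (1 + (of_real s)\<^sup>2))"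
        using False by (intro tendsto_intros e) auto
      then show ?thesis using False by simp
    qed
    then show "AE s in M. (\<lambda>n. ?k n s) \<longlonglongrightarrow> complex_of_real (indicator {t} s)" by (intro AE_I2)
  qed
  also have "(LINT s|M. complex_of_real (indicator {t} s)) = of_real (measure M {t})"
    using M(1) sets_eq_imp_space_eq[OF M(1)] by (simp add: integral_complex_of_real)
  finally show "(\<lambda>n. - \<i> * of_real (e n) *
      (LINT s|M. 1 / (of_real s - (of_real t + \<i> * of_real (e n))) - of_real s / (1 + (of_real s)\<^sup>2)))
     \<longlonglongrightarrow> of_real (measure M {t})"
    by (simp only: integral_mult_right_zero)
qed

text \<open>Entry by entry, polarisation reduces the claim to \<open>point_mass_limit\<close> for
  four positive measures. The terms with C and D stay bounded near t and are killed by the factor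
  \<epsilon>.\<close>

lemma Herglotz_point_mass:
  fixes M :: "complex \<Rightarrow> complex^'n::finite^'n"
  assumes "Herglotz_rep M C D \<mu>"
  shows "((\<lambda>\<epsilon>::real. (- \<i> * of_real \<epsilon>) *\<^sub>m M (of_real t + \<i> * of_real \<epsilon>)) \<longlongrightarrow> \<mu> {t}) (at_right 0)"
proof (rule vec_tendstoI, rule vec_tendstoI)
  fix i j :: 'n
  have \<mu>: "matrix_measure \<mu>" and int: "\<And>\<xi>. integrable (quad_measure \<mu> \<xi>) (\<lambda>s. 1 / (1 + s\<^sup>2))"
    and rep: "\<And>z. Im z > 0 \<Longrightarrow> M z = C + z *\<^sub>m D +
        mat_integral \<mu> (\<lambda>s. 1 / (of_real s - z) - of_real s / (1 + (of_real s)\<^sup>2))"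
    using assms unfolding Herglotz_rep_def by blast+
  let ?z = "\<lambda>\<epsilon>::real. of_real t + \<i> * of_real \<epsilon>"
  let ?\<xi> = "\<lambda>k. axis j 1 + axis i (\<i> ^ k)"
  let ?J = "\<lambda>\<epsilon> k. (LINT s|quad_measure \<mu> (?\<xi> k). 1 / (of_real s - ?z \<epsilon>) - of_real s / (1 + (of_real s)\<^sup>2))"
  have "((\<lambda>\<epsilon>::real. - \<i> * of_real \<epsilon> * (C $ i $ j + ?z \<epsilon> * D $ i $ j) +
      (\<Sum>k<4. \<i> ^ k * (- \<i> * of_real \<epsilon> * ?J \<epsilon> k)) / 4)
    \<longlongrightarrow> - \<i> * of_real 0 * (C $ i $ j + ?z 0 * D $ i $ j) +
      (\<Sum>k<4. \<i> ^ k * of_real (measure (quad_measure \<mu> (?\<xi> k)) {t})) / 4) (at_right 0)"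
    by (intro tendsto_intros point_mass_limit int sets_quad_measure) simp_all
  also have "- \<i> * of_real 0 * (C $ i $ j + ?z 0 * D $ i $ j) +
      (\<Sum>k<4. \<i> ^ k * of_real (measure (quad_measure \<mu> (?\<xi> k)) {t})) / 4 = \<mu> {t} $ i $ j"
    unfolding measure_quad_measure_singleton[OF \<mu>] polarisation by simp
  finally show "((\<lambda>\<epsilon>. ((- \<i> * of_real \<epsilon>) *\<^sub>m M (?z \<epsilon>)) $ i $ j) \<longlongrightarrow> \<mu> {t} $ i $ j) (at_right 0)"
  proof (rule Lim_transform_eventually)
    show "\<forall>\<^sub>F \<epsilon> in at_right 0. - \<i> * of_real \<epsilon> * (C $ i $ j + ?z \<epsilon> * D $ i $ j) +
      (\<Sum>k<4. \<i> ^ k * (- \<i> * of_real \<epsilon> * ?J \<epsilon> k)) / 4 = ((- \<i> * of_real \<epsilon>) *\<^sub>m M (?z \<epsilon>)) $ i $ j"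
      using eventually_at_right_less[of "0::real"]
    proof eventually_elim
      case (elim \<epsilon>)
      have "Im (?z \<epsilon>) > 0" using elim by simp
      from rep[OF this] have "M (?z \<epsilon>) $ i $ j = C $ i $ j + ?z \<epsilon> * D $ i $ j + (\<Sum>k<4. \<i> ^ k * ?J \<epsilon> k) / 4"
        by (simp add: mat_integral_def)
      then show ?case
        by (simp only: mat_scale_component) (simp only: distrib_left sum_distrib_left times_divide_eq_right mult.left_commute)
    qed
  qed
qed

theorem theorem5p2:
  fixes S :: sl_data and F :: sl_frame and K lam0 :: real
    and u1 u2 :: "complex \<Rightarrow> real \<Rightarrow> complex"
    and M0 :: "complex \<Rightarrow> complex^2^2" and C D :: "complex^2^2"
    and \<mu> :: "real set \<Rightarrow> complex^2^2"
  assumes "sl_coeffs S"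
    and "limit_circle_a S" and "limit_circle_b S"
    and "bounded_below S (Dmin S) K"
    and "is_frame S lam0 F"
    and "fundamental_system S F u1 u2"
    and "is_Weyl_function S F M0"
    and "Herglotz_rep M0 C D \<mu>"
  shows "(\<forall>lam::real. sl_eigenvalue S (dom_L0 S F) (of_real lam) \<longrightarrow>
            ((\<lambda>\<epsilon>::real. let z = of_real lam + \<i> * of_real \<epsilon> in
                (- \<i> * of_real \<epsilon> * (1 / qd0_b S F (u2 z))) *\<^sub>m
                  vector [vector [- qd0_b S F (u1 z), 1],
                          vector [1, - qd1_b S F (u2 z)]])
              \<longlongrightarrow> \<mu> {lam}) (at_right 0)) \<and>
         (\<forall>z::complex. sl_eigenvalue S (dom_L0 S F) z \<longrightarrow>
            sl_multiplicity S (dom_L0 S F) z = 1)"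
proof (intro conjI allI impI)
  interpret sl_problem S F lam0 u1 u2
    using assms by unfold_locales
  show "sl_multiplicity S (dom_L0 S F) z = 1" if "sl_eigenvalue S (dom_L0 S F) z" for z
    using that by (rule eigenvalue_simple)
  fix lam :: real
  show "((\<lambda>\<epsilon>::real. let z = of_real lam + \<i> * of_real \<epsilon> in
          (- \<i> * of_real \<epsilon> * (1 / qd0_b S F (u2 z))) *\<^sub>m
            vector [vector [- qd0_b S F (u1 z), 1], vector [1, - qd1_b S F (u2 z)]])
        \<longlongrightarrow> \<mu> {lam}) (at_right 0)"
  proof (rule Lim_transform_eventually[OF Herglotz_point_mass[OF assms(8), of lam]])
    have scale: "a *\<^sub>m (b *\<^sub>m A) = (a * b) *\<^sub>m A" for a b and A :: "complex^2^2"
      by (simp add: vec_eq_iff mult.assoc)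
    \<comment> \<open>For \<epsilon> > 0 the point is non-real, where the closed form of the Weyl
      function is available.\<close>
    show "\<forall>\<^sub>F \<epsilon> in at_right 0. (- \<i> * of_real \<epsilon>) *\<^sub>m M0 (of_real lam + \<i> * of_real \<epsilon>) =
        (let z = of_real lam + \<i> * of_real \<epsilon> in
          (- \<i> * of_real \<epsilon> * (1 / qd0_b S F (u2 z))) *\<^sub>m
            vector [vector [- qd0_b S F (u1 z), 1], vector [1, - qd1_b S F (u2 z)]])"
      using eventually_at_right_less[of "0::real"]
    proof eventually_elim
      case (elim \<epsilon>)
      have "Im (of_real lam + \<i> * of_real \<epsilon>) \<noteq> 0" using elim by simp
      from Weyl_function_eq[OF assms(7) this] show ?case by (simp only: Let_def scale)
    qed
  qed
qed

end
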